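(* Let $\mu$ be a law on $\mathbb{R}$ with finite second moment, centered and different from $\delta_0$, and let $\vartheta^2\in(0,\infty)$ be its variance. Then, as $J\to\infty$, $$-\frac12F'_\mu(J)=\frac{\vartheta^2}{4J^2}+O(\varepsilon_J),$$ where $\varepsilon_J$ is equal, - if $\mu$ is the centered Gaussian law with variance $\vartheta^2$, to $\dfrac{(\log J)^{1/4}}{J^{5/2}}$; - if $\mu$ admits finite exponential moments (i.e. $\int e^{tx}\,\mu(dx)<\infty$ for all $t$ in a neighbourhood of $0$), to $\dfrac{(\log J)^{1/6}}{J^{13/6}}$; - if $\int|x|^p\,\mu(dx)<\infty$ for a given $p\in[2,\infty)$, to $\dfrac{1}{J^{\frac{3+\eta_p}{2}}}$ when $p\in\big(\frac{3+\sqrt5}{2},\infty\big)$ and to $\dfrac{1}{J^{\eta_p+1}}$ when $p\in\big[2,\frac{3+\sqrt5}{2}\big]$, where $\eta_p:=\frac{4p}{3p+2}$ for $p\in[3,\infty)$ and $\eta_p:=\frac{2p(p-1)}{p^2+p-1}$ for $p\in[2,3)$.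
   Context: Let $\mathbb{N}=\{1,2,\dots\}$. For a law $\mu$ on $\mathbb{R}$ with finite first moment, let $h=(h_n)_{n\in\mathbb{N}}$ be, under $\mathbb{P}_\mu$, an i.i.d. sequence of real random variables with law $\mu$. For $N\in\mathbb{N}$, $(a,b)\in\{-1,+1\}^2$ and real $J$, the partition function of the Ising chain with external field $h$ is $$Z_{N,h}^{a,b}(J):=\sum_{\substack{\sigma\in\{-1,1\}^{\{0,1,\dots,N\}}\\ \sigma_0=a,\ \sigma_N=b}}\exp\Big(-2J\sum_{n=1}^N\mathbf 1_{\{\sigma_n\ne\sigma_{n-1}\}}+\sum_{n=1}^N\sigma_nh_n\Big).$$ The free energy density $F_\mu(J)$ is the deterministic real number such that, $\mathbb{P}_\mu$-almost surely, for every $(a,b)\in\{-1,+1\}^2$, $\frac1N\log Z_{N,h}^{a,b}(J)\to F_\mu(J)$ as $N\to\infty$ (this limit exists by Kingman's subadditive ergodic theorem). It is a known fact (Furstenberg's theory and results of Ruelle on products of random matrices) that $F_\mu$ is analytic on $(0,\infty)$; $F'_\mu$ denotes its derivative there. *)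

theory Defs
  imports "HOL-Probability.Probability" "HOL-Library.Landau_Symbols"
begin

definition spin_configs :: "nat \<Rightarrow> real \<Rightarrow> real \<Rightarrow> (nat \<Rightarrow> real) set" where
  "spin_configs N a b = {\<sigma> \<in> {0..N} \<rightarrow>\<^sub>E {-1, 1}. \<sigma> 0 = a \<and> \<sigma> N = b}"

definition ising_Z :: "nat \<Rightarrow> (nat \<Rightarrow> real) \<Rightarrow> real \<Rightarrow> real \<Rightarrow> real \<Rightarrow> real" where
  "ising_Z N h a b J =
     (\<Sum>\<sigma>\<in>spin_configs N a b.
        exp (- 2 * J * (\<Sum>n = 1..N. of_bool (\<sigma> n \<noteq> \<sigma> (n - 1))) + (\<Sum>n = 1..N. \<sigma> n * h n)))"

text \<open>The field is realised canonically, as the coordinate process under the infinite product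
  of copies of \<open>\<mu>\<close> indexed by the positive integers.\<close>

definition iid_field :: "real measure \<Rightarrow> (nat \<Rightarrow> real) measure" where
  "iid_field \<mu> = (\<Pi>\<^sub>M n\<in>{1..}. \<mu>)"

definition free_energy :: "real measure \<Rightarrow> real \<Rightarrow> real" where
  "free_energy \<mu> J =
     (THE F. AE h in iid_field \<mu>. \<forall>a\<in>{-1, 1}. \<forall>b\<in>{-1, 1}.
        (\<lambda>N. ln (ising_Z N h a b J) / real N) \<longlonglongrightarrow> F)"

definition eta :: "real \<Rightarrow> real" where
  "eta p = (if p \<ge> 3 then 4 * p / (3 * p + 2) else 2 * p * (p - 1) / (p\<^sup>2 + p - 1))"

end

theory Submission
  imports Defs "HOL-Library.Discrete_Functions"
begin

text \<open>
  Write \<open>c = 2 J\<close>. The logarithmic ratio of the two boundary partition functions is a Markov chain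
  driven by the field: a random walk with steps \<open>2 h\<close>, softly reflected at \<open>\<plusminus> c\<close>. Each step contracts, so
  the chain has a stationary law, and the free energy is the mean push \<open>F\<close> at either barrier under
  that law. Stationarity of the square of the chain gives \<open>4 \<theta>\<^sup>2 = 4 c F + error\<close>, where the error only
  involves the behaviour beyond the barriers; stationarity of exponential test functions shows that
  the chain stays within distance \<open>y\<close> of a barrier with probability \<open>O(y F)\<close>. Hence
  \<open>F = \<theta>\<^sup>2 / c + O(c powr (- 1 - r))\<close> whenever the moment of order \<open>2 + r\<close> is finite, \<open>0 < r \<le> 1\<close>. The free
  energy is convex in \<open>J\<close>, and its second differences are bounded because the chain contracts, so it is
  differentiable; comparing the derivative with difference quotients over a window of length
  \<open>J powr (1 - r / 2)\<close> gives an error \<open>O(J powr (- 2 - r / 2))\<close>;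
  finite variance alone gives \<open>O(1 / J\<^sup>2)\<close>. Neither exceeds the claimed error.
\<close>

section \<open>Softplus and the soft clamp\<close>

text \<open>A step of the chain with barriers at distance \<open>c\<close> contracts only by
  \<open>1 - sigmoid (- c)\<close>, so every bound that rests on contraction carries powers of
  \<open>exp c\<close>. Contraction is therefore used only at fixed \<open>c\<close>: for the
  stationary law, the law of large numbers and differentiability. Convexity replaces it, bracketing
  the derivative between chord slopes, which involve only values of the free energy. A chord of
  length \<open>t\<close> costs the error of these values, \<open>J powr (- 1 - r) / t\<close>, plus
  the curvature of the main term, \<open>t / J ^ 3\<close>; the two balance at
  \<open>t = J powr (1 - r / 2)\<close>. The restriction to a moment of order \<open>2 + r\<close>
  enters through jumps across a barrier: for a jump of size \<open>y\<close> the relevant states are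
  those within distance \<open>y\<close> of the barrier, and their probability is bounded at that
  very scale.\<close>

definition softplus :: "real \<Rightarrow> real" where
  "softplus x = ln (1 + exp x)"

definition sigmoid :: "real \<Rightarrow> real" where
  "sigmoid x = exp x / (1 + exp x)"

lemma one_plus_exp_pos [simp]: "0 < 1 + exp (x::real)"
  by (simp add: add_pos_pos)

lemma sigmoid_pos: "0 < sigmoid x" and sigmoid_less_1: "sigmoid x < 1"
  by (auto simp: sigmoid_def add_pos_pos)

lemma sigmoid_minus: "sigmoid (- x) = 1 - sigmoid x"
proof -
  have "1 + exp x \<noteq> 0" "1 + exp (- x) \<noteq> 0"
    by (metis add_pos_pos exp_gt_zero less_irrefl zero_less_one)+
  then show ?thesis
    by (simp add: sigmoid_def exp_minus field_simps)
qed

lemma sigmoid_mono: "x \<le> y \<Longrightarrow> sigmoid x \<le> sigmoid y"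
proof -
  assume "x \<le> y"
  have *: "sigmoid z = 1 - 1 / (1 + exp z)" for z
    using one_plus_exp_pos[of z] by (simp add: sigmoid_def eq_diff_eq add.commute less_imp_neq[symmetric] flip: add_divide_distrib)
  show ?thesis
    unfolding * using \<open>x \<le> y\<close> by (intro diff_mono divide_left_mono mult_pos_pos) auto
qed

lemma has_derivative_softplus [derivative_intros]:
  assumes "(f has_real_derivative D) (at x within A)"
  shows "((\<lambda>x. softplus (f x)) has_real_derivative sigmoid (f x) * D) (at x within A)"
  unfolding softplus_def sigmoid_def
  by (rule derivative_eq_intros assms one_plus_exp_pos refl | simp)+

lemma has_derivative_sigmoid [derivative_intros]:
  assumes "(f has_real_derivative D) (at x within A)"
  shows "((\<lambda>x. sigmoid (f x)) has_real_derivative sigmoid (f x) * (1 - sigmoid (f x)) * D) (at x within A)"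
proof -
  have *: "1 + exp (f x) \<noteq> 0" using one_plus_exp_pos[of "f x"] by linarith
  show ?thesis
    unfolding sigmoid_def
    by (rule derivative_eq_intros assms refl * | simp add: * field_simps)+
qed

lemma softplus_pos: "0 < softplus x"
  by (simp add: softplus_def)

lemma softplus_nonneg [simp]: "0 \<le> softplus x"
  using softplus_pos[of x] by simp

lemma softplus_mono: "x \<le> y \<Longrightarrow> softplus x \<le> softplus y"
  by (simp add: softplus_def)

lemma softplus_minus: "softplus x = x + softplus (- x)"
proof -
  have "ln (1 + exp x) = ln (exp x * (1 + exp (- x)))"
    by (simp add: distrib_left add.commute flip: exp_add)
  also have "\<dots> = x + ln (1 + exp (- x))"
    using one_plus_exp_pos[of "- x"] by (subst ln_mult) (auto simp del: one_plus_exp_pos)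
  finally show ?thesis by (simp add: softplus_def)
qed

lemma softplus_lipschitz: "\<bar>softplus x - softplus y\<bar> \<le> \<bar>x - y\<bar>"
proof -
  have *: "softplus x - softplus y \<le> x - y" if "y \<le> x" for x y
  proof -
    have "softplus (- x) \<le> softplus (- y)" using that by (intro softplus_mono) auto
    then show ?thesis using softplus_minus[of x] softplus_minus[of y] by linarith
  qed
  show ?thesis
    using *[of x y] *[of y x] softplus_mono[of x y] softplus_mono[of y x] by linarith
qed

lemma softplus_le_exp: "softplus x \<le> exp x"
  unfolding softplus_def by (rule ln_add_one_self_le_self) simp

lemma softplus_le: "softplus x \<le> max 0 x + 1"
proof -
  have 1: "softplus x \<le> 1" if "x \<le> 0" for x
    using softplus_le_exp[of x] that by (meson exp_le_one_iff order_trans)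
  show ?thesis
    using 1[of x] 1[of "-x"] softplus_minus[of x] by (cases "x \<le> 0") auto
qed

lemma softplus_measurable [measurable]: "softplus \<in> borel_measurable borel"
  unfolding softplus_def[abs_def] by measurable

lemma sigmoid_lipschitz: "\<bar>sigmoid x - sigmoid y\<bar> \<le> \<bar>x - y\<bar>"
proof -
  have *: "sigmoid x - sigmoid y \<le> x - y" if "y < x" for x y
  proof -
    have "\<exists>z. y < z \<and> z < x \<and> sigmoid x - sigmoid y = (x - y) * (sigmoid z * (1 - sigmoid z))"
      by (rule MVT2[OF that]) (rule derivative_eq_intros refl | simp)+
    then obtain z where z: "sigmoid x - sigmoid y = (x - y) * (sigmoid z * (1 - sigmoid z))" by blast
    have "sigmoid z * (1 - sigmoid z) \<le> 1 * 1"
      using sigmoid_pos[of z] sigmoid_less_1[of z] by (intro mult_mono) auto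
    then show ?thesis unfolding z using that
      by (metis diff_gt_0_iff_gt mult.right_neutral mult_le_cancel_left_pos)
  qed
  show ?thesis
    using *[of x y] *[of y x] sigmoid_mono[of x y] sigmoid_mono[of y x]
    by (cases x y rule: linorder_cases) auto
qed

text \<open>The mean value theorem turns the error into \<open>x - y\<close> times a difference of
  sigmoids, and the sigmoid is 1-Lipschitz. The quadratic remainder makes second differences in the
  barrier parameter quadratic.\<close>

lemma softplus_taylor: "\<bar>softplus x - softplus y - sigmoid y * (x - y)\<bar> \<le> (x - y)\<^sup>2"
proof (cases "x = y")
  case False
  have "\<exists>z. \<bar>z - y\<bar> \<le> \<bar>x - y\<bar> \<and> softplus x - softplus y = (x - y) * sigmoid z"
  proof (cases "y < x")
    case True
    have "\<exists>z. y < z \<and> z < x \<and> softplus x - softplus y = (x - y) * sigmoid z"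
      by (rule MVT2[OF True]) (rule derivative_eq_intros refl | simp)+
    then obtain z where "y < z" "z < x" "softplus x - softplus y = (x - y) * sigmoid z" by blast
    then show ?thesis by (intro exI[of _ z]) simp
  next
    case F: False
    then have "x < y" using False by auto
    have "\<exists>z. x < z \<and> z < y \<and> softplus y - softplus x = (y - x) * sigmoid z"
      by (rule MVT2[OF \<open>x < y\<close>]) (rule derivative_eq_intros refl | simp)+
    then obtain z where "x < z" "z < y" "softplus y - softplus x = (y - x) * sigmoid z" by blast
    moreover from this have "softplus x - softplus y = (x - y) * sigmoid z"
      by (simp add: algebra_simps)
    ultimately show ?thesis by (intro exI[of _ z]) simp
  qed
  then obtain z where z: "\<bar>z - y\<bar> \<le> \<bar>x - y\<bar>" "softplus x - softplus y = (x - y) * sigmoid z" by blast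
  have "\<bar>softplus x - softplus y - sigmoid y * (x - y)\<bar> = \<bar>x - y\<bar> * \<bar>sigmoid z - sigmoid y\<bar>"
    by (simp add: z(2) abs_mult[symmetric] algebra_simps)
  also have "\<dots> \<le> \<bar>x - y\<bar> * \<bar>x - y\<bar>"
    using sigmoid_lipschitz[of z y] z(1) by (intro mult_left_mono) auto
  finally show ?thesis by (simp add: power2_eq_square)
qed simp

text \<open>With \<open>softplus\<close> replaced by the positive part this is truncation to
  \<open>[-c, c]\<close>. The two \<open>softplus\<close> terms are the pushes of the lower and of
  the upper barrier.\<close>

definition soft_clamp :: "real \<Rightarrow> real \<Rightarrow> real" where
  "soft_clamp c x = x + softplus (- x - c) - softplus (x - c)"

definition contr_rate :: "real \<Rightarrow> real" where
  "contr_rate c = 1 - sigmoid (- c)"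

lemma contr_rate_bounds: "0 < contr_rate c" "contr_rate c < 1"
  using sigmoid_pos[of "-c"] sigmoid_less_1[of "-c"] by (auto simp: contr_rate_def)

lemma soft_clamp_minus: "soft_clamp c (- x) = - soft_clamp c x"
  by (simp add: soft_clamp_def)

text \<open>By \<open>softplus_minus\<close> the clamp equals
  \<open>c + softplus (- x - c) - softplus (c - x)\<close>, where the last term dominates the one
  before it. Oddness gives the lower bound.\<close>

lemma soft_clamp_abs_le:
  assumes "0 \<le> c" shows "\<bar>soft_clamp c x\<bar> \<le> c"
proof -
  have *: "soft_clamp c x \<le> c" for x
    using softplus_minus[of "x - c"] softplus_mono[of "- x - c" "c - x"] assms by (simp add: soft_clamp_def)
  show ?thesis using *[of x] *[of "- x"] by (simp add: soft_clamp_minus abs_le_iff)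
qed

lemma soft_clamp_measurable [measurable]: "soft_clamp c \<in> borel_measurable borel"
  unfolding soft_clamp_def[abs_def] by measurable

text \<open>According to the sign of \<open>x\<close>, one of the two sigmoids is at least
  \<open>sigmoid (- c)\<close>; the other one is dropped. The slope is nonnegative because
  \<open>sigmoid (- x - c)\<close> is at most
  \<open>sigmoid (c - x) = 1 - sigmoid (x - c)\<close>.\<close>

lemma soft_clamp_slope:
  assumes "0 \<le> c"
  shows "0 \<le> 1 - sigmoid (- x - c) - sigmoid (x - c)" "1 - sigmoid (- x - c) - sigmoid (x - c) \<le> contr_rate c"
proof -
  show "0 \<le> 1 - sigmoid (- x - c) - sigmoid (x - c)"
    using sigmoid_minus[of "x - c"] sigmoid_mono[of "- x - c" "- (x - c)"] assms by auto
  show "1 - sigmoid (- x - c) - sigmoid (x - c) \<le> contr_rate c"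
  proof (cases "0 \<le> x")
    case True
    then show ?thesis using sigmoid_mono[of "- c" "x - c"] sigmoid_pos[of "-x-c"] by (simp add: contr_rate_def)
  next
    case False
    then show ?thesis using sigmoid_mono[of "- c" "- x - c"] sigmoid_pos[of "x-c"] by (simp add: contr_rate_def)
  qed
qed

lemma soft_clamp_increment:
  assumes "0 \<le> c" "x \<le> y"
  shows "0 \<le> soft_clamp c y - soft_clamp c x" "soft_clamp c y - soft_clamp c x \<le> contr_rate c * (y - x)"
proof -
  have "0 \<le> soft_clamp c y - soft_clamp c x \<and> soft_clamp c y - soft_clamp c x \<le> contr_rate c * (y - x)"
  proof (cases "x = y")
    case False
    then have "x < y" using assms by auto
    have "\<exists>z. x < z \<and> z < y \<and> soft_clamp c y - soft_clamp c x = (y - x) * (1 - sigmoid (- z - c) - sigmoid (z - c))"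
      unfolding soft_clamp_def by (rule MVT2[OF \<open>x < y\<close>]) (rule derivative_eq_intros refl | simp)+
    then obtain z where "soft_clamp c y - soft_clamp c x = (y - x) * (1 - sigmoid (- z - c) - sigmoid (z - c))" by blast
    then show ?thesis using soft_clamp_slope[OF assms(1), of z] assms(2)
      by (auto simp: mult.commute[of "contr_rate c"] intro!: mult_left_mono mult_nonneg_nonneg)
  qed simp
  then show "0 \<le> soft_clamp c y - soft_clamp c x" "soft_clamp c y - soft_clamp c x \<le> contr_rate c * (y - x)" by auto
qed

lemma soft_clamp_lipschitz:
  assumes "0 \<le> c"
  shows "\<bar>soft_clamp c x - soft_clamp c y\<bar> \<le> contr_rate c * \<bar>x - y\<bar>"
  using soft_clamp_increment[OF assms, of x y] soft_clamp_increment[OF assms, of y x]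
  by (cases "x \<le> y") (auto simp: abs_if algebra_simps)

lemma soft_clamp_mono: "0 \<le> c \<Longrightarrow> x \<le> y \<Longrightarrow> soft_clamp c x \<le> soft_clamp c y"
  using soft_clamp_increment(1)[of c x y] by simp

text \<open>For \<open>c \<le> d\<close> each of the two barrier terms changes by an amount in
  \<open>[0, d - c]\<close>, and the changes enter with opposite signs; hence the constant
  1.\<close>

lemma soft_clamp_parameter_lipschitz: "\<bar>soft_clamp c x - soft_clamp d x\<bar> \<le> \<bar>c - d\<bar>"
proof -
  have *: "\<bar>soft_clamp c x - soft_clamp d x\<bar> \<le> d - c" if "c \<le> d" for c d
    using softplus_lipschitz[of "-x-c" "-x-d"] softplus_lipschitz[of "x-c" "x-d"]
      softplus_mono[of "-x-d" "-x-c"] softplus_mono[of "x-d" "x-c"] that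
    by (auto simp: soft_clamp_def abs_le_iff)
  show ?thesis using *[of c d] *[of d c] by (cases "c \<le> d") (auto simp: abs_minus_commute)
qed

text \<open>The driving sequence is indexed from 0. For the Ising chain it is
  \<open>\<lambda>n. h (Suc n)\<close>, because the first field acts on site 1.\<close>

primrec chain :: "real \<Rightarrow> real \<Rightarrow> (nat \<Rightarrow> real) \<Rightarrow> nat \<Rightarrow> real" where
  "chain c m h 0 = m"
| "chain c m h (Suc n) = soft_clamp c (chain c m h n + 2 * h n)"

section \<open>The recursion for the partition functions\<close>

lemma finite_spin_configs: "finite (spin_configs N a b)"
  unfolding spin_configs_def by (rule finite_subset[of _ "{0..N} \<rightarrow>\<^sub>E {- 1, 1}"]) (auto intro: finite_PiE)

text \<open>Configurations in \<open>PiE\<close> are \<open>undefined\<close> outside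
  \<open>{0..N}\<close>, so removing the last spin means resetting it to \<open>undefined\<close>.
  The spin at \<open>N\<close> may then have either sign, hence the union.\<close>

lemma spin_configs_Suc_bij:
  assumes "b \<in> {-1, 1}"
  shows "bij_betw (\<lambda>\<sigma>. \<sigma>(Suc N := b)) (spin_configs N a 1 \<union> spin_configs N a (-1)) (spin_configs (Suc N) a b)"
proof (rule bij_betw_byWitness[where f' = "\<lambda>\<sigma>. \<sigma>(Suc N := undefined)"])
  show "\<forall>\<sigma>\<in>spin_configs N a 1 \<union> spin_configs N a (-1). (\<sigma>(Suc N := b))(Suc N := undefined) = \<sigma>"
    by (auto simp: spin_configs_def PiE_iff extensional_def fun_eq_iff)
  show "\<forall>\<sigma>\<in>spin_configs (Suc N) a b. (\<sigma>(Suc N := undefined))(Suc N := b) = \<sigma>"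
    by (auto simp: spin_configs_def)
  show "(\<lambda>\<sigma>. \<sigma>(Suc N := b)) ` (spin_configs N a 1 \<union> spin_configs N a (-1)) \<subseteq> spin_configs (Suc N) a b"
    using assms by (fastforce simp: spin_configs_def PiE_iff extensional_def)
  show "(\<lambda>\<sigma>. \<sigma>(Suc N := undefined)) ` spin_configs (Suc N) a b \<subseteq> spin_configs N a 1 \<union> spin_configs N a (-1)"
  proof safe
    fix \<sigma> assume \<sigma>: "\<sigma> \<in> spin_configs (Suc N) a b" and *: "\<sigma>(Suc N := undefined) \<notin> spin_configs N a (- 1)"
    have "\<sigma> N \<in> {-1, 1}"
      using \<sigma> by (auto simp: spin_configs_def PiE_iff)
    then show "\<sigma>(Suc N := undefined) \<in> spin_configs N a 1"
      using \<sigma> * by (fastforce simp: spin_configs_def PiE_iff extensional_def split: if_splits)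
  qed
qed

text \<open>One transfer-matrix step: after splitting by the spin at \<open>N\<close>, the new bond
  costs \<open>exp (- 2 * J)\<close> when the last two spins differ, and the new field acts with the
  sign of the last spin.\<close>

lemma ising_Z_Suc:
  assumes b: "b \<in> {-1, 1}"
  shows "ising_Z (Suc N) h a b J =
    exp (b * h (Suc N)) * (exp (- 2 * J * of_bool (b \<noteq> 1)) * ising_Z N h a 1 J
      + exp (- 2 * J * of_bool (b \<noteq> - 1)) * ising_Z N h a (- 1) J)"
proof -
  define w where "w N \<sigma> = exp (- 2 * J * (\<Sum>n = 1..N. of_bool (\<sigma> n \<noteq> \<sigma> (n - 1))) + (\<Sum>n = 1..N. \<sigma> n * h n))"
    for N and \<sigma> :: "nat \<Rightarrow> real"
  have Z: "ising_Z N h a b J = sum (w N) (spin_configs N a b)" for N b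
    by (simp add: ising_Z_def w_def)
  have step: "w (Suc N) (\<sigma>(Suc N := b)) = exp (b * h (Suc N)) * (exp (- 2 * J * of_bool (b \<noteq> d)) * w N \<sigma>)"
    if "\<sigma> \<in> spin_configs N a d" for \<sigma> d
  proof -
    have "\<sigma> N = d" using that by (auto simp: spin_configs_def)
    moreover have "(\<Sum>n = 1..N. of_bool ((\<sigma>(Suc N := b)) n \<noteq> (\<sigma>(Suc N := b)) (n - 1))) =
        (\<Sum>n = 1..N. of_bool (\<sigma> n \<noteq> \<sigma> (n - 1)) :: real)"
      by (intro sum.cong) auto
    moreover have "(\<Sum>n = 1..N. (\<sigma>(Suc N := b)) n * h n) = (\<Sum>n = 1..N. \<sigma> n * h n)"
      by (intro sum.cong) auto
    ultimately show ?thesis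
      by (simp add: w_def sum.atLeast_Suc_atMost flip: exp_add) (simp add: algebra_simps)
  qed
  have "ising_Z (Suc N) h a b J
      = (\<Sum>\<sigma>\<in>spin_configs N a 1 \<union> spin_configs N a (-1). w (Suc N) (\<sigma>(Suc N := b)))"
    unfolding Z by (rule sum.reindex_bij_betw[OF spin_configs_Suc_bij[OF b], symmetric])
  also have "\<dots> = (\<Sum>\<sigma>\<in>spin_configs N a 1. w (Suc N) (\<sigma>(Suc N := b)))
      + (\<Sum>\<sigma>\<in>spin_configs N a (-1). w (Suc N) (\<sigma>(Suc N := b)))"
    by (intro sum.union_disjoint finite_spin_configs) (auto simp: spin_configs_def)
  also have "(\<Sum>\<sigma>\<in>spin_configs N a 1. w (Suc N) (\<sigma>(Suc N := b)))
      = (\<Sum>\<sigma>\<in>spin_configs N a 1. exp (b * h (Suc N)) * (exp (- 2 * J * of_bool (b \<noteq> 1)) * w N \<sigma>))"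
    by (intro sum.cong step) auto
  also have "(\<Sum>\<sigma>\<in>spin_configs N a (-1). w (Suc N) (\<sigma>(Suc N := b)))
      = (\<Sum>\<sigma>\<in>spin_configs N a (-1). exp (b * h (Suc N)) * (exp (- 2 * J * of_bool (b \<noteq> -1)) * w N \<sigma>))"
    by (intro sum.cong step) auto
  finally show ?thesis
    unfolding Z by (simp add: sum_distrib_left distrib_left)
qed

lemma ising_Z_0:
  assumes "a \<in> {-1, 1}"
  shows "ising_Z 0 h a b J = of_bool (a = b)"
proof -
  have "spin_configs 0 a b = (if a = b then {\<lambda>n. if n = 0 then a else undefined} else {})"
    using assms by (auto simp: spin_configs_def PiE_iff extensional_def fun_eq_iff)
  then show ?thesis by (simp add: ising_Z_def)
qed

text \<open>Its exponential is \<open>exp x * (1 + exp (- c - m - 2 * x))\<close>: the weight of a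
  plus spin in the field \<open>x\<close>, times one plus the relative weight of a minus spin that
  pays for the next bond.\<close>

definition log_increment :: "real \<Rightarrow> real \<Rightarrow> real \<Rightarrow> real" where
  "log_increment c m x = x + softplus (- c - m - 2 * x)"

definition log_sum :: "real \<Rightarrow> real \<Rightarrow> (nat \<Rightarrow> real) \<Rightarrow> nat \<Rightarrow> real" where
  "log_sum c m \<omega> N = (\<Sum>k<N. log_increment c (chain c m \<omega> k) (\<omega> k))"

lemma exp_softplus: "exp (softplus x) = 1 + exp x"
  by (simp add: softplus_def)

text \<open>The chain is the logarithmic ratio of the two boundary partition functions, each completed by
  the next bond; the increments are those of the logarithm of the one that ends in a plus spin.\<close>

lemma ising_Z_chain:
  fixes h :: "nat \<Rightarrow> real" and J :: real
  assumes a: "a \<in> {-1, 1}"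
  defines "c \<equiv> 2 * J" and "\<omega> \<equiv> \<lambda>n. h (Suc n)"
  defines "E \<equiv> \<lambda>N. exp ((if a = 1 then 0 else - c) + log_sum c (a * c) \<omega> N)"
  shows "ising_Z N h a 1 J + exp (- c) * ising_Z N h a (- 1) J = E N"
    and "exp (- c) * ising_Z N h a 1 J + ising_Z N h a (- 1) J = E N * exp (- chain c (a * c) \<omega> N)"
proof -
  have "ising_Z N h a 1 J + exp (- c) * ising_Z N h a (- 1) J = E N \<and>
    exp (- c) * ising_Z N h a 1 J + ising_Z N h a (- 1) J = E N * exp (- chain c (a * c) \<omega> N)"
  proof (induction N)
    case 0
    show ?case
      using a by (auto simp: ising_Z_0 E_def log_sum_def simp flip: exp_add)
  next
    case (Suc N)
    define m x where "m = chain c (a * c) \<omega> N" and "x = h (Suc N)"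
    have Zp: "ising_Z (Suc N) h a 1 J = exp x * E N"
      using Suc by (subst ising_Z_Suc) (auto simp: x_def c_def)
    have Zm: "ising_Z (Suc N) h a (- 1) J = exp (- x) * (E N * exp (- m))"
      using Suc by (subst ising_Z_Suc) (auto simp: x_def m_def c_def)
    have E: "E (Suc N) = E N * exp x * (1 + exp (- c - m - 2 * x))"
      by (simp add: E_def log_sum_def log_increment_def m_def x_def \<omega>_def exp_add exp_softplus add.assoc[symmetric])
    have ch: "exp (- chain c (a * c) \<omega> (Suc N))
        = exp (- m - 2 * x) * (1 + exp (m + 2 * x - c)) / (1 + exp (- c - m - 2 * x))"
    proof -
      have "- chain c (a * c) \<omega> (Suc N)
          = - m - 2 * x + softplus (m + 2 * x - c) - softplus (- c - m - 2 * x)"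
        unfolding m_def x_def \<omega>_def chain.simps soft_clamp_def
        by (simp add: algebra_simps diff_diff_eq)
          (metis add.commute add.left_commute diff_diff_eq minus_diff_commute)
      then show ?thesis by (simp only: exp_diff exp_add exp_softplus)
    qed
    have nz: "1 + exp (- c - m - 2 * x) \<noteq> 0"
      using one_plus_exp_pos[of "- c - m - 2 * x"] by linarith
    have "ising_Z (Suc N) h a 1 J + exp (- c) * ising_Z (Suc N) h a (- 1) J = E (Suc N)"
      unfolding Zp Zm E by (simp add: algebra_simps flip: exp_add)
    moreover have "exp (- c) * ising_Z (Suc N) h a 1 J + ising_Z (Suc N) h a (- 1) J
        = E (Suc N) * exp (- chain c (a * c) \<omega> (Suc N))"
    proof -
      have "E (Suc N) * exp (- chain c (a * c) \<omega> (Suc N))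
          = E N * exp x * (exp (- m - 2 * x) * (1 + exp (m + 2 * x - c)))"
        unfolding E ch using nz by simp
      then show ?thesis
        unfolding Zp Zm by (simp add: algebra_simps flip: exp_add)
    qed
    ultimately show ?case by blast
  qed
  then show "ising_Z N h a 1 J + exp (- c) * ising_Z N h a (- 1) J = E N"
    and "exp (- c) * ising_Z N h a 1 J + ising_Z N h a (- 1) J = E N * exp (- chain c (a * c) \<omega> N)"
    by auto
qed

text \<open>The last site has a field but no bond after it, so the completed sums of
  \<open>ising_Z_chain\<close> at length \<open>N\<close> yield length \<open>Suc N\<close>: a final
  plus spin selects the first sum, a final minus spin the second. Length 0 stays out, since there
  the partition function with unequal boundary spins is 0.\<close>

lemma ln_ising_Z_Suc:
  fixes h :: "nat \<Rightarrow> real" and J :: real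
  assumes a: "a \<in> {-1, 1}" and b: "b \<in> {-1, 1}"
  defines "c \<equiv> 2 * J" and "\<omega> \<equiv> \<lambda>n. h (Suc n)"
  shows "ln (ising_Z (Suc N) h a b J) = (if a = 1 then 0 else - c) + b * \<omega> N
    + log_sum c (a * c) \<omega> N - (if b = 1 then 0 else chain c (a * c) \<omega> N)"
proof (cases "b = 1")
  case True
  have "ising_Z (Suc N) h a b J
      = exp (\<omega> N) * exp ((if a = 1 then 0 else - c) + log_sum c (a * c) \<omega> N)"
    using True ising_Z_chain[OF a, where N = N and h = h and J = J]
    by (subst ising_Z_Suc) (auto simp: c_def \<omega>_def)
  then show ?thesis using True by (simp flip: exp_add)
next
  case False
  then have [simp]: "b = - 1" using b by auto
  have "ising_Z (Suc N) h a b J = exp (- \<omega> N) *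
      (exp ((if a = 1 then 0 else - c) + log_sum c (a * c) \<omega> N) * exp (- chain c (a * c) \<omega> N))"
    using ising_Z_chain[OF a, where N = N and h = h and J = J]
    by (subst ising_Z_Suc) (auto simp: c_def \<omega>_def)
  then show ?thesis by (simp flip: exp_add)
qed

section \<open>A strong law from second moments\<close>

text \<open>By monotone convergence the series of the functions has a finite integral, so it
  converges almost everywhere and its terms vanish.\<close>

lemma AE_tendsto_0_if_summable_integral:
  fixes f :: "nat \<Rightarrow> 'a \<Rightarrow> real"
  assumes int: "\<And>n. integrable M (f n)" and nonneg: "\<And>n x. 0 \<le> f n x"
    and summable: "summable (\<lambda>n. \<integral>x. f n x \<partial>M)"
  shows "AE x in M. (\<lambda>n. f n x) \<longlonglongrightarrow> 0"
proof -
  have [measurable]: "f n \<in> borel_measurable M" for n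
    using int by auto
  have "(\<integral>\<^sup>+x. (\<Sum>n. ennreal (f n x)) \<partial>M) = (\<Sum>n. \<integral>\<^sup>+x. ennreal (f n x) \<partial>M)"
    by (rule nn_integral_suminf) auto
  also have "\<dots> = (\<Sum>n. ennreal (\<integral>x. f n x \<partial>M))"
    by (simp add: nn_integral_eq_integral[OF int] nonneg)
  also have "\<dots> = ennreal (\<Sum>n. \<integral>x. f n x \<partial>M)"
    by (intro suminf_ennreal2 summable) (simp add: nonneg)
  finally have "(\<integral>\<^sup>+x. (\<Sum>n. ennreal (f n x)) \<partial>M) \<noteq> \<infinity>" by simp
  then have "AE x in M. (\<Sum>n. ennreal (f n x)) \<noteq> \<infinity>"
    by (intro nn_integral_PInf_AE) auto
  then show ?thesis
    by eventually_elim (auto intro!: summable_LIMSEQ_zero summable_suminf_not_top simp: nonneg)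
qed

text \<open>Linear growth of the second moment makes the averages along \<open>N = n\<^sup>2\<close>
  square summable. Between consecutive squares the partial sums are controlled by Cauchy-Schwarz on
  the block \<open>I n\<close>. Neither independence nor orthogonality is involved.\<close>

lemma strong_law_second_moments:
  fixes X :: "nat \<Rightarrow> 'a \<Rightarrow> real"
  assumes X[measurable]: "\<And>k. X k \<in> borel_measurable M"
    and int: "\<And>k. integrable M (\<lambda>x. (X k x)\<^sup>2)"
    and intS: "\<And>N. integrable M (\<lambda>x. (\<Sum>k<N. X k x)\<^sup>2)"
    and bnd: "\<And>k. (\<integral>x. (X k x)\<^sup>2 \<partial>M) \<le> C"
    and bndS: "\<And>N. (\<integral>x. (\<Sum>k<N. X k x)\<^sup>2 \<partial>M) \<le> C * N"
  shows "AE x in M. (\<lambda>N. (\<Sum>k<N. X k x) / N) \<longlonglongrightarrow> 0"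
proof -
  have C: "0 \<le> C" using bnd[of 0] by (smt (verit) Bochner_Integration.integral_nonneg zero_le_power2)
  define I where "I n = {n\<^sup>2..<(Suc n)\<^sup>2}" for n :: nat
  define f where "f n x = ((\<Sum>k<n\<^sup>2. X k x) / (real n)\<^sup>2)\<^sup>2" for n x
  \<comment> \<open>Cauchy-Schwarz bound for the square of the largest block contribution,
    normalised by \<open>n\<^sup>2\<close>.\<close>
  define g where "g n x = ((real (card (I n)) * (\<Sum>k\<in>I n. (X k x)\<^sup>2)) / (real n) ^ 4)" for n x
  have intf: "integrable M (f n)" for n
    unfolding f_def power_divide using intS by simp
  have intg: "integrable M (g n)" for n
    unfolding g_def using int by simp
  have summ: "summable (\<lambda>n. K * (1 / (real n)\<^sup>2))" for K
    by (rule summable_mult) (use inverse_power_summable[of 2] in \<open>simp add: field_simps\<close>)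
  have "summable (\<lambda>n. \<integral>x. f n x \<partial>M)"
  proof (rule summable_comparison_test'[OF summ[of C], of 1])
    fix n :: nat assume "1 \<le> n"
    have "(\<integral>x. f n x \<partial>M) = (\<integral>x. (\<Sum>k<n\<^sup>2. X k x)\<^sup>2 \<partial>M) / (real n) ^ 4"
      by (simp add: f_def power_divide flip: power_mult)
    also have "\<dots> \<le> C * n\<^sup>2 / (real n) ^ 4"
      using bndS[of "n\<^sup>2"] by (intro divide_right_mono) auto
    also have "\<dots> = C * (1 / (real n)\<^sup>2)"
      using \<open>1 \<le> n\<close> by (simp add: field_simps power2_eq_square power4_eq_xxxx)
    finally show "norm (\<integral>x. f n x \<partial>M) \<le> C * (1 / (real n)\<^sup>2)"
      by (simp add: f_def)
  qed
  then have f0: "AE x in M. (\<lambda>n. f n x) \<longlonglongrightarrow> 0"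
    by (intro AE_tendsto_0_if_summable_integral intf) (simp_all add: f_def)
  have card: "card (I n) = 2 * n + 1" for n
    by (simp add: I_def power2_eq_square)
  have "summable (\<lambda>n. \<integral>x. g n x \<partial>M)"
  \<comment> \<open>The 9 is the square of 3 in \<open>2 * n + 1 \<le> 3 * n\<close>.\<close>
  proof (rule summable_comparison_test'[OF summ[of "9 * C"], of 1])
    fix n :: nat assume "1 \<le> n"
    have "(\<integral>x. g n x \<partial>M) = real (card (I n)) * (\<Sum>k\<in>I n. \<integral>x. (X k x)\<^sup>2 \<partial>M) / (real n) ^ 4"
      using int by (simp add: g_def)
    also have "\<dots> \<le> real (card (I n)) * (\<Sum>k\<in>I n. C) / (real n) ^ 4"
      by (intro divide_right_mono mult_left_mono sum_mono bnd) auto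
    also have "\<dots> = C * (real (2 * n + 1))\<^sup>2 / (real n) ^ 4"
      by (simp add: card power2_eq_square)
    also have "\<dots> \<le> C * (3 * real n)\<^sup>2 / (real n) ^ 4"
      using \<open>1 \<le> n\<close> C by (intro divide_right_mono mult_left_mono power_mono) auto
    also have "\<dots> = 9 * C * (1 / (real n)\<^sup>2)"
      using \<open>1 \<le> n\<close> by (simp add: field_simps power2_eq_square power4_eq_xxxx)
    finally show "norm (\<integral>x. g n x \<partial>M) \<le> 9 * C * (1 / (real n)\<^sup>2)"
      by (simp add: g_def sum_nonneg)
  qed
  then have g0: "AE x in M. (\<lambda>n. g n x) \<longlonglongrightarrow> 0"
    by (intro AE_tendsto_0_if_summable_integral intg) (simp_all add: g_def sum_nonneg)
  have sq: "filterlim floor_sqrt at_top sequentially"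
    unfolding filterlim_at_top
  proof
    fix Z
    show "\<forall>\<^sub>F x in sequentially. Z \<le> floor_sqrt x"
      using eventually_ge_at_top[of "Z\<^sup>2"]
      by eventually_elim (metis floor_sqrt_inverse_power2 mono_floor_sqrt')
  qed
  from f0 g0 show ?thesis
  proof eventually_elim
    case (elim x)
    have "(\<lambda>n. sqrt (f n x) + sqrt (g n x)) \<longlonglongrightarrow> sqrt 0 + sqrt 0"
      by (intro tendsto_intros elim)
    then have lim: "(\<lambda>N. sqrt (f (floor_sqrt N) x) + sqrt (g (floor_sqrt N) x)) \<longlonglongrightarrow> 0"
      using filterlim_compose[OF _ sq] by fastforce
    show ?case
    proof (rule Lim_null_comparison[OF _ lim])
      show "\<forall>\<^sub>F N in sequentially. norm ((\<Sum>k<N. X k x) / real N)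
          \<le> sqrt (f (floor_sqrt N) x) + sqrt (g (floor_sqrt N) x)"
        using eventually_ge_at_top[of 1]
      proof eventually_elim
        case N: (elim N)
        define n where "n = floor_sqrt N"
        have n: "n\<^sup>2 \<le> N" "N < (Suc n)\<^sup>2" "0 < n"
          using N Suc_floor_sqrt_power2_gt[of N] by (auto simp: n_def)
        have "(\<Sum>k<N. X k x) = (\<Sum>k<n\<^sup>2. X k x) + (\<Sum>k=n\<^sup>2..<N. X k x)"
          by (metis atLeast0LessThan n(1) sum.atLeastLessThan_concat zero_le)
        moreover have "\<bar>\<Sum>k=n\<^sup>2..<N. X k x\<bar> \<le> (\<Sum>k\<in>I n. \<bar>X k x\<bar>)"
          using n by (intro order_trans[OF sum_abs] sum_mono2) (auto simp: I_def)
        ultimately have 1: "\<bar>\<Sum>k<N. X k x\<bar> \<le> \<bar>\<Sum>k<n\<^sup>2. X k x\<bar> + (\<Sum>k\<in>I n. \<bar>X k x\<bar>)" by linarith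
        have "(\<Sum>k\<in>I n. \<bar>X k x\<bar>) \<le> sqrt (real (card (I n)) * (\<Sum>k\<in>I n. (X k x)\<^sup>2))"
          using sum_squared_le_sum_of_squares[of "\<lambda>k. \<bar>X k x\<bar>" "I n"]
          by (intro real_le_rsqrt) (simp add: mult.commute)
        also have "\<dots> = sqrt (g n x) * (real n)\<^sup>2"
          using n by (simp add: g_def real_sqrt_divide real_sqrt_power power4_eq_xxxx power2_eq_square
            real_sqrt_mult)
        finally have 2: "(\<Sum>k\<in>I n. \<bar>X k x\<bar>) \<le> sqrt (g n x) * (real n)\<^sup>2" .
        have 3: "\<bar>\<Sum>k<n\<^sup>2. X k x\<bar> = sqrt (f n x) * (real n)\<^sup>2"
          using n by (simp add: f_def)
        have "\<bar>\<Sum>k<N. X k x\<bar> / real N \<le> (sqrt (f n x) + sqrt (g n x)) * (real n)\<^sup>2 / real N"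
          using 1 2 3 by (intro divide_right_mono) (auto simp: distrib_right)
        also have "\<dots> \<le> (sqrt (f n x) + sqrt (g n x)) * real N / real N"
        proof (intro divide_right_mono mult_left_mono)
          show "(real n)\<^sup>2 \<le> real N" using n(1) by (metis of_nat_le_iff of_nat_power)
          show "0 \<le> sqrt (f n x) + sqrt (g n x)" by (simp add: f_def g_def sum_nonneg)
        qed simp
        finally show ?case using N by (simp add: n_def)
      qed
    qed
  qed
qed

section \<open>The chain and its stationary law\<close>

lemma chain_Suc_front: "chain c m \<omega> (Suc k) = chain c (soft_clamp c (m + 2 * \<omega> 0)) (\<lambda>i. \<omega> (Suc i)) k"
  by (induction k) simp_all

lemma chain_abs_le: "0 \<le> c \<Longrightarrow> \<bar>m\<bar> \<le> c \<Longrightarrow> \<bar>chain c m \<omega> k\<bar> \<le> c"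
  by (cases k) (auto simp: soft_clamp_abs_le)

lemma chain_contracting:
  assumes "0 \<le> c"
  shows "\<bar>chain c m \<omega> k - chain c m' \<omega> k\<bar> \<le> contr_rate c ^ k * \<bar>m - m'\<bar>"
proof (induction k)
  case (Suc k)
  have "\<bar>chain c m \<omega> (Suc k) - chain c m' \<omega> (Suc k)\<bar> \<le> contr_rate c * \<bar>chain c m \<omega> k - chain c m' \<omega> k\<bar>"
    using soft_clamp_lipschitz[OF assms, of "chain c m \<omega> k + 2 * \<omega> k" "chain c m' \<omega> k + 2 * \<omega> k"] by simp
  also have "\<dots> \<le> contr_rate c * (contr_rate c ^ k * \<bar>m - m'\<bar>)"
    using Suc contr_rate_bounds[of c] by (intro mult_left_mono) auto
  finally show ?case by (simp add: mult.assoc)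
qed simp

text \<open>Increments are 1-Lipschitz in the state, and two chains driven by the same field merge
  geometrically. The geometric series bounds the difference uniformly in \<open>N\<close>.\<close>

lemma log_sum_lipschitz:
  assumes "0 \<le> c"
  shows "\<bar>log_sum c m \<omega> N - log_sum c m' \<omega> N\<bar> \<le> \<bar>m - m'\<bar> / (1 - contr_rate c)"
proof -
  have "\<bar>log_sum c m \<omega> N - log_sum c m' \<omega> N\<bar>
      \<le> (\<Sum>k<N. \<bar>log_increment c (chain c m \<omega> k) (\<omega> k) - log_increment c (chain c m' \<omega> k) (\<omega> k)\<bar>)"
    unfolding log_sum_def sum_subtractf[symmetric] by (rule sum_abs)
  also have "\<dots> \<le> (\<Sum>k<N. contr_rate c ^ k * \<bar>m - m'\<bar>)"
  proof (rule sum_mono)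
    fix k
    have "\<bar>log_increment c (chain c m \<omega> k) (\<omega> k) - log_increment c (chain c m' \<omega> k) (\<omega> k)\<bar>
        \<le> \<bar>chain c m \<omega> k - chain c m' \<omega> k\<bar>"
      using softplus_lipschitz[of "- c - chain c m \<omega> k - 2 * \<omega> k" "- c - chain c m' \<omega> k - 2 * \<omega> k"]
      by (simp add: log_increment_def abs_minus_commute)
    also have "\<dots> \<le> contr_rate c ^ k * \<bar>m - m'\<bar>" by (rule chain_contracting[OF assms])
    finally show "\<bar>log_increment c (chain c m \<omega> k) (\<omega> k) - log_increment c (chain c m' \<omega> k) (\<omega> k)\<bar>
        \<le> contr_rate c ^ k * \<bar>m - m'\<bar>" .
  qed
  also have "\<dots> = (\<Sum>k<N. contr_rate c ^ k) * \<bar>m - m'\<bar>"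
    by (simp add: sum_distrib_right)
  also have "\<dots> \<le> (1 / (1 - contr_rate c)) * \<bar>m - m'\<bar>"
  proof (rule mult_right_mono)
    have "(\<Sum>k<N. contr_rate c ^ k) \<le> (\<Sum>k. contr_rate c ^ k)"
      using contr_rate_bounds[of c] by (intro sum_le_suminf summable_geometric) auto
    also have "\<dots> = 1 / (1 - contr_rate c)"
      using contr_rate_bounds[of c] by (intro suminf_geometric) auto
    finally show "(\<Sum>k<N. contr_rate c ^ k) \<le> 1 / (1 - contr_rate c)" .
  qed simp
  finally show ?thesis by simp
qed

lemma log_increment_bound: "\<bar>log_increment c m x\<bar> \<le> 3 * \<bar>x\<bar> + (\<bar>c\<bar> + \<bar>m\<bar> + 1)"
proof -
  have "softplus (- c - m - 2 * x) \<le> \<bar>c\<bar> + \<bar>m\<bar> + 2 * \<bar>x\<bar> + 1"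
    by (rule order_trans[OF softplus_le]) auto
  then show ?thesis
    using softplus_nonneg[of "- c - m - 2 * x"] unfolding log_increment_def by linarith
qed

lemma log_increment_measurable [measurable]:
  "(\<lambda>(m, x). log_increment c m x) \<in> borel_measurable (borel \<Otimes>\<^sub>M borel)"
  unfolding log_increment_def by measurable

text \<open>The order of the fields is reversed: \<open>\<omega> 0\<close> acts last. For an i.i.d.
  field this has the law of the chain after \<open>n\<close> steps, but here adding a step changes
  only the innermost value, so that the sequence converges pathwise.\<close>

primrec backward :: "real \<Rightarrow> nat \<Rightarrow> (nat \<Rightarrow> real) \<Rightarrow> real" where
  "backward c 0 \<omega> = 0"
| "backward c (Suc n) \<omega> = soft_clamp c (backward c n (\<lambda>i. \<omega> (Suc i)) + 2 * \<omega> 0)"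

text \<open>The innermost starting value changes from 0 to a point of \<open>[-c, c]\<close>, and
  \<open>n\<close> contractions follow.\<close>

lemma backward_increment:
  assumes "0 \<le> c"
  shows "\<bar>backward c (Suc n) \<omega> - backward c n \<omega>\<bar> \<le> c * contr_rate c ^ n"
proof (induction n arbitrary: \<omega>)
  case 0
  then show ?case by (simp add: soft_clamp_abs_le[OF assms])
next
  case (Suc n)
  have "\<bar>backward c (Suc (Suc n)) \<omega> - backward c (Suc n) \<omega>\<bar>
      \<le> contr_rate c * \<bar>backward c (Suc n) (\<lambda>i. \<omega> (Suc i)) - backward c n (\<lambda>i. \<omega> (Suc i))\<bar>"
    using soft_clamp_lipschitz[OF assms, of "backward c (Suc n) (\<lambda>i. \<omega> (Suc i)) + 2 * \<omega> 0"
        "backward c n (\<lambda>i. \<omega> (Suc i)) + 2 * \<omega> 0"]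
    by simp
  also have "\<dots> \<le> contr_rate c * (c * contr_rate c ^ n)"
    using Suc contr_rate_bounds[of c] by (intro mult_left_mono) auto
  finally show ?case by (simp add: mult_ac)
qed

lemma backward_convergent:
  assumes "0 \<le> c"
  shows "convergent (\<lambda>n. backward c n \<omega>)"
proof -
  have "summable (\<lambda>n. backward c (Suc n) \<omega> - backward c n \<omega>)"
  proof (rule summable_comparison_test')
    show "summable (\<lambda>n. c * contr_rate c ^ n)"
      using contr_rate_bounds[of c] by (intro summable_mult summable_geometric) auto
    show "norm (backward c (Suc n) \<omega> - backward c n \<omega>) \<le> c * contr_rate c ^ n" if "0 \<le> n" for n
      using backward_increment[OF assms] by simp
  qed
  then have "convergent (\<lambda>n. \<Sum>k<n. backward c (Suc k) \<omega> - backward c k \<omega>)"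
    by (simp add: summable_iff_convergent)
  then show ?thesis by (simp only: sum_lessThan_telescope[of "\<lambda>k. backward c k \<omega>"]) simp
qed

definition backward_limit :: "real \<Rightarrow> (nat \<Rightarrow> real) \<Rightarrow> real" where
  "backward_limit c \<omega> = lim (\<lambda>n. backward c n \<omega>)"

lemma backward_limit: "0 \<le> c \<Longrightarrow> (\<lambda>n. backward c n \<omega>) \<longlonglongrightarrow> backward_limit c \<omega>"
  unfolding backward_limit_def using backward_convergent[of c \<omega>] by (simp add: convergent_LIMSEQ_iff)

lemma soft_clamp_isCont: "isCont (soft_clamp c) x"
  unfolding soft_clamp_def[abs_def]
  by (rule DERIV_isCont[where D = "1 - sigmoid (- x - c) - sigmoid (x - c)"])
    (rule derivative_eq_intros refl | simp)+

text \<open>The limit on the right depends on the fields from index 1 on only, hence is independent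
  of \<open>\<omega> 0\<close>: this equation is the pathwise form of stationarity.\<close>

lemma backward_limit_step:
  assumes "0 \<le> c"
  shows "backward_limit c \<omega> = soft_clamp c (backward_limit c (\<lambda>i. \<omega> (Suc i)) + 2 * \<omega> 0)"
proof (rule LIMSEQ_unique)
  show "(\<lambda>n. backward c (Suc n) \<omega>) \<longlonglongrightarrow> backward_limit c \<omega>"
    by (rule LIMSEQ_Suc[OF backward_limit[OF assms]])
  show "(\<lambda>n. backward c (Suc n) \<omega>) \<longlonglongrightarrow> soft_clamp c (backward_limit c (\<lambda>i. \<omega> (Suc i)) + 2 * \<omega> 0)"
    unfolding backward.simps
    by (intro isCont_tendsto_compose[OF soft_clamp_isCont] tendsto_intros backward_limit[OF assms])
qed

locale centered_law = real_distribution \<mu> for \<mu> :: "real measure" +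
  assumes square_integrable: "integrable \<mu> (\<lambda>x. x\<^sup>2)" and mean_zero: "(\<integral>x. x \<partial>\<mu>) = 0"
begin

sublocale path: sequence_space \<mu>
  by unfold_locales

abbreviation paths :: "(nat \<Rightarrow> real) measure" where
  "paths \<equiv> \<Pi>\<^sub>M i\<in>UNIV. \<mu>"

lemma integrable_id: "integrable \<mu> (\<lambda>x. x)"
  by (rule square_integrable_imp_integrable) (use square_integrable in auto)

lemma component_measurable: "(\<lambda>\<omega>. \<omega> k) \<in> borel_measurable paths"
  using measurable_component_singleton[of k UNIV "\<lambda>_. \<mu>"] by simp

lemma shift_measurable: "(\<lambda>\<omega> i. \<omega> (Suc i)) \<in> measurable paths paths"
  by (rule measurable_PiM_single') (auto simp: space_PiM)

lemma chain_measurable [measurable (raw)]: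
  assumes [measurable]: "f \<in> borel_measurable M" "g \<in> measurable M paths"
  shows "(\<lambda>x. chain c (f x) (g x) k) \<in> borel_measurable M"
proof (induction k)
  case (Suc k)
  note [measurable] = this measurable_compose[OF assms(2) component_measurable[of k]]
  show ?case unfolding chain.simps by measurable
qed simp

lemma backward_measurable [measurable]: "backward c n \<in> borel_measurable paths"
proof (induction n)
  case (Suc n)
  have [measurable]: "(\<lambda>\<omega>. backward c n (\<lambda>i. \<omega> (Suc i))) \<in> borel_measurable paths"
    by (rule measurable_compose[OF shift_measurable Suc])
  note [measurable] = component_measurable[of 0]
  show ?case unfolding backward.simps[abs_def] by measurable
qed simp

lemma backward_limit_measurable [measurable]: "backward_limit c \<in> borel_measurable paths"
  unfolding backward_limit_def[abs_def] by measurable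

text \<open>An i.i.d. path is an independent first field prepended to an i.i.d. path; Fubini then
  separates the two.\<close>

lemma nn_integral_paths:
  assumes [measurable]: "\<phi> \<in> borel_measurable paths"
  shows "(\<integral>\<^sup>+\<omega>. \<phi> \<omega> \<partial>paths) = (\<integral>\<^sup>+x. \<integral>\<^sup>+\<omega>. \<phi> (case_nat x \<omega>) \<partial>paths \<partial>\<mu>)"
proof -
  have "(\<integral>\<^sup>+\<omega>. \<phi> \<omega> \<partial>paths) = (\<integral>\<^sup>+\<omega>. \<phi> \<omega> \<partial>(distr (\<mu> \<Otimes>\<^sub>M paths) paths (\<lambda>(s, \<omega>). case_nat s \<omega>)))"
    by (simp only: path.PiM_iter)
  also have "\<dots> = (\<integral>\<^sup>+p. \<phi> (case p of (s, \<omega>) \<Rightarrow> case_nat s \<omega>) \<partial>(\<mu> \<Otimes>\<^sub>M paths))"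
    by (rule nn_integral_distr) auto
  also have "\<dots> = (\<integral>\<^sup>+x. \<integral>\<^sup>+\<omega>. \<phi> (case_nat x \<omega>) \<partial>paths \<partial>\<mu>)"
    by (subst path.P.nn_integral_fst[symmetric]) auto
  finally show ?thesis .
qed

end

locale stationary_chain = centered_law \<mu> + st: real_distribution \<nu>
  for \<mu> \<nu> :: "real measure" +
  fixes c :: real
  assumes c_pos: "0 < c"
    and support: "AE m in \<nu>. \<bar>m\<bar> \<le> c"
    and stationary: "distr (\<nu> \<Otimes>\<^sub>M \<mu>) borel (\<lambda>(m, x). soft_clamp c (m + 2 * x)) = \<nu>"

text \<open>The witness is the law of the backward limit.\<close>

lemma (in centered_law) stationary_exists:
  assumes "0 < c"
  shows "stationary_chain \<mu> (distr paths borel (backward_limit c)) c"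
proof -
  let ?\<nu> = "distr paths borel (backward_limit c)"
  interpret nu: prob_space ?\<nu> by (rule path.prob_space_distr) simp
  interpret nu: real_distribution ?\<nu> by unfold_locales simp
  interpret P1: pair_prob_space ?\<nu> \<mu> ..
  interpret P2: pair_sigma_finite paths \<mu> ..
  show ?thesis
  proof unfold_locales
    show "0 < c" by fact
    have "\<bar>backward_limit c \<omega>\<bar> \<le> c" for \<omega>
      using assms backward_limit_step[of c \<omega>] soft_clamp_abs_le[of c] by simp
    then show "AE m in ?\<nu>. \<bar>m\<bar> \<le> c"
      by (subst AE_distr_iff) auto
    show "distr (?\<nu> \<Otimes>\<^sub>M \<mu>) borel (\<lambda>(m, x). soft_clamp c (m + 2 * x)) = ?\<nu>"
    proof (rule measure_eqI)
      fix A assume "A \<in> sets (distr (?\<nu> \<Otimes>\<^sub>M \<mu>) borel (\<lambda>(m, x). soft_clamp c (m + 2 * x)))"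
      then have A [measurable]: "A \<in> sets borel" by simp
      have "emeasure (distr (?\<nu> \<Otimes>\<^sub>M \<mu>) borel (\<lambda>(m, x). soft_clamp c (m + 2 * x))) A
          = (\<integral>\<^sup>+p. indicator A (case p of (m, x) \<Rightarrow> soft_clamp c (m + 2 * x)) \<partial>(?\<nu> \<Otimes>\<^sub>M \<mu>))"
        by (subst nn_integral_distr[symmetric, where M' = borel]) auto
      also have "\<dots> = (\<integral>\<^sup>+m. \<integral>\<^sup>+x. indicator A (soft_clamp c (m + 2 * x)) \<partial>\<mu> \<partial>?\<nu>)"
        by (subst nn_integral_fst[symmetric]) auto
      also have "\<dots> = (\<integral>\<^sup>+\<omega>. \<integral>\<^sup>+x. indicator A (soft_clamp c (backward_limit c \<omega> + 2 * x)) \<partial>\<mu> \<partial>paths)"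
        by (subst nn_integral_distr) auto
      also have "\<dots> = (\<integral>\<^sup>+x. \<integral>\<^sup>+\<omega>. indicator A (soft_clamp c (backward_limit c \<omega> + 2 * x)) \<partial>paths \<partial>\<mu>)"
        by (rule P2.Fubini'[symmetric]) auto
      \<comment> \<open>Prepending an independent field to the path performs one step of the chain,
        by \<open>backward_limit_step\<close>.\<close>
      also have "\<dots> = (\<integral>\<^sup>+x. \<integral>\<^sup>+\<omega>. indicator A (backward_limit c (case_nat x \<omega>)) \<partial>paths \<partial>\<mu>)"
        using assms backward_limit_step[of c "case_nat _ _"] by simp
      also have "\<dots> = (\<integral>\<^sup>+\<omega>. indicator A (backward_limit c \<omega>) \<partial>paths)"
        by (rule nn_integral_paths[symmetric]) auto
      also have "\<dots> = emeasure ?\<nu> A"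
        by (subst nn_integral_distr[symmetric, where M' = borel]) auto
      finally show "emeasure (distr (?\<nu> \<Otimes>\<^sub>M \<mu>) borel (\<lambda>(m, x). soft_clamp c (m + 2 * x))) A = emeasure ?\<nu> A" .
    qed simp
  qed
qed

section \<open>Law of large numbers for the free energy\<close>

lemma distr_pair_snd:
  assumes "prob_space N" "sigma_finite_measure M"
  shows "distr (N \<Otimes>\<^sub>M M) M snd = M"
proof (rule measure_eqI)
  interpret N: prob_space N by fact
  interpret M: sigma_finite_measure M by fact
  fix A assume "A \<in> sets (distr (N \<Otimes>\<^sub>M M) M snd)"
  then have A: "A \<in> sets M" by simp
  then have "emeasure (distr (N \<Otimes>\<^sub>M M) M snd) A = emeasure (N \<Otimes>\<^sub>M M) (space N \<times> A)"
    by (auto simp: emeasure_distr space_pair_measure dest: sets.sets_into_space intro!: arg_cong2[where f = emeasure])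
  with A show "emeasure (distr (N \<Otimes>\<^sub>M M) M snd) A = emeasure M A"
    by (simp add: M.emeasure_pair_measure_Times N.emeasure_space_1)
qed simp

section \<open>Stationary runs of the chain and their measure-preserving step\<close>

context stationary_chain
begin

sublocale joint: pair_prob_space \<nu> \<mu>
  by unfold_locales

sublocale run: pair_prob_space \<nu> paths
  by unfold_locales

sublocale triple: pair_prob_space "\<nu> \<Otimes>\<^sub>M \<mu>" paths
  by unfold_locales

abbreviation pairs :: "(real \<times> real) measure" where
  "pairs \<equiv> \<nu> \<Otimes>\<^sub>M \<mu>"

abbreviation runs :: "(real \<times> (nat \<Rightarrow> real)) measure" where
  "runs \<equiv> \<nu> \<Otimes>\<^sub>M paths"

lemma pairs_fst_law: "distr pairs \<nu> fst = \<nu>"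
  by (rule distr_pair_fst)

lemma pairs_snd_law: "distr pairs \<mu> snd = \<mu>"
  by (rule distr_pair_snd) unfold_locales

lemma integrable_pairs_snd:
  fixes f :: "real \<Rightarrow> real"
  shows "integrable \<mu> f \<Longrightarrow> integrable pairs (\<lambda>p. f (snd p))"
  using integrable_distr[of snd pairs \<mu> f] by (simp add: pairs_snd_law)

lemma integral_pairs_fst:
  fixes f :: "real \<Rightarrow> real"
  shows "f \<in> borel_measurable borel \<Longrightarrow> (\<integral>p. f (fst p) \<partial>pairs) = (\<integral>m. f m \<partial>\<nu>)"
  using integral_distr[of fst pairs \<nu> f] by (simp add: pairs_fst_law)

lemma integral_pairs_snd:
  fixes f :: "real \<Rightarrow> real"
  shows "f \<in> borel_measurable borel \<Longrightarrow> (\<integral>p. f (snd p) \<partial>pairs) = (\<integral>x. f x \<partial>\<mu>)"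
  using integral_distr[of snd pairs \<mu> f] by (simp add: pairs_snd_law)

lemma AE_pairs_fst: "AE p in pairs. \<bar>fst p\<bar> \<le> c"
  by (rule AE_distrD[of fst pairs \<nu>]) (simp_all only: pairs_fst_law support measurable_fst)

abbreviation next_state :: "real \<times> real \<Rightarrow> real" where
  "next_state p \<equiv> soft_clamp c (fst p + 2 * snd p)"

lemma next_state_law: "distr pairs borel next_state = \<nu>"
  using stationary by (simp add: case_prod_beta')

lemma stationary_integral:
  fixes f :: "real \<Rightarrow> real"
  assumes [measurable]: "f \<in> borel_measurable borel"
  shows "(\<integral>p. f (next_state p) \<partial>pairs) = (\<integral>p. f (fst p) \<partial>pairs)"
proof -
  have "(\<integral>p. f (next_state p) \<partial>pairs) = (\<integral>m. f m \<partial>distr pairs borel next_state)"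
    by (rule integral_distr[symmetric]) auto
  then show ?thesis by (simp add: next_state_law integral_pairs_fst)
qed

text \<open>The mean push at the lower barrier. It is also the mean of \<open>log_increment\<close>,
  whose remaining summand is the centred field.\<close>

definition lyapunov :: real where
  "lyapunov = (\<integral>p. softplus (- c - fst p - 2 * snd p) \<partial>pairs)"

text \<open>The state is almost surely bounded by \<open>c\<close>, so integrability depends only on
  the growth in the field.\<close>

lemma integrable_lipschitz:
  fixes f :: "real \<times> real \<Rightarrow> real"
  assumes [measurable]: "f \<in> borel_measurable (borel \<Otimes>\<^sub>M borel)"
    and bound: "\<And>m x. \<bar>m\<bar> \<le> c \<Longrightarrow> \<bar>f (m, x)\<bar> \<le> A * \<bar>x\<bar> + B"
  shows "integrable pairs f"
proof (rule Bochner_Integration.integrable_bound)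
  show "integrable pairs (\<lambda>p. A * \<bar>snd p\<bar> + B)"
    using integrable_pairs_snd[of "\<lambda>x. \<bar>x\<bar>"] integrable_id by simp
  show "AE p in pairs. norm (f p) \<le> norm (A * \<bar>snd p\<bar> + B)"
    using AE_pairs_fst
  proof eventually_elim
    case (elim p)
    then show ?case using bound[of "fst p" "snd p"] by simp
  qed
qed simp

lemma integrable_quadratic:
  fixes f :: "real \<times> real \<Rightarrow> real"
  assumes [measurable]: "f \<in> borel_measurable (borel \<Otimes>\<^sub>M borel)"
    and bound: "\<And>m x. \<bar>m\<bar> \<le> c \<Longrightarrow> \<bar>f (m, x)\<bar> \<le> A * x\<^sup>2 + B"
  shows "integrable pairs f"
proof (rule Bochner_Integration.integrable_bound)
  show "integrable pairs (\<lambda>p. A * (snd p)\<^sup>2 + B)"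
    using integrable_pairs_snd[of "\<lambda>x. x\<^sup>2"] square_integrable by simp
  show "AE p in pairs. norm (f p) \<le> norm (A * (snd p)\<^sup>2 + B)"
    using AE_pairs_fst
  proof eventually_elim
    case (elim p)
    then show ?case using bound[of "fst p" "snd p"] by simp
  qed
qed simp

lemma integrable_log_increment: "integrable pairs (\<lambda>p. log_increment c (fst p) (snd p))"
proof (rule integrable_lipschitz[of _ 3 "2 * c + 1"])
  show "\<bar>log_increment c (fst (m, x)) (snd (m, x))\<bar> \<le> 3 * \<bar>x\<bar> + (2 * c + 1)" if "\<bar>m\<bar> \<le> c" for m x
    using log_increment_bound[of c m x] that c_pos by simp
qed measurable

lemma integral_log_increment: "(\<integral>p. log_increment c (fst p) (snd p) \<partial>pairs) = lyapunov"
proof -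
  have 1: "integrable pairs snd"
    using integrable_pairs_snd[OF integrable_id] by simp
  have 2: "integrable pairs (\<lambda>p. softplus (- c - fst p - 2 * snd p))"
    using Bochner_Integration.integrable_diff[OF integrable_log_increment 1]
    by (simp add: log_increment_def)
  have "(\<integral>p. snd p \<partial>pairs) = 0"
    using integral_pairs_snd[of "\<lambda>x. x"] mean_zero by simp
  then show ?thesis
    using Bochner_Integration.integral_add[OF 1 2] by (simp add: lyapunov_def log_increment_def)
qed

lemma integrable_square_log_increment:
  "integrable pairs (\<lambda>p. (log_increment c (fst p) (snd p) - lyapunov)\<^sup>2)"
proof (rule integrable_quadratic[of _ 18 "2 * (2 * c + 1 + \<bar>lyapunov\<bar>)\<^sup>2"])
  fix m x assume "\<bar>m\<bar> \<le> c"
  let ?K = "2 * c + 1 + \<bar>lyapunov\<bar>"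
  have "\<bar>log_increment c m x - lyapunov\<bar> \<le> 3 * \<bar>x\<bar> + ?K"
    using log_increment_bound[of c m x] \<open>\<bar>m\<bar> \<le> c\<close> c_pos by simp
  then have "(log_increment c m x - lyapunov)\<^sup>2 \<le> (3 * \<bar>x\<bar> + ?K)\<^sup>2"
    by (metis abs_ge_zero power2_abs power_mono)
  also have "\<dots> \<le> 18 * x\<^sup>2 + 2 * ?K\<^sup>2"
    using zero_le_power2[of "3 * \<bar>x\<bar> - ?K"] by (simp add: power2_diff power2_sum[of "3 * \<bar>x\<bar>"] power_mult_distrib)
  finally show "\<bar>(log_increment c (fst (m, x)) (snd (m, x)) - lyapunov)\<^sup>2\<bar> \<le> 18 * x\<^sup>2 + 2 * ?K\<^sup>2"
    by simp
qed measurable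

lemma runs_head_law: "distr runs pairs (\<lambda>p. (fst p, snd p 0)) = pairs"
proof -
  have [measurable]: "(\<lambda>\<omega>. \<omega> 0) \<in> measurable paths \<mu>" by simp
  have "distr paths \<mu> (\<lambda>\<omega>. \<omega> 0) = \<mu>"
    by (rule path.PiM_component) simp
  moreover have "distr \<nu> \<nu> (\<lambda>m. m) \<Otimes>\<^sub>M distr paths \<mu> (\<lambda>\<omega>. \<omega> 0)
      = distr runs pairs (\<lambda>(m, \<omega>). (m, \<omega> 0))"
    by (rule pair_measure_distr) (auto simp: calculation intro: prob_space_imp_sigma_finite prob_space_axioms)
  ultimately show ?thesis by (simp add: case_prod_beta')
qed

lemma runs_split_law:
  "distr (pairs \<Otimes>\<^sub>M paths) runs (\<lambda>q. (fst (fst q), case_nat (snd (fst q)) (snd q))) = runs"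
proof (rule measure_eqI)
  let ?s = "\<lambda>q. (fst (fst q), case_nat (snd (fst q)) (snd q))"
  have s [measurable]: "?s \<in> measurable (pairs \<Otimes>\<^sub>M paths) runs"
    by measurable
  fix A assume "A \<in> sets (distr (pairs \<Otimes>\<^sub>M paths) runs ?s)"
  then have A [measurable]: "A \<in> sets runs" by simp
  have "emeasure (distr (pairs \<Otimes>\<^sub>M paths) runs ?s) A = (\<integral>\<^sup>+q. indicator A (?s q) \<partial>(pairs \<Otimes>\<^sub>M paths))"
    by (subst nn_integral_distr[symmetric, where M' = runs]) (use s A in simp_all)
  also have "\<dots> = (\<integral>\<^sup>+p. \<integral>\<^sup>+\<omega>. indicator A (fst p, case_nat (snd p) \<omega>) \<partial>paths \<partial>pairs)"
    by (subst path.P.nn_integral_fst[symmetric]) auto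
  also have "\<dots> = (\<integral>\<^sup>+m. \<integral>\<^sup>+x. \<integral>\<^sup>+\<omega>. indicator A (m, case_nat x \<omega>) \<partial>paths \<partial>\<mu> \<partial>\<nu>)"
    by (subst nn_integral_fst[symmetric]) auto
  also have "\<dots> = (\<integral>\<^sup>+m. \<integral>\<^sup>+\<omega>. indicator A (m, \<omega>) \<partial>paths \<partial>\<nu>)"
    by (subst nn_integral_paths) auto
  also have "\<dots> = (\<integral>\<^sup>+p. indicator A p \<partial>runs)"
    by (subst path.P.nn_integral_fst[symmetric]) auto
  finally show "emeasure (distr (pairs \<Otimes>\<^sub>M paths) runs ?s) A = emeasure runs A"
    by (simp only: nn_integral_indicator[OF A])
qed simp

text \<open>The skew product over the shift: the state makes one step and the used field is
  discarded.\<close>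

definition advance :: "real \<times> (nat \<Rightarrow> real) \<Rightarrow> real \<times> (nat \<Rightarrow> real)" where
  "advance p = (soft_clamp c (fst p + 2 * snd p 0), \<lambda>i. snd p (Suc i))"

lemma advance_measurable [measurable]: "advance \<in> measurable runs runs"
proof -
  have [measurable]: "(\<lambda>p. snd p 0) \<in> borel_measurable runs"
    by (rule measurable_compose[OF measurable_snd component_measurable])
  have [measurable]: "(\<lambda>p i. snd p (Suc i)) \<in> measurable runs paths"
    by (rule measurable_compose[OF measurable_snd shift_measurable])
  show ?thesis unfolding advance_def[abs_def] by measurable
qed

text \<open>Once the first field is split off, the new state depends only on the old state and that
  field. It therefore has law \<open>\<nu>\<close> and is independent of the remaining
  fields.\<close>

lemma advance_law: "distr runs runs advance = runs"
proof -
  let ?s = "\<lambda>q. (fst (fst q), case_nat (snd (fst q)) (snd q))"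
  have s [measurable]: "?s \<in> measurable (pairs \<Otimes>\<^sub>M paths) runs"
    by measurable
  have "distr runs runs advance = distr (distr (pairs \<Otimes>\<^sub>M paths) runs ?s) runs advance"
    by (simp only: runs_split_law)
  also have "\<dots> = distr (pairs \<Otimes>\<^sub>M paths) runs (advance \<circ> ?s)"
    by (rule distr_distr) simp_all
  also have "advance \<circ> ?s = (\<lambda>(p, \<omega>). (next_state p, \<omega>))"
    by (auto simp: advance_def)
  also have "distr (pairs \<Otimes>\<^sub>M paths) runs (\<lambda>(p, \<omega>). (next_state p, \<omega>))
      = distr pairs \<nu> next_state \<Otimes>\<^sub>M distr paths paths (\<lambda>\<omega>. \<omega>)"
    by (rule pair_measure_distr[symmetric]) (simp_all add: path.P.sigma_finite_measure_axioms)
  also have "distr pairs \<nu> next_state = \<nu>"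
    using next_state_law by (simp cong: distr_cong)
  finally show ?thesis by simp
qed

end

section \<open>Second moments of the centred increments\<close>

context stationary_chain
begin

definition fluct :: "nat \<Rightarrow> real \<times> (nat \<Rightarrow> real) \<Rightarrow> real" where
  "fluct k p = log_increment c (chain c (fst p) (snd p) k) (snd p k) - lyapunov"

definition deviation :: "nat \<Rightarrow> real \<times> (nat \<Rightarrow> real) \<Rightarrow> real" where
  "deviation N p = (\<Sum>k<N. fluct k p)"

lemma deviation_eq: "deviation N p = log_sum c (fst p) (snd p) N - N * lyapunov"
  by (simp add: deviation_def fluct_def log_sum_def sum_subtractf)

lemma fluct_measurable [measurable]: "fluct k \<in> borel_measurable runs"
proof -
  have [measurable]: "(\<lambda>p. snd p k) \<in> borel_measurable runs"
    by (rule measurable_compose[OF measurable_snd component_measurable])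
  have [measurable]: "(\<lambda>p. chain c (fst p) (snd p) k) \<in> borel_measurable runs"
    by (rule chain_measurable) auto
  show ?thesis unfolding fluct_def[abs_def] by measurable
qed

lemma deviation_measurable [measurable]: "deviation N \<in> borel_measurable runs"
  unfolding deviation_def[abs_def] by measurable

lemma fluct_advance: "fluct (Suc k) p = fluct k (advance p)"
  unfolding fluct_def chain_Suc_front by (simp add: advance_def)

lemma deviation_Suc: "deviation (Suc N) p = fluct 0 p + deviation N (advance p)"
  by (simp only: deviation_def sum.lessThan_Suc_shift fluct_advance)

lemma integrable_advance:
  fixes f :: "real \<times> (nat \<Rightarrow> real) \<Rightarrow> real"
  shows "integrable runs f \<Longrightarrow> integrable runs (\<lambda>p. f (advance p))"
  using integrable_distr[of advance runs runs f] by (simp add: advance_law)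

lemma integral_advance:
  fixes f :: "real \<times> (nat \<Rightarrow> real) \<Rightarrow> real"
  assumes [measurable]: "f \<in> borel_measurable runs"
  shows "(\<integral>p. f (advance p) \<partial>runs) = (\<integral>p. f p \<partial>runs)"
  using integral_distr[of advance runs runs f] by (simp add: advance_law)

definition centred :: "real \<times> real \<Rightarrow> real" where
  "centred q = log_increment c (fst q) (snd q) - lyapunov"

lemma centred_measurable [measurable]: "centred \<in> borel_measurable (borel \<Otimes>\<^sub>M borel)"
  unfolding centred_def[abs_def] by measurable

lemma fluct_0: "fluct 0 p = centred (fst p, snd p 0)"
  by (simp add: fluct_def centred_def)

lemma head_measurable: "(\<lambda>p. (fst p, snd p 0)) \<in> measurable runs pairs"
proof -
  have [measurable]: "(\<lambda>p. snd p 0) \<in> borel_measurable runs"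
    by (rule measurable_compose[OF measurable_snd component_measurable])
  show ?thesis by measurable
qed

lemma integrable_centred: "integrable pairs centred"
  unfolding centred_def[abs_def] using integrable_log_increment by simp

lemma integrable_fluct_0_square: "integrable runs (\<lambda>p. (fluct 0 p)\<^sup>2)"
  using integrable_distr[OF head_measurable, of "\<lambda>q. (centred q)\<^sup>2"] integrable_square_log_increment
  by (simp add: runs_head_law fluct_0 centred_def)

lemma integral_fluct_0: "(\<integral>p. fluct 0 p \<partial>runs) = 0"
proof -
  have "(\<integral>p. fluct 0 p \<partial>runs) = (\<integral>q. centred q \<partial>distr runs pairs (\<lambda>p. (fst p, snd p 0)))"
    unfolding fluct_0 by (rule integral_distr[symmetric, OF head_measurable]) simp
  also have "\<dots> = (\<integral>q. log_increment c (fst q) (snd q) - lyapunov \<partial>pairs)"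
    by (simp add: runs_head_law centred_def)
  also have "\<dots> = 0"
    using integrable_log_increment integral_log_increment joint.prob_space by simp
  finally show ?thesis .
qed

lemma fluct_square:
  "integrable runs (\<lambda>p. (fluct k p)\<^sup>2)" "(\<integral>p. (fluct k p)\<^sup>2 \<partial>runs) = (\<integral>p. (fluct 0 p)\<^sup>2 \<partial>runs)"
proof -
  have "integrable runs (\<lambda>p. (fluct k p)\<^sup>2) \<and> (\<integral>p. (fluct k p)\<^sup>2 \<partial>runs) = (\<integral>p. (fluct 0 p)\<^sup>2 \<partial>runs)"
  proof (induction k)
    case (Suc k)
    then show ?case
      using integrable_advance[of "\<lambda>p. (fluct k p)\<^sup>2"] integral_advance[of "\<lambda>p. (fluct k p)\<^sup>2"]
      by (simp add: fluct_advance)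
  qed (simp add: integrable_fluct_0_square)
  then show "integrable runs (\<lambda>p. (fluct k p)\<^sup>2)" "(\<integral>p. (fluct k p)\<^sup>2 \<partial>runs) = (\<integral>p. (fluct 0 p)\<^sup>2 \<partial>runs)"
    by auto
qed

lemma integrable_deviation_square: "integrable runs (\<lambda>p. (deviation N p)\<^sup>2)"
proof (rule Bochner_Integration.integrable_bound)
  show "integrable runs (\<lambda>p. (\<Sum>k<N. (fluct k p)\<^sup>2) * N)"
    using fluct_square(1) by simp
  show "AE p in runs. norm ((deviation N p)\<^sup>2) \<le> norm ((\<Sum>k<N. (fluct k p)\<^sup>2) * N)"
  proof (rule AE_I2)
    fix p
    have "(deviation N p)\<^sup>2 \<le> (\<Sum>k<N. (fluct k p)\<^sup>2) * N"
      using sum_squared_le_sum_of_squares[of "\<lambda>k. fluct k p" "{..<N}"] by (simp add: deviation_def)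
    then show "norm ((deviation N p)\<^sup>2) \<le> norm ((\<Sum>k<N. (fluct k p)\<^sup>2) * N)"
      by (simp add: abs_of_nonneg sum_nonneg)
  qed
qed simp

lemma integrable_deviation: "integrable runs (deviation N)"
  by (rule run.P.square_integrable_imp_integrable) (simp_all add: integrable_deviation_square)

lemma integrable_fluct_0: "integrable runs (fluct 0)"
  by (rule run.P.square_integrable_imp_integrable) (simp_all add: integrable_fluct_0_square)

lemma integral_deviation: "(\<integral>p. deviation N p \<partial>runs) = 0"
proof (induction N)
  case (Suc N)
  have "(\<integral>p. deviation (Suc N) p \<partial>runs) = (\<integral>p. fluct 0 p \<partial>runs) + (\<integral>p. deviation N (advance p) \<partial>runs)"
    unfolding deviation_Suc
    by (rule Bochner_Integration.integral_add[OF integrable_fluct_0 integrable_advance[OF integrable_deviation]])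
  then show ?case using Suc by (simp add: integral_fluct_0 integral_advance)
qed (simp add: deviation_def)

text \<open>Fubini would give this for almost every \<open>m\<close> only; the cross-term estimate
  uses it at every state in \<open>[-c, c]\<close>.\<close>

lemma integrable_deviation_section:
  assumes "\<bar>m\<bar> \<le> c"
  shows "integrable paths (\<lambda>\<omega>. deviation N (m, \<omega>))"
  unfolding deviation_def
proof (rule Bochner_Integration.integrable_sum)
  fix k
  have f: "integrable paths (\<lambda>\<omega>. \<bar>\<omega> k\<bar>)"
  proof -
    have "distr paths \<mu> (\<lambda>\<omega>. \<omega> k) = \<mu>" by (rule path.PiM_component) simp
    moreover have "integrable \<mu> (\<lambda>x. \<bar>x\<bar>)" using integrable_id by simp
    ultimately show ?thesis
      using integrable_distr[of "\<lambda>\<omega>. \<omega> k" paths \<mu> "\<lambda>x. \<bar>x\<bar>"] by simp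
  qed
  have [measurable]: "(\<lambda>\<omega>. fluct k (m, \<omega>)) \<in> borel_measurable paths"
    using measurable_Pair2[OF fluct_measurable, of m] st.space_eq_univ by simp
  show "integrable paths (\<lambda>\<omega>. fluct k (m, \<omega>))"
  proof (rule Bochner_Integration.integrable_bound)
    show "integrable paths (\<lambda>\<omega>. 3 * \<bar>\<omega> k\<bar> + (2 * c + 1 + \<bar>lyapunov\<bar>))"
      using f by simp
    show "AE \<omega> in paths. norm (fluct k (m, \<omega>)) \<le> norm (3 * \<bar>\<omega> k\<bar> + (2 * c + 1 + \<bar>lyapunov\<bar>))"
    proof (rule AE_I2)
      fix \<omega>
      show "norm (fluct k (m, \<omega>)) \<le> norm (3 * \<bar>\<omega> k\<bar> + (2 * c + 1 + \<bar>lyapunov\<bar>))"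
        using log_increment_bound[of c "chain c m \<omega> k" "\<omega> k"] chain_abs_le[of c m \<omega> k] assms c_pos
        by (simp add: fluct_def)
    qed
  qed simp
qed

text \<open>The diameter \<open>2 * c\<close> of the state space times the geometric series of
  \<open>contr_rate c\<close>.\<close>

definition mixing_bound :: real where
  "mixing_bound = 2 * c / (1 - contr_rate c)"

lemma deviation_diff_le:
  assumes "\<bar>m\<bar> \<le> c" "\<bar>m'\<bar> \<le> c"
  shows "\<bar>deviation N (m, \<omega>) - deviation N (m', \<omega>)\<bar> \<le> mixing_bound"
proof -
  have "\<bar>deviation N (m, \<omega>) - deviation N (m', \<omega>)\<bar> \<le> \<bar>m - m'\<bar> / (1 - contr_rate c)"
    using log_sum_lipschitz[of c m \<omega> N m'] c_pos by (simp add: deviation_eq)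
  also have "\<dots> \<le> mixing_bound"
    unfolding mixing_bound_def using assms contr_rate_bounds[of c] by (intro divide_right_mono) auto
  finally show ?thesis .
qed

text \<open>As a function of the starting state the mean oscillates by at most
  \<open>mixing_bound\<close>, and its integral against \<open>\<nu>\<close> vanishes; hence it is
  bounded at every state.\<close>

lemma deviation_mean_le:
  assumes m: "\<bar>m\<bar> \<le> c"
  shows "\<bar>\<integral>\<omega>. deviation N (m, \<omega>) \<partial>paths\<bar> \<le> mixing_bound"
proof -
  define e where "e m = (\<integral>\<omega>. deviation N (m, \<omega>) \<partial>paths)" for m
  have diff: "e m - e m' \<le> mixing_bound" if "\<bar>m\<bar> \<le> c" "\<bar>m'\<bar> \<le> c" for m m'
  proof -
    have "e m - e m' = (\<integral>\<omega>. deviation N (m, \<omega>) - deviation N (m', \<omega>) \<partial>paths)"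
      unfolding e_def using that integrable_deviation_section by simp
    also have "\<dots> \<le> mixing_bound"
    proof (rule path.P.integral_le_const)
      show "integrable paths (\<lambda>\<omega>. deviation N (m, \<omega>) - deviation N (m', \<omega>))"
        by (intro Bochner_Integration.integrable_diff integrable_deviation_section that)
      show "AE \<omega> in paths. deviation N (m, \<omega>) - deviation N (m', \<omega>) \<le> mixing_bound"
        by (intro AE_I2 abs_le_D1[OF deviation_diff_le] that)
    qed
    finally show ?thesis .
  qed
  have int: "integrable \<nu> e"
    unfolding e_def by (rule run.integrable_fst'[OF integrable_deviation])
  have "(\<integral>m. e m \<partial>\<nu>) = 0"
    unfolding e_def using run.integral_fst'[OF integrable_deviation] integral_deviation by simp
  moreover have "e m - mixing_bound \<le> (\<integral>m. e m \<partial>\<nu>)"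
  proof (rule st.integral_ge_const[OF int])
    show "AE m' in \<nu>. e m - mixing_bound \<le> e m'"
      using support by eventually_elim (use diff[OF m] in fastforce)
  qed
  moreover have "(\<integral>m. e m \<partial>\<nu>) \<le> e m + mixing_bound"
  proof (rule st.integral_le_const[OF int])
    show "AE m' in \<nu>. e m' \<le> e m + mixing_bound"
      using support by eventually_elim (use diff[OF _ m] in fastforce)
  qed
  ultimately show ?thesis unfolding e_def by (simp add: abs_le_iff)
qed

text \<open>Conditionally on the first step, the rest of the sum has bounded mean, so the cross term does not
  grow with \<open>N\<close>.\<close>

lemma integral_cross_term:
  "(\<integral>p. fluct 0 p * deviation N (advance p) \<partial>runs) \<le> mixing_bound * (\<integral>q. \<bar>centred q\<bar> \<partial>pairs)"
proof -
  let ?s = "\<lambda>q. (fst (fst q), case_nat (snd (fst q)) (snd q)) :: real \<times> (nat \<Rightarrow> real)"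
  let ?f = "\<lambda>p. fluct 0 p * deviation N (advance p)"
  let ?g = "\<lambda>q. centred (fst q) * deviation N (next_state (fst q), snd q)"
  have s [measurable]: "?s \<in> measurable (pairs \<Otimes>\<^sub>M paths) runs"
    by measurable
  have "integrable runs (\<lambda>p. (fluct 0 p)\<^sup>2 + (deviation N (advance p))\<^sup>2)"
    using integrable_fluct_0_square integrable_advance[OF integrable_deviation_square] by simp
  then have f: "integrable runs ?f"
  proof (rule Bochner_Integration.integrable_bound)
    show "AE p in runs. norm (?f p) \<le> norm ((fluct 0 p)\<^sup>2 + (deviation N (advance p))\<^sup>2)"
    proof (rule AE_I2)
      fix p
      have "0 \<le> (\<bar>fluct 0 p\<bar> - \<bar>deviation N (advance p)\<bar>)\<^sup>2" by simp
      then have "2 * (\<bar>fluct 0 p\<bar> * \<bar>deviation N (advance p)\<bar>) \<le> (fluct 0 p)\<^sup>2 + (deviation N (advance p))\<^sup>2"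
        by (simp add: power2_diff)
      moreover have "0 \<le> \<bar>fluct 0 p\<bar> * \<bar>deviation N (advance p)\<bar>" by simp
      ultimately have "\<bar>?f p\<bar> \<le> (fluct 0 p)\<^sup>2 + (deviation N (advance p))\<^sup>2"
        unfolding abs_mult by linarith
      then show "norm (?f p) \<le> norm ((fluct 0 p)\<^sup>2 + (deviation N (advance p))\<^sup>2)"
        by simp
    qed
  qed simp
  have g_eq: "(\<lambda>q. ?f (?s q)) = ?g"
    by (auto simp: fluct_0 advance_def)
  have g: "integrable (pairs \<Otimes>\<^sub>M paths) ?g"
    unfolding g_eq[symmetric] by (rule integrable_distr[OF s]) (simp only: runs_split_law f)
  have "(\<integral>p. ?f p \<partial>runs) = (\<integral>p. ?f p \<partial>distr (pairs \<Otimes>\<^sub>M paths) runs ?s)"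
    by (simp only: runs_split_law)
  also have "\<dots> = (\<integral>q. ?g q \<partial>(pairs \<Otimes>\<^sub>M paths))"
    unfolding g_eq[symmetric] by (rule integral_distr[OF s]) simp
  also have "\<dots> = (\<integral>q. (\<integral>\<omega>. ?g (q, \<omega>) \<partial>paths) \<partial>pairs)"
    by (rule triple.integral_fst'[symmetric, OF g])
  also have "\<dots> \<le> (\<integral>q. mixing_bound * \<bar>centred q\<bar> \<partial>pairs)"
  proof (rule integral_mono)
    show "integrable pairs (\<lambda>q. \<integral>\<omega>. ?g (q, \<omega>) \<partial>paths)"
      by (rule triple.integrable_fst'[OF g])
    show "integrable pairs (\<lambda>q. mixing_bound * \<bar>centred q\<bar>)"
      using integrable_centred by simp
    fix q
    have "(\<integral>\<omega>. ?g (q, \<omega>) \<partial>paths) = centred q * (\<integral>\<omega>. deviation N (next_state q, \<omega>) \<partial>paths)"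
      by simp
    also have "\<dots> \<le> \<bar>centred q\<bar> * \<bar>\<integral>\<omega>. deviation N (next_state q, \<omega>) \<partial>paths\<bar>"
      by (metis abs_ge_self abs_mult)
    also have "\<dots> \<le> \<bar>centred q\<bar> * mixing_bound"
      using c_pos by (intro mult_left_mono deviation_mean_le soft_clamp_abs_le) auto
    finally show "(\<integral>\<omega>. ?g (q, \<omega>) \<partial>paths) \<le> mixing_bound * \<bar>centred q\<bar>"
      by (simp add: mult.commute)
  qed
  finally show ?thesis using integrable_centred by simp
qed

text \<open>Expanding the square of the first term plus the rest, stationarity gives the rest the
  second moment of \<open>N\<close> terms. The first square and the cross term add at most
  \<open>C\<close>, uniformly in \<open>N\<close>.\<close>

lemma deviation_second_moment:
  defines "C \<equiv> (\<integral>p. (fluct 0 p)\<^sup>2 \<partial>runs) + 2 * (mixing_bound * (\<integral>q. \<bar>centred q\<bar> \<partial>pairs))"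
  shows "(\<integral>p. (deviation N p)\<^sup>2 \<partial>runs) \<le> C * N"
proof (induction N)
  case (Suc N)
  let ?a = "\<lambda>p. deviation N (advance p)"
  have a: "integrable runs (\<lambda>p. (?a p)\<^sup>2)"
    by (rule integrable_advance[OF integrable_deviation_square])
  have "integrable runs (\<lambda>p. (deviation (Suc N) p)\<^sup>2 - (fluct 0 p)\<^sup>2 - (?a p)\<^sup>2)"
    using a integrable_deviation_square integrable_fluct_0_square by simp
  then have x: "integrable runs (\<lambda>p. fluct 0 p * ?a p * 2)"
    by (simp add: deviation_Suc power2_sum mult_ac)
  have "(\<integral>p. (deviation (Suc N) p)\<^sup>2 \<partial>runs) = (\<integral>p. ((fluct 0 p)\<^sup>2 + (?a p)\<^sup>2) + fluct 0 p * ?a p * 2 \<partial>runs)"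
    by (simp add: deviation_Suc power2_sum mult_ac)
  also have "\<dots> = (\<integral>p. (fluct 0 p)\<^sup>2 \<partial>runs) + (\<integral>p. (?a p)\<^sup>2 \<partial>runs) + (\<integral>p. fluct 0 p * ?a p \<partial>runs) * 2"
    using a x integrable_fluct_0_square by simp
  also have "(\<integral>p. (?a p)\<^sup>2 \<partial>runs) = (\<integral>p. (deviation N p)\<^sup>2 \<partial>runs)"
    by (rule integral_advance) simp
  also have "(\<integral>p. (fluct 0 p)\<^sup>2 \<partial>runs) + (\<integral>p. (deviation N p)\<^sup>2 \<partial>runs) + (\<integral>p. fluct 0 p * ?a p \<partial>runs) * 2
      \<le> C + C * N"
    using Suc integral_cross_term[of N] by (simp add: C_def)
  finally show ?case by (simp add: algebra_simps)
qed (simp add: deviation_def)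

text \<open>The strong law holds from almost every starting state, hence from some
  \<open>m0\<close>. By \<open>log_sum_lipschitz\<close> every other start differs by a bounded
  amount on the same path, so a single null set serves all \<open>m\<close>.\<close>

lemma log_sum_law_of_large_numbers:
  "AE \<omega> in paths. \<forall>m. (\<lambda>N. log_sum c m \<omega> N / N) \<longlonglongrightarrow> lyapunov"
proof -
  define C where "C = (\<integral>p. (fluct 0 p)\<^sup>2 \<partial>runs) + 2 * (mixing_bound * (\<integral>q. \<bar>centred q\<bar> \<partial>pairs))"
  have mb: "0 \<le> mixing_bound"
    using c_pos contr_rate_bounds[of c] by (simp add: mixing_bound_def)
  have "AE p in runs. (\<lambda>N. (\<Sum>k<N. fluct k p) / N) \<longlonglongrightarrow> 0"
  proof (rule strong_law_second_moments[where C = C])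
    show "(\<integral>p. (fluct k p)\<^sup>2 \<partial>runs) \<le> C" for k
      using fluct_square(2)[of k] mb by (simp add: C_def)
    show "(\<integral>p. (\<Sum>k<N. fluct k p)\<^sup>2 \<partial>runs) \<le> C * N" for N
      using deviation_second_moment[of N] by (simp add: deviation_def C_def)
    show "integrable runs (\<lambda>p. (\<Sum>k<N. fluct k p)\<^sup>2)" for N
      using integrable_deviation_square[of N] by (simp add: deviation_def)
  qed (simp_all add: fluct_square(1))
  then have "AE m in \<nu>. AE \<omega> in paths. (\<lambda>N. deviation N (m, \<omega>) / N) \<longlonglongrightarrow> 0"
    unfolding deviation_def by (rule run.AE_pair)
  then obtain m0 where "AE \<omega> in paths. (\<lambda>N. deviation N (m0, \<omega>) / N) \<longlonglongrightarrow> 0"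
    using eventually_happens'[OF st.ae_filter_bot] by blast
  then show ?thesis
  proof eventually_elim
    case (elim \<omega>)
    show ?case
    proof
      fix m
      have "(\<lambda>N. (log_sum c m \<omega> N - log_sum c m0 \<omega> N) / N) \<longlonglongrightarrow> 0"
      proof (rule Lim_null_comparison)
        show "(\<lambda>N. (\<bar>m - m0\<bar> / (1 - contr_rate c)) / real N) \<longlonglongrightarrow> 0"
          by (rule lim_const_over_n)
        show "\<forall>\<^sub>F N in sequentially. norm ((log_sum c m \<omega> N - log_sum c m0 \<omega> N) / N)
            \<le> (\<bar>m - m0\<bar> / (1 - contr_rate c)) / real N"
        proof (intro always_eventually allI)
          fix N
          show "norm ((log_sum c m \<omega> N - log_sum c m0 \<omega> N) / N)
              \<le> (\<bar>m - m0\<bar> / (1 - contr_rate c)) / real N"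
            using divide_right_mono[OF log_sum_lipschitz[of c m \<omega> N m0], of "real N"] c_pos by simp
        qed
      qed
      from tendsto_add[OF tendsto_add[OF this elim] tendsto_const[of lyapunov]]
      have "(\<lambda>N. (log_sum c m \<omega> N - log_sum c m0 \<omega> N) / N + deviation N (m0, \<omega>) / N + lyapunov) \<longlonglongrightarrow> lyapunov"
        by simp
      then show "(\<lambda>N. log_sum c m \<omega> N / N) \<longlonglongrightarrow> lyapunov"
      proof (rule Lim_transform_eventually)
        show "\<forall>\<^sub>F N in sequentially. (log_sum c m \<omega> N - log_sum c m0 \<omega> N) / N + deviation N (m0, \<omega>) / N + lyapunov
            = log_sum c m \<omega> N / N"
          using eventually_gt_at_top[of 0]
          by eventually_elim (simp add: deviation_eq diff_divide_distrib)
      qed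
    qed
  qed
qed

end

section \<open>The free energy\<close>

context centered_law
begin

definition lyap :: "real \<Rightarrow> real" where
  "lyap c = stationary_chain.lyapunov \<mu> (distr paths borel (backward_limit c)) c"

lemma lyap_limit:
  assumes "0 < c"
  shows "AE \<omega> in paths. \<forall>m. (\<lambda>N. log_sum c m \<omega> N / N) \<longlonglongrightarrow> lyap c"
proof -
  interpret stationary_chain \<mu> "distr paths borel (backward_limit c)" c
    by (rule stationary_exists[OF assms])
  show ?thesis unfolding lyap_def by (rule log_sum_law_of_large_numbers)
qed

text \<open>This disposes of the isolated last field in \<open>ln_ising_Z_Suc\<close>.\<close>

lemma field_sublinear: "AE \<omega> in paths. (\<lambda>n. \<omega> n / Suc n) \<longlonglongrightarrow> 0"
proof -
  have comp: "distr paths \<mu> (\<lambda>\<omega>. \<omega> n) = \<mu>" for n by (rule path.PiM_component) simp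
  have m: "(\<lambda>\<omega>. \<omega> n) \<in> measurable paths \<mu>" for n by simp
  have int: "integrable paths (\<lambda>\<omega>. (\<omega> n)\<^sup>2)" for n
    using integrable_distr[OF m, of n "\<lambda>x. x\<^sup>2"] square_integrable by (simp add: comp)
  have eq: "(\<integral>\<omega>. (\<omega> n)\<^sup>2 \<partial>paths) = (\<integral>x. x\<^sup>2 \<partial>\<mu>)" for n
    using integral_distr[OF m, of "\<lambda>x. x\<^sup>2" n] by (simp add: comp)
  have "AE \<omega> in paths. (\<lambda>n. (\<omega> n / Suc n)\<^sup>2) \<longlonglongrightarrow> 0"
  proof (rule AE_tendsto_0_if_summable_integral)
    show "integrable paths (\<lambda>\<omega>. (\<omega> n / Suc n)\<^sup>2)" for n
      using int unfolding power_divide by simp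
    have "summable (\<lambda>n. (\<integral>x. x\<^sup>2 \<partial>\<mu>) * inverse ((real (Suc n))\<^sup>2))"
      using inverse_power_summable[of 2, where 'a = real] by (intro summable_mult) (subst summable_Suc_iff, simp)
    then show "summable (\<lambda>n. \<integral>\<omega>. (\<omega> n / real (Suc n))\<^sup>2 \<partial>paths)"
      unfolding power_divide using eq by (simp add: divide_inverse)
  qed simp
  then show ?thesis
  proof eventually_elim
    case (elim \<omega>)
    from tendsto_real_sqrt[OF this] show ?case
      by (simp only: real_sqrt_abs real_sqrt_zero tendsto_rabs_zero_iff)
  qed
qed

text \<open>Reindexing by \<open>Suc\<close> transports the canonical field on the positive integers
  to paths indexed from 0.\<close>

lemma AE_iid_field:
  assumes "AE \<omega> in paths. P \<omega>"
  shows "AE h in iid_field \<mu>. P (\<lambda>n. h (Suc n))"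
proof -
  have "distr (\<Pi>\<^sub>M n\<in>{1..}. \<mu>) paths (\<lambda>h. \<lambda>n\<in>UNIV. h (Suc n)) = paths"
    using distr_PiM_reindex[of "{1..}" "\<lambda>_. \<mu>" Suc UNIV] prob_space_axioms by auto
  then have *: "distr (iid_field \<mu>) paths (\<lambda>h n. h (Suc n)) = paths"
    by (simp add: iid_field_def restrict_UNIV)
  have "(\<lambda>h n. h (Suc n)) \<in> measurable (iid_field \<mu>) paths"
    unfolding iid_field_def by (rule measurable_PiM_single') (auto simp: space_PiM)
  then show ?thesis
    by (rule AE_distrD) (simp only: * assms)
qed

lemma free_energy_limit:
  assumes "0 < J"
  shows "AE h in iid_field \<mu>. \<forall>a\<in>{-1, 1}. \<forall>b\<in>{-1, 1}.
    (\<lambda>N. ln (ising_Z N h a b J) / real N) \<longlonglongrightarrow> lyap (2 * J)"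
proof -
  have "AE \<omega> in paths. (\<forall>m. (\<lambda>N. log_sum (2 * J) m \<omega> N / N) \<longlonglongrightarrow> lyap (2 * J))
      \<and> (\<lambda>n. \<omega> n / Suc n) \<longlonglongrightarrow> 0"
    using lyap_limit[of "2 * J"] field_sublinear assms by simp
  from AE_iid_field[OF this] show ?thesis
  proof eventually_elim
    case (elim h)
    define \<omega> where "\<omega> = (\<lambda>n. h (Suc n))"
    have l: "(\<lambda>N. log_sum (2 * J) m \<omega> N / N) \<longlonglongrightarrow> lyap (2 * J)" for m
      using elim by (simp add: \<omega>_def)
    have \<omega>0: "(\<lambda>n. \<omega> n / Suc n) \<longlonglongrightarrow> 0"
      using elim by (simp add: \<omega>_def)
    show ?case
    proof (intro ballI)
      fix a b :: real assume a: "a \<in> {-1, 1}" and b: "b \<in> {-1, 1}"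
      define K where "K = (if a = 1 then 0 else - (2 * J))"
      define M where "M N = (if b = 1 then 0 else chain (2 * J) (a * (2 * J)) \<omega> N)" for N
      have eq: "ln (ising_Z (Suc N) h a b J) = K + b * \<omega> N + log_sum (2 * J) (a * (2 * J)) \<omega> N - M N" for N
        unfolding K_def M_def \<omega>_def using ln_ising_Z_Suc[OF a b] by simp
      have "(\<lambda>N. K / real N) \<longlonglongrightarrow> 0" by (rule lim_const_over_n)
      then have 1: "(\<lambda>N. K / real (Suc N)) \<longlonglongrightarrow> 0" by (rule LIMSEQ_Suc)
      have "(\<lambda>N. 2 * J / real N) \<longlonglongrightarrow> 0" by (rule lim_const_over_n)
      then have bound0: "(\<lambda>N. 2 * J / real (Suc N)) \<longlonglongrightarrow> 0" by (rule LIMSEQ_Suc)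
      have bound: "norm (M N / real (Suc N)) \<le> 2 * J / real (Suc N)" for N
      proof -
        have "\<bar>M N\<bar> \<le> 2 * J"
          using chain_abs_le[of "2 * J" "a * (2 * J)" \<omega> N] a assms by (auto simp: M_def)
        then show ?thesis by (simp add: divide_right_mono)
      qed
      have 2: "(\<lambda>N. M N / real (Suc N)) \<longlonglongrightarrow> 0"
        by (rule Lim_null_comparison[OF _ bound0]) (intro always_eventually allI bound)
      \<comment> \<open>The field sum has \<open>N\<close> terms while the chain has length
        \<open>Suc N\<close>; the ratio of the two tends to 1.\<close>
      have "(\<lambda>N. log_sum (2 * J) (a * (2 * J)) \<omega> N / N * (real N / real (Suc N))) \<longlonglongrightarrow> lyap (2 * J) * 1"
        by (intro tendsto_mult l LIMSEQ_n_over_Suc_n)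
      moreover have "log_sum (2 * J) (a * (2 * J)) \<omega> N / N * (real N / real (Suc N))
          = log_sum (2 * J) (a * (2 * J)) \<omega> N / real (Suc N)" for N
        by (cases "N = 0") (auto simp: log_sum_def)
      ultimately have 3: "(\<lambda>N. log_sum (2 * J) (a * (2 * J)) \<omega> N / real (Suc N)) \<longlonglongrightarrow> lyap (2 * J)"
        by simp
      have "(\<lambda>N. K / real (Suc N) + b * (\<omega> N / real (Suc N))
          + log_sum (2 * J) (a * (2 * J)) \<omega> N / real (Suc N) - M N / real (Suc N))
        \<longlonglongrightarrow> 0 + b * 0 + lyap (2 * J) - 0"
        by (intro tendsto_intros 1 2 3 \<omega>0)
      then have "(\<lambda>N. ln (ising_Z (Suc N) h a b J) / real (Suc N)) \<longlonglongrightarrow> lyap (2 * J)"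
        unfolding eq by (simp add: add_divide_distrib diff_divide_distrib)
      then show "(\<lambda>N. ln (ising_Z N h a b J) / real N) \<longlonglongrightarrow> lyap (2 * J)"
        by (rule LIMSEQ_imp_Suc)
    qed
  qed
qed

lemma prob_space_iid_field: "prob_space (iid_field \<mu>)"
  unfolding iid_field_def by (rule prob_space_PiM) (rule prob_space_axioms)

text \<open>Two candidate limits hold on sets of full probability, which intersect; this gives the
  uniqueness that \<open>THE\<close> demands.\<close>

lemma free_energy_eq:
  assumes "0 < J"
  shows "free_energy \<mu> J = lyap (2 * J)"
  unfolding free_energy_def
proof (rule the_equality)
  interpret iid: prob_space "iid_field \<mu>" by (rule prob_space_iid_field)
  fix F assume "AE h in iid_field \<mu>. \<forall>a\<in>{-1, 1}. \<forall>b\<in>{-1, 1}. (\<lambda>N. ln (ising_Z N h a b J) / real N) \<longlonglongrightarrow> F"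
  with free_energy_limit[OF assms]
  have "AE h in iid_field \<mu>. F = lyap (2 * J)"
  proof eventually_elim
    case (elim h)
    then have "(\<lambda>N. ln (ising_Z N h 1 1 J) / real N) \<longlonglongrightarrow> lyap (2 * J)"
      "(\<lambda>N. ln (ising_Z N h 1 1 J) / real N) \<longlonglongrightarrow> F" by auto
    then show ?case by (rule LIMSEQ_unique[OF _ _, symmetric])
  qed
  then show "F = lyap (2 * J)" by simp
qed (rule free_energy_limit[OF assms])

end

section \<open>Convexity of the free energy in the coupling\<close>

lemma ising_Z_pos:
  assumes a: "a \<in> {-1, 1}" and b: "b \<in> {-1, 1}"
  shows "0 < ising_Z (Suc N) h a b J"
proof -
  have "spin_configs (Suc N) a b \<noteq> {}"
  proof -
    have "(\<lambda>n\<in>{0..Suc N}. if n = 0 then a else b) \<in> spin_configs (Suc N) a b"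
      using a b by (auto simp: spin_configs_def)
    then show ?thesis by blast
  qed
  then show ?thesis
    unfolding ising_Z_def by (intro sum_pos finite_spin_configs) auto
qed

text \<open>Convexity of the logarithm of a sum of exponentials. The slope \<open>D\<close> is the
  Gibbs mean, at coupling \<open>J\<close>, of the derivative \<open>- 2 * W \<sigma>\<close> of the
  exponent.\<close>

lemma ln_ising_Z_subgradient:
  assumes a: "a \<in> {-1, 1}" and b: "b \<in> {-1, 1}"
  shows "\<exists>D. \<forall>K. ln (ising_Z (Suc N) h a b J) + D * (K - J) \<le> ln (ising_Z (Suc N) h a b K)"
proof -
  define S where "S = spin_configs (Suc N) a b"
  define W where "W \<sigma> = (\<Sum>n = 1..Suc N. of_bool (\<sigma> n \<noteq> \<sigma> (n - 1)) :: real)" for \<sigma> :: "nat \<Rightarrow> real"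
  define H where "H \<sigma> = (\<Sum>n = 1..Suc N. \<sigma> n * h n)" for \<sigma>
  define w where "w \<sigma> = exp (- 2 * J * W \<sigma> + H \<sigma>)" for \<sigma>
  define Z where "Z = (\<Sum>\<sigma>\<in>S. w \<sigma>)"
  have Z_eq: "ising_Z (Suc N) h a b K = (\<Sum>\<sigma>\<in>S. exp (- 2 * K * W \<sigma> + H \<sigma>))" for K
    by (simp only: ising_Z_def S_def W_def H_def)
  have Z: "ising_Z (Suc N) h a b J = Z"
    by (simp only: Z_eq Z_def w_def)
  have Zpos: "0 < Z" using ising_Z_pos[OF a b, of N h J] by (simp add: Z)
  define D where "D = (\<Sum>\<sigma>\<in>S. w \<sigma> * (- 2 * W \<sigma>)) / Z"
  have "ln (ising_Z (Suc N) h a b J) + D * (K - J) \<le> ln (ising_Z (Suc N) h a b K)" for K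
  proof -
    define x where "x \<sigma> = - 2 * (K - J) * W \<sigma>" for \<sigma>
    define m where "m = D * (K - J)"
    have "(\<Sum>\<sigma>\<in>S. w \<sigma> * x \<sigma>) = (\<Sum>\<sigma>\<in>S. w \<sigma> * (- 2 * W \<sigma>)) * (K - J)"
      unfolding x_def sum_distrib_right by (intro sum.cong) (simp_all add: algebra_simps)
    also have "\<dots> = m * Z"
      using Zpos by (simp add: m_def D_def)
    finally have mZ: "(\<Sum>\<sigma>\<in>S. w \<sigma> * x \<sigma>) = m * Z" .
    \<comment> \<open>As \<open>m\<close> is the Gibbs mean of \<open>x\<close>, the linear term
      sums to zero; the next estimate is Jensen's inequality through the tangent of
      \<open>exp\<close> at \<open>m\<close>.\<close>
    have "exp m * Z = (\<Sum>\<sigma>\<in>S. w \<sigma> * (exp m * (1 + (x \<sigma> - m))))"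
    proof -
      have "(\<Sum>\<sigma>\<in>S. w \<sigma> * (exp m * (1 + (x \<sigma> - m)))) = exp m * (Z + (\<Sum>\<sigma>\<in>S. w \<sigma> * x \<sigma>) - m * Z)"
        by (simp add: Z_def sum_distrib_left sum.distrib sum_subtractf algebra_simps)
      then show ?thesis by (simp add: mZ)
    qed
    also have "\<dots> \<le> (\<Sum>\<sigma>\<in>S. w \<sigma> * exp (x \<sigma>))"
    proof (intro sum_mono mult_left_mono)
      fix \<sigma>
      have "exp m * (1 + (x \<sigma> - m)) \<le> exp m * exp (x \<sigma> - m)"
        by (intro mult_left_mono exp_ge_add_one_self) simp
      then show "exp m * (1 + (x \<sigma> - m)) \<le> exp (x \<sigma>)" by (simp flip: exp_add)
    qed (simp add: w_def)
    also have "\<dots> = ising_Z (Suc N) h a b K"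
      unfolding Z_eq w_def x_def exp_add[symmetric]
      by (intro sum.cong arg_cong[where f = exp]) (simp_all add: algebra_simps)
    finally have "ln (exp m * Z) \<le> ln (ising_Z (Suc N) h a b K)"
      using Zpos by (subst ln_le_cancel_iff) (auto intro: ising_Z_pos[OF a b])
    then show ?thesis
      using Zpos by (simp add: ln_mult Z m_def)
  qed
  then show ?thesis by blast
qed

text \<open>Convexity at finite length survives the almost sure limit; for fixed \<open>x\<close>,
  \<open>y\<close> and \<open>t\<close> only three null sets have to be avoided.\<close>

lemma (in centered_law) free_energy_convex: "convex_on {0<..} (free_energy \<mu>)"
proof (rule convex_onI)
  fix t x y :: real
  assume t: "0 < t" "t < 1" and xy: "x \<in> {0<..}" "y \<in> {0<..}"
  define z where "z = (1 - t) *\<^sub>R x + t *\<^sub>R y"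
  have z: "0 < z" using t xy by (auto simp: z_def intro!: add_pos_pos)
  have x: "0 < x" and y: "0 < y" using xy by auto
  interpret iid: prob_space "iid_field \<mu>" by (rule prob_space_iid_field)
  have "AE h in iid_field \<mu>. free_energy \<mu> z \<le> (1 - t) * free_energy \<mu> x + t * free_energy \<mu> y"
    using free_energy_limit[OF x] free_energy_limit[OF y] free_energy_limit[OF z]
  proof eventually_elim
    fix h
    let ?f = "\<lambda>J N. ln (ising_Z (Suc N) h 1 1 J) / real (Suc N)"
    assume "\<forall>a\<in>{-1, 1}. \<forall>b\<in>{-1, 1}. (\<lambda>N. ln (ising_Z N h a b x) / real N) \<longlonglongrightarrow> lyap (2 * x)"
      "\<forall>a\<in>{-1, 1}. \<forall>b\<in>{-1, 1}. (\<lambda>N. ln (ising_Z N h a b y) / real N) \<longlonglongrightarrow> lyap (2 * y)"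
      "\<forall>a\<in>{-1, 1}. \<forall>b\<in>{-1, 1}. (\<lambda>N. ln (ising_Z N h a b z) / real N) \<longlonglongrightarrow> lyap (2 * z)"
    then have "(\<lambda>N. ln (ising_Z N h 1 1 x) / real N) \<longlonglongrightarrow> free_energy \<mu> x"
        "(\<lambda>N. ln (ising_Z N h 1 1 y) / real N) \<longlonglongrightarrow> free_energy \<mu> y"
        "(\<lambda>N. ln (ising_Z N h 1 1 z) / real N) \<longlonglongrightarrow> free_energy \<mu> z"
      by (simp_all add: free_energy_eq x y z)
    note lim = this[THEN LIMSEQ_Suc]
    show "free_energy \<mu> z \<le> (1 - t) * free_energy \<mu> x + t * free_energy \<mu> y"
    proof (rule LIMSEQ_le[OF lim(3)])
      show "(\<lambda>N. (1 - t) * ?f x N + t * ?f y N) \<longlonglongrightarrow> (1 - t) * free_energy \<mu> x + t * free_energy \<mu> y"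
        by (intro tendsto_intros lim)
      have "?f z N \<le> (1 - t) * ?f x N + t * ?f y N" for N
      proof -
        let ?g = "\<lambda>J. ln (ising_Z (Suc N) h 1 1 J)"
        obtain D where D: "\<And>K. ?g z + D * (K - z) \<le> ?g K"
          using ln_ising_Z_subgradient[of 1 1 N h z] by auto
        have "(1 - t) * (?g z + D * (x - z)) + t * (?g z + D * (y - z)) \<le> (1 - t) * ?g x + t * ?g y"
          using t by (intro add_mono mult_left_mono D) auto
        moreover have "(1 - t) * (?g z + D * (x - z)) + t * (?g z + D * (y - z)) = ?g z"
          by (simp add: z_def algebra_simps)
        ultimately have "?g z / real (Suc N) \<le> ((1 - t) * ?g x + t * ?g y) / real (Suc N)"
          by (intro divide_right_mono) auto
        then show ?thesis by (simp add: add_divide_distrib)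
      qed
      then show "\<exists>N0. \<forall>N\<ge>N0. ?f z N \<le> (1 - t) * ?f x N + t * ?f y N" by blast
    qed
  qed
  then show "free_energy \<mu> ((1 - t) *\<^sub>R x + t *\<^sub>R y) \<le> (1 - t) * free_energy \<mu> x + t * free_energy \<mu> y"
    by (simp add: z_def)
qed simp

section \<open>Differentiability\<close>

lemma softplus_second_difference:
  assumes "\<bar>u - w\<bar> \<le> r" "\<bar>v - w\<bar> \<le> r"
  shows "\<bar>softplus u + softplus v - 2 * softplus w - sigmoid w * (u + v - 2 * w)\<bar> \<le> 2 * r\<^sup>2"
proof -
  have "(u - w)\<^sup>2 \<le> r\<^sup>2" "(v - w)\<^sup>2 \<le> r\<^sup>2"
    using assms by (metis abs_ge_zero power2_abs power_mono)+
  then have "\<bar>softplus u - softplus w - sigmoid w * (u - w)\<bar> \<le> r\<^sup>2"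
      "\<bar>softplus v - softplus w - sigmoid w * (v - w)\<bar> \<le> r\<^sup>2"
    using softplus_taylor[of u w] softplus_taylor[of v w] by linarith+
  then have "\<bar>(softplus u - softplus w - sigmoid w * (u - w))
      + (softplus v - softplus w - sigmoid w * (v - w))\<bar> \<le> 2 * r\<^sup>2"
    by linarith
  then show ?thesis by (simp add: algebra_simps)
qed

text \<open>Each step adds at most \<open>\<bar>e - c\<bar>\<close> and contracts the previous
  difference; the bound is the fixed point of that recursion.\<close>

lemma chain_parameter_lipschitz:
  assumes "0 \<le> c"
  shows "\<bar>chain e m \<omega> k - chain c m \<omega> k\<bar> \<le> \<bar>e - c\<bar> / (1 - contr_rate c)"
proof (induction k)
  case 0
  then show ?case using contr_rate_bounds[of c] by simp
next
  case (Suc k)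
  let ?x = "chain e m \<omega> k + 2 * \<omega> k" and ?y = "chain c m \<omega> k + 2 * \<omega> k"
  have pos: "0 < 1 - contr_rate c" using contr_rate_bounds[of c] by simp
  have "\<bar>soft_clamp e ?x - soft_clamp c ?y\<bar> \<le> \<bar>e - c\<bar> + contr_rate c * \<bar>chain e m \<omega> k - chain c m \<omega> k\<bar>"
    using soft_clamp_parameter_lipschitz[of e ?x c] soft_clamp_lipschitz[OF assms, of ?x ?y] by simp
  also have "\<dots> \<le> \<bar>e - c\<bar> + contr_rate c * (\<bar>e - c\<bar> / (1 - contr_rate c))"
    using Suc contr_rate_bounds[of c] by (intro add_left_mono mult_left_mono) auto
  also have "\<dots> = \<bar>e - c\<bar> / (1 - contr_rate c)"
    using pos by (simp add: field_simps)
  finally show ?case by simp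
qed

text \<open>\<open>r\<close> bounds the shift of each \<open>softplus\<close> argument:
  \<open>d / \<kappa>\<close> through the state and \<open>d\<close> through the barrier. Linearised
  at the middle chain, the second difference is multiplied by a slope of at most
  \<open>contr_rate c\<close> and receives an error \<open>2 * r\<^sup>2\<close> from each barrier;
  the bound is again a fixed point.\<close>

lemma chain_second_difference:
  fixes c d :: real
  assumes "0 \<le> c" "0 \<le> d"
  defines "\<kappa> \<equiv> 1 - contr_rate c"
  defines "r \<equiv> d / \<kappa> + d"
  shows "\<bar>chain (c + d) m \<omega> k + chain (c - d) m \<omega> k - 2 * chain c m \<omega> k\<bar> \<le> 4 * r\<^sup>2 / \<kappa>"
proof (induction k)
  case 0
  then show ?case using contr_rate_bounds[of c] by (simp add: \<kappa>_def)
next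
  case (Suc k)
  have \<kappa>: "0 < \<kappa>" using contr_rate_bounds[of c] by (simp add: \<kappa>_def)
  define a b e where "a = chain (c + d) m \<omega> k" and "b = chain (c - d) m \<omega> k" and "e = chain c m \<omega> k"
  define x where "x = 2 * \<omega> k"
  have ae: "\<bar>a - e\<bar> \<le> d / \<kappa>" and be: "\<bar>b - e\<bar> \<le> d / \<kappa>"
    using chain_parameter_lipschitz[OF assms(1), of "c + d" m \<omega> k]
      chain_parameter_lipschitz[OF assms(1), of "c - d" m \<omega> k] assms(2)
    by (simp_all add: a_def b_def e_def \<kappa>_def)
  define D where "D = a + b - 2 * e"
  define s1 where "s1 = softplus (- (a + x) - (c + d)) + softplus (- (b + x) - (c - d)) - 2 * softplus (- (e + x) - c)"
  define s2 where "s2 = softplus (a + x - (c + d)) + softplus (b + x - (c - d)) - 2 * softplus (e + x - c)"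
  have "\<bar>s1 - sigmoid (- (e + x) - c) * (- D)\<bar> \<le> 2 * r\<^sup>2"
    using softplus_second_difference[of "- (a + x) - (c + d)" "- (e + x) - c" r "- (b + x) - (c - d)"] ae be assms(2)
    by (simp add: s1_def D_def r_def algebra_simps)
  moreover have "\<bar>s2 - sigmoid (e + x - c) * D\<bar> \<le> 2 * r\<^sup>2"
    using softplus_second_difference[of "a + x - (c + d)" "e + x - c" r "b + x - (c - d)"] ae be assms(2)
    by (simp add: s2_def D_def r_def algebra_simps)
  moreover have "soft_clamp (c + d) (a + x) + soft_clamp (c - d) (b + x) - 2 * soft_clamp c (e + x) = D + s1 - s2"
    by (simp add: soft_clamp_def s1_def s2_def D_def)
  ultimately have "\<bar>soft_clamp (c + d) (a + x) + soft_clamp (c - d) (b + x) - 2 * soft_clamp c (e + x)\<bar>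
      \<le> \<bar>(1 - sigmoid (- (e + x) - c) - sigmoid (e + x - c)) * D\<bar> + 4 * r\<^sup>2"
    by (simp add: algebra_simps)
  also have "\<bar>(1 - sigmoid (- (e + x) - c) - sigmoid (e + x - c)) * D\<bar> \<le> contr_rate c * \<bar>D\<bar>"
    unfolding abs_mult using soft_clamp_slope[OF assms(1), of "e + x"] by (intro mult_right_mono) auto
  also have "contr_rate c * \<bar>D\<bar> \<le> contr_rate c * (4 * r\<^sup>2 / \<kappa>)"
    using Suc contr_rate_bounds[of c] by (intro mult_left_mono) (auto simp: D_def a_def b_def e_def)
  also have "contr_rate c * (4 * r\<^sup>2 / \<kappa>) + 4 * r\<^sup>2 = 4 * r\<^sup>2 / \<kappa>"
    using \<kappa> by (simp add: field_simps \<kappa>_def)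
  finally show ?case
    by (simp add: a_def b_def e_def x_def)
qed

text \<open>Each increment contains a single \<open>softplus\<close> with slope below 1, which adds
  \<open>2 * r\<^sup>2\<close> to the second difference of the states. Only an upper bound is asked
  for, since convexity supplies the lower one.\<close>

lemma log_sum_second_difference:
  fixes c d :: real
  assumes "0 \<le> c" "0 \<le> d"
  defines "\<kappa> \<equiv> 1 - contr_rate c"
  defines "r \<equiv> d / \<kappa> + d"
  shows "log_sum (c + d) m \<omega> N + log_sum (c - d) m \<omega> N - 2 * log_sum c m \<omega> N \<le> N * (4 * r\<^sup>2 / \<kappa> + 2 * r\<^sup>2)"
proof -
  have "log_increment (c + d) (chain (c + d) m \<omega> k) (\<omega> k) + log_increment (c - d) (chain (c - d) m \<omega> k) (\<omega> k)
      - 2 * log_increment c (chain c m \<omega> k) (\<omega> k) \<le> 4 * r\<^sup>2 / \<kappa> + 2 * r\<^sup>2" for k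
  proof -
    define a b e where "a = chain (c + d) m \<omega> k" and "b = chain (c - d) m \<omega> k" and "e = chain c m \<omega> k"
    define x where "x = 2 * \<omega> k"
    have ae: "\<bar>a - e\<bar> \<le> d / \<kappa>" and be: "\<bar>b - e\<bar> \<le> d / \<kappa>"
      using chain_parameter_lipschitz[OF assms(1), of "c + d" m \<omega> k]
        chain_parameter_lipschitz[OF assms(1), of "c - d" m \<omega> k] assms(2)
      by (simp_all add: a_def b_def e_def \<kappa>_def)
    define D where "D = a + b - 2 * e"
    define s where "s = softplus (- (c + d) - a - x) + softplus (- (c - d) - b - x) - 2 * softplus (- c - e - x)"
    have "\<bar>s - sigmoid (- c - e - x) * (- D)\<bar> \<le> 2 * r\<^sup>2"
      using softplus_second_difference[of "- (c + d) - a - x" "- c - e - x" r "- (c - d) - b - x"] ae be assms(2)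
      by (simp add: s_def D_def r_def algebra_simps)
    moreover have "\<bar>sigmoid (- c - e - x) * (- D)\<bar> \<le> \<bar>D\<bar>"
      using mult_right_mono[of "sigmoid (- c - e - x)" 1 "\<bar>D\<bar>"] sigmoid_pos[of "- c - e - x"] sigmoid_less_1[of "- c - e - x"]
      by (simp add: abs_mult)
    moreover have "\<bar>D\<bar> \<le> 4 * r\<^sup>2 / \<kappa>"
      using chain_second_difference[OF assms(1,2), of m \<omega> k] by (simp add: D_def a_def b_def e_def r_def \<kappa>_def)
    ultimately have "s \<le> 4 * r\<^sup>2 / \<kappa> + 2 * r\<^sup>2" by linarith
    then show ?thesis by (simp add: s_def log_increment_def a_def b_def e_def x_def)
  qed
  then have "(\<Sum>k<N. log_increment (c + d) (chain (c + d) m \<omega> k) (\<omega> k) + log_increment (c - d) (chain (c - d) m \<omega> k) (\<omega> k)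
      - 2 * log_increment c (chain c m \<omega> k) (\<omega> k)) \<le> (\<Sum>k<N. 4 * r\<^sup>2 / \<kappa> + 2 * r\<^sup>2)"
    by (intro sum_mono)
  then show ?thesis
    by (simp add: log_sum_def sum.distrib sum_subtractf sum_distrib_left)
qed

lemma (in centered_law) lyap_second_difference:
  fixes c d :: real
  assumes "0 < d" "d < c"
  defines "\<kappa> \<equiv> 1 - contr_rate c"
  shows "lyap (c + d) + lyap (c - d) - 2 * lyap c \<le> (4 / \<kappa> + 2) * (1 / \<kappa> + 1)\<^sup>2 * d\<^sup>2"
proof -
  define r where "r = d / \<kappa> + d"
  have *: "AE \<omega> in paths. lyap (c + d) + lyap (c - d) - 2 * lyap c \<le> 4 * r\<^sup>2 / \<kappa> + 2 * r\<^sup>2"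
  proof -
    have c: "0 < c + d" "0 < c - d" "0 < c" using assms by auto
    show ?thesis
      using lyap_limit[OF c(1)] lyap_limit[OF c(2)] lyap_limit[OF c(3)]
    proof eventually_elim
      case (elim \<omega>)
      have "(\<lambda>N. log_sum (c + d) 0 \<omega> N / N + log_sum (c - d) 0 \<omega> N / N - 2 * (log_sum c 0 \<omega> N / N))
          \<longlonglongrightarrow> lyap (c + d) + lyap (c - d) - 2 * lyap c"
        using elim by (intro tendsto_intros) auto
      then show ?case
      proof (rule LIMSEQ_le_const2)
        have "log_sum (c + d) 0 \<omega> N / N + log_sum (c - d) 0 \<omega> N / N - 2 * (log_sum c 0 \<omega> N / N)
            \<le> 4 * r\<^sup>2 / \<kappa> + 2 * r\<^sup>2" if "1 \<le> N" for N
        proof -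
          have "(log_sum (c + d) 0 \<omega> N + log_sum (c - d) 0 \<omega> N - 2 * log_sum c 0 \<omega> N) / N
              \<le> N * (4 * r\<^sup>2 / \<kappa> + 2 * r\<^sup>2) / N"
            using log_sum_second_difference[of c d 0 \<omega> N] assms
            by (intro divide_right_mono) (auto simp: r_def \<kappa>_def)
          then show ?thesis using that by (simp add: add_divide_distrib diff_divide_distrib)
        qed
        then show "\<exists>N0. \<forall>N\<ge>N0. log_sum (c + d) 0 \<omega> N / N + log_sum (c - d) 0 \<omega> N / N
            - 2 * (log_sum c 0 \<omega> N / N) \<le> 4 * r\<^sup>2 / \<kappa> + 2 * r\<^sup>2" by blast
      qed
    qed
  qed
  then have "lyap (c + d) + lyap (c - d) - 2 * lyap c \<le> 4 * r\<^sup>2 / \<kappa> + 2 * r\<^sup>2"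
    by simp
  also have "\<dots> = (4 / \<kappa> + 2) * r\<^sup>2"
    by (simp add: distrib_right)
  also have "r = (1 / \<kappa> + 1) * d" by (simp add: r_def distrib_right)
  finally show ?thesis by (simp add: power_mult_distrib mult.assoc)
qed

text \<open>For a convex function all left slopes lie below all right slopes, so the supremum of the
  left slopes separates them. The second-difference bound closes the gap to \<open>C * t\<close>,
  which makes this supremum the derivative. The chord bounds do not involve
  \<open>C\<close>.\<close>

lemma convex_differentiable:
  fixes f :: "real \<Rightarrow> real"
  assumes convex: "convex_on {0<..} f" and "0 < x"
    and second: "\<And>t. 0 < t \<Longrightarrow> t < x \<Longrightarrow> f (x + t) + f (x - t) - 2 * f x \<le> C * t\<^sup>2"
  shows "(f has_real_derivative deriv f x) (at x)"
    and "0 < t \<Longrightarrow> t < x \<Longrightarrow> deriv f x \<le> (f (x + t) - f x) / t"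
    and "0 < t \<Longrightarrow> t < x \<Longrightarrow> (f x - f (x - t)) / t \<le> deriv f x"
proof -
  define l where "l t = (f x - f (x - t)) / t" for t
  define r where "r t = (f (x + t) - f x) / t" for t
  have lr: "l s \<le> r t" if "0 < s" "s < x" "0 < t" for s t
  proof -
    have "f ((1 - s / (s + t)) *\<^sub>R (x - s) + (s / (s + t)) *\<^sub>R (x + t))
        \<le> (1 - s / (s + t)) * f (x - s) + (s / (s + t)) * f (x + t)"
      using that assms(2) by (intro convex_onD[OF convex]) auto
    also have "(1 - s / (s + t)) *\<^sub>R (x - s) + (s / (s + t)) *\<^sub>R (x + t) = x"
    proof -
      have "(1 - q) * (x - s) + q * (x + t) = x - s + q * (s + t)" for q
        by (simp add: algebra_simps)
      from this[of "s / (s + t)"] show ?thesis using that by simp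
    qed
    finally have "(s + t) * f x \<le> (s + t) * ((1 - s / (s + t)) * f (x - s) + (s / (s + t)) * f (x + t))"
      using that by (intro mult_left_mono) auto
    also have "\<dots> = t * f (x - s) + s * f (x + t)"
    proof -
      have "(s + t) * (1 - s / (s + t)) = t" "(s + t) * (s / (s + t)) = s"
        using that by (auto simp: right_diff_distrib)
      then show ?thesis by (simp only: distrib_left[of "s + t" "_ * _"] mult.assoc[symmetric])
    qed
    finally show ?thesis
      using that by (simp add: l_def r_def field_simps)
  qed
  define D where "D = (SUP s\<in>{0<..<x}. l s)"
  have ne: "{0<..<x} \<noteq> {}" using assms(2) by simp
  have Dr: "D \<le> r t" if "0 < t" for t
    unfolding D_def using that by (intro cSUP_least[OF ne] lr) auto
  have lD: "l s \<le> D" if "0 < s" "s < x" for s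
    unfolding D_def using that assms(2) by (intro cSUP_upper bdd_aboveI[of _ "r 1"]) (auto intro: lr)
  have rl: "r t - l t \<le> C * t" if "0 < t" "t < x" for t
  proof -
    have "r t - l t = (f (x + t) + f (x - t) - 2 * f x) / t"
      by (simp add: r_def l_def diff_divide_distrib add_divide_distrib)
    also have "\<dots> \<le> C * t\<^sup>2 / t" using second[OF that] that by (intro divide_right_mono) auto
    also have "\<dots> = C * t" using that by (simp add: power2_eq_square)
    finally show ?thesis .
  qed
  have quotient: "\<bar>(f (x + h) - f x) / h - D\<bar> \<le> C * \<bar>h\<bar>" if "h \<noteq> 0" "\<bar>h\<bar> < x" for h
  proof (cases "0 < h")
    case True
    then show ?thesis using Dr[of h] lD[of h] rl[of h] that by (simp add: r_def)
  next
    case False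
    then have h: "0 < - h" "- h < x" using that by auto
    have "(f (x + h) - f x) / h = l (- h)"
      by (simp add: l_def minus_divide_right[symmetric] diff_divide_distrib)
    then show ?thesis using Dr[of "- h"] lD[of "- h"] rl[of "- h"] h by simp
  qed
  have "((\<lambda>h. (f (x + h) - f x) / h - D) \<longlongrightarrow> 0) (at 0)"
  proof (rule Lim_null_comparison)
    have "((\<lambda>h. C * \<bar>h\<bar>) \<longlongrightarrow> C * \<bar>0\<bar>) (at 0)"
      by (intro tendsto_intros)
    then show "((\<lambda>h. C * \<bar>h\<bar>) \<longlongrightarrow> 0) (at 0)" by simp
    show "\<forall>\<^sub>F h in at 0. norm ((f (x + h) - f x) / h - D) \<le> C * \<bar>h\<bar>"
      using assms(2) quotient by (auto simp: eventually_at intro!: exI[of _ x])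
  qed
  then have "(f has_real_derivative D) (at x)"
    by (simp add: DERIV_def Lim_null[symmetric])
  then have "deriv f x = D" "(f has_real_derivative deriv f x) (at x)"
    by (auto dest: DERIV_imp_deriv)
  then show "(f has_real_derivative deriv f x) (at x)"
    and "0 < t \<Longrightarrow> t < x \<Longrightarrow> deriv f x \<le> (f (x + t) - f x) / t"
    and "0 < t \<Longrightarrow> t < x \<Longrightarrow> (f x - f (x - t)) / t \<le> deriv f x"
    using Dr lD by (auto simp: r_def l_def)
qed

text \<open>The constant of \<open>lyap_second_difference\<close>, which deteriorates exponentially
  in \<open>J\<close>, serves differentiability only; the resulting bounds are free of it.\<close>

lemma (in centered_law) free_energy_deriv_bounds:
  assumes "0 < t" "t < J"
  shows "deriv (free_energy \<mu>) J \<le> (free_energy \<mu> (J + t) - free_energy \<mu> J) / t"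
    and "(free_energy \<mu> J - free_energy \<mu> (J - t)) / t \<le> deriv (free_energy \<mu>) J"
proof -
  define \<kappa> where "\<kappa> = 1 - contr_rate (2 * J)"
  have J: "0 < J" using assms by simp
  \<comment> \<open>The barrier parameter is \<open>2 * J\<close>, so shifting \<open>J\<close> by
    \<open>s\<close> moves it by \<open>2 * s\<close>; hence the factor 4.\<close>
  have "free_energy \<mu> (J + s) + free_energy \<mu> (J - s) - 2 * free_energy \<mu> J
      \<le> ((4 / \<kappa> + 2) * (1 / \<kappa> + 1)\<^sup>2 * 4) * s\<^sup>2" if "0 < s" "s < J" for s
    using lyap_second_difference[of "2 * s" "2 * J"] that J
    by (simp add: free_energy_eq \<kappa>_def algebra_simps)
  note * = convex_differentiable[OF free_energy_convex J this]
  show "deriv (free_energy \<mu>) J \<le> (free_energy \<mu> (J + t) - free_energy \<mu> J) / t"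
    and "(free_energy \<mu> J - free_energy \<mu> (J - t)) / t \<le> deriv (free_energy \<mu>) J"
    using *(2,3)[of t] assms by auto
qed

section \<open>Test functions\<close>

text \<open>With the push \<open>A = softplus (z - c)\<close>, the square drops by \<open>z\<^sup>2
  - (z - A)\<^sup>2 = 2 * c * A + A * (2 * (z - c) - A)\<close>. The last product is the deviation
  from the leading term \<open>2 * c * A\<close>.\<close>

definition overshoot :: "real \<Rightarrow> real \<Rightarrow> real" where
  "overshoot c z = softplus (z - c) * (2 * (z - c) - softplus (z - c))"

lemma overshoot_measurable [measurable]: "overshoot c \<in> borel_measurable borel"
  unfolding overshoot_def[abs_def] by measurable

lemma square_minus_soft_clamp_square:
  "z\<^sup>2 - (soft_clamp c z)\<^sup>2 = 2 * c * (softplus (z - c) + softplus (- z - c))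
    + overshoot c z + overshoot c (- z) + 2 * (softplus (z - c) * softplus (- z - c))"
  by (simp add: soft_clamp_def overshoot_def power2_eq_square algebra_simps)

text \<open>Inside the barrier the push decays like \<open>exp (z - c)\<close>; half of the exponent
  absorbs the linear factor.\<close>

lemma overshoot_nonpos_bound:
  assumes "z \<le> c"
  shows "\<bar>overshoot c z\<bar> \<le> 3 * exp ((z - c) / 2)"
proof -
  define x where "x = c - z"
  have x: "0 \<le> x" using assms by (simp add: x_def)
  have A: "softplus (- x) \<le> exp (- x)" by (rule softplus_le_exp)
  have "\<bar>overshoot c z\<bar> = softplus (- x) * \<bar>- 2 * x - softplus (- x)\<bar>"
    by (simp add: overshoot_def x_def abs_mult)
  also have "\<bar>- 2 * x - softplus (- x)\<bar> = 2 * x + softplus (- x)"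
    using softplus_nonneg[of "- x"] x by linarith
  also have "softplus (- x) * (2 * x + softplus (- x)) \<le> exp (- x) * (2 * x + 1)"
    using A x by (intro mult_mono add_mono order_trans[OF A]) auto
  also have "exp (- x) * (2 * x + 1) = exp (- x / 2) * (exp (- x / 2) * (2 * x + 1))"
    by (simp flip: mult.assoc exp_add)
  also have "\<dots> \<le> exp (- x / 2) * 3"
  proof (rule mult_left_mono)
    have "2 * x + 1 \<le> 3 * (1 + x / 2 + (x / 2)\<^sup>2 / 2)"
      using zero_le_power2[of "x - 2 / 3"] by (simp add: power2_eq_square algebra_simps)
    also have "\<dots> \<le> 3 * exp (x / 2)"
      using exp_lower_Taylor_quadratic[of "x / 2"] x by (intro mult_left_mono) auto
    finally have "2 * x + 1 \<le> 3 * exp (x / 2)" .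
    then show "exp (- x / 2) * (2 * x + 1) \<le> 3"
      by (simp add: exp_minus field_simps)
  qed simp
  finally show ?thesis by (simp add: x_def mult.commute)
qed

lemma soft_clamp_ge: "z - softplus (z - c) \<le> soft_clamp c z"
  using softplus_nonneg[of "- z - c"] by (simp add: soft_clamp_def)

text \<open>The exponential is taken at the clamped state, whose law is again stationary. For
  \<open>z \<le> c\<close> clamping lowers \<open>z\<close> by at most 1, which costs a factor
  \<open>exp (1 / 2) \<le> 2\<close> and turns 3 into 6. For \<open>z > c\<close> the clamped state
  is at least \<open>c - 1\<close>, so the exponential term is at least 3 and covers the constant in
  \<open>(x + 1)\<^sup>2 \<le> 2 * x\<^sup>2 + 2\<close>.\<close>

lemma overshoot_bound:
  assumes c: "0 \<le> c"
  shows "\<bar>overshoot c z\<bar> \<le> 6 * exp ((soft_clamp c z - c) / 2) + 2 * (max 0 (z - c))\<^sup>2"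
proof -
  have e: "exp (- 1 / 2) \<ge> (1 / 2 :: real)"
    using exp_ge_add_one_self[of "- 1 / 2 :: real"] by simp
  show ?thesis
  proof (cases "z \<le> c")
    case True
    have "softplus (z - c) \<le> 1"
      using softplus_le[of "z - c"] True by simp
    then have "z - 1 \<le> soft_clamp c z" using soft_clamp_ge[of z c] by linarith
    then have "(z - c) / 2 + (- 1 / 2) \<le> (soft_clamp c z - c) / 2" by (simp add: field_simps)
    then have "exp ((z - c) / 2 + (- 1 / 2)) \<le> exp ((soft_clamp c z - c) / 2)"
      by (simp only: exp_le_cancel_iff)
    then have "exp ((z - c) / 2) * exp (- 1 / 2) \<le> exp ((soft_clamp c z - c) / 2)"
      by (simp only: exp_add)
    moreover have "exp ((z - c) / 2) * (1 / 2) \<le> exp ((z - c) / 2) * exp (- 1 / 2)"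
      by (intro mult_left_mono e) simp
    moreover have "0 \<le> (max 0 (z - c))\<^sup>2" by simp
    ultimately show ?thesis
      using overshoot_nonpos_bound[OF True] by linarith
  next
    case False
    define x A where "x = z - c" and "A = softplus (z - c)"
    have x: "0 < x" using False by (simp add: x_def)
    have A: "0 \<le> A" "A \<le> x + 1" "x \<le> A"
      using softplus_le[of x] softplus_nonneg[of "- x"] softplus_minus[of x] softplus_nonneg[of x] x
      by (auto simp: A_def x_def)
    have "softplus 0 \<le> 1" using softplus_le[of 0] by simp
    then have "c - 1 \<le> soft_clamp c c" using soft_clamp_ge[of c c] by simp
    also have "\<dots> \<le> soft_clamp c z" using False c by (intro soft_clamp_mono) auto
    finally have "exp (- 1 / 2) \<le> exp ((soft_clamp c z - c) / 2)"
      by simp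
    then have "3 \<le> 6 * exp ((soft_clamp c z - c) / 2)" using e by linarith
    moreover have "\<bar>overshoot c z\<bar> \<le> (x + 1) * (x + 1)"
      unfolding overshoot_def x_def[symmetric] A_def[unfolded x_def[symmetric], symmetric] abs_mult
      using A x by (intro mult_mono) auto
    moreover have "(x + 1) * (x + 1) \<le> 2 * x\<^sup>2 + 2"
      using zero_le_power2[of "x - 1"] by (simp add: power2_eq_square algebra_simps)
    moreover have "max 0 (z - c) = x" using x by (simp add: x_def)
    ultimately show ?thesis by simp
  qed
qed

text \<open>Large overshoots are positive, so the lower bound is uniform in \<open>z\<close>. It
  provides the a priori bound on the free energy under a finite variance.\<close>

lemma overshoot_ge: "- 3 \<le> overshoot c z"
proof (cases "z \<le> c")
  case True
  have "exp ((z - c) / 2) \<le> 1" using True by simp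
  then show ?thesis using overshoot_nonpos_bound[OF True] by linarith
next
  case False
  define x A where "x = z - c" and "A = softplus x"
  have x: "0 < x" using False by (simp add: x_def)
  have A: "0 \<le> A" "A \<le> x + 1"
    using softplus_le[of x] softplus_nonneg[of x] x by (auto simp: A_def)
  show ?thesis
  proof (cases "A \<le> 2 * x")
    case True
    then have "0 \<le> overshoot c z" using A by (simp add: overshoot_def x_def[symmetric] A_def[symmetric])
    then show ?thesis by simp
  next
    case False
    have "A * (A - 2 * x) \<le> 2 * 1" using False A x by (intro mult_mono) auto
    then show ?thesis by (simp add: overshoot_def x_def[symmetric] A_def[symmetric] algebra_simps)
  qed
qed

text \<open>Every \<open>z\<close> is at distance at least \<open>c\<close> from one of the
  barriers, and the push of that barrier is at most \<open>exp (- c)\<close>.\<close>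

lemma softplus_product_le:
  assumes "0 \<le> c"
  shows "softplus (z - c) * softplus (- z - c) \<le> exp (- c) * (softplus (z - c) + softplus (- z - c))"
proof (cases "0 \<le> z")
  case True
  then have "softplus (- z - c) \<le> exp (- c)"
    using softplus_le_exp[of "- z - c"] by (smt (verit) exp_le_cancel_iff)
  then have "softplus (z - c) * softplus (- z - c) \<le> softplus (z - c) * exp (- c)"
    by (intro mult_left_mono) auto
  then show ?thesis by (smt (verit) distrib_left mult.commute mult_nonneg_nonneg exp_ge_zero softplus_nonneg)
next
  case False
  then have "softplus (z - c) \<le> exp (- c)"
    using softplus_le_exp[of "z - c"] by (smt (verit) exp_le_cancel_iff)
  then have "softplus (z - c) * softplus (- z - c) \<le> exp (- c) * softplus (- z - c)"
    by (intro mult_right_mono) auto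
  then show ?thesis by (smt (verit) distrib_left mult_nonneg_nonneg exp_ge_zero softplus_nonneg)
qed

text \<open>The test function is convex, which yields a gain at every step, and has slope at most one, so that
  reflection at the barrier costs at most the push.\<close>

definition exp_tent :: "real \<Rightarrow> real \<Rightarrow> real \<Rightarrow> real" where
  "exp_tent c y z = (if z \<le> c then y * exp ((z - c) / y) else y + (z - c))"

lemma exp_tent_measurable [measurable]: "exp_tent c y \<in> borel_measurable borel"
  unfolding exp_tent_def[abs_def] by measurable

lemma exp_tent_increment:
  assumes "0 < y" "a \<le> b"
  shows "exp_tent c y a \<le> exp_tent c y b" "exp_tent c y b - exp_tent c y a \<le> b - a"
proof -
  have le: "y * exp ((b - c) / y) - y * exp ((a - c) / y) \<le> b - a" if "b \<le> c" "a \<le> b" for a b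
  proof -
    have "y * exp ((b - c) / y) - y * exp ((a - c) / y) = y * exp ((b - c) / y) * (1 - exp ((a - b) / y))"
      by (simp add: right_diff_distrib diff_divide_distrib flip: exp_add)
    also have "\<dots> \<le> y * 1 * ((b - a) / y)"
    proof (intro mult_mono)
      show "exp ((b - c) / y) \<le> 1" using that assms by (simp add: divide_nonpos_pos)
      show "1 - exp ((a - b) / y) \<le> (b - a) / y"
      proof -
        have "(b - a) / y = - ((a - b) / y)" by (simp add: minus_divide_left)
        then show ?thesis using exp_ge_add_one_self[of "(a - b) / y"] by linarith
      qed
      show "0 \<le> 1 - exp ((a - b) / y)" using that assms by (simp add: divide_nonpos_pos)
    qed (use assms in auto)
    finally show ?thesis using assms by simp
  qed
  show "exp_tent c y b - exp_tent c y a \<le> b - a"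
    using le[of b a] le[of c a] assms by (auto simp: exp_tent_def)
  have mono: "y * exp ((a - c) / y) \<le> y * exp ((b - c) / y)" if "a \<le> b" for a b
    using that assms by (simp add: divide_right_mono)
  show "exp_tent c y a \<le> exp_tent c y b"
  proof (cases "a \<le> c \<and> c < b")
    case True
    have "y * exp ((a - c) / y) \<le> y"
      using True assms by (intro mult_left_le) (auto simp: divide_nonpos_pos)
    then show ?thesis using True by (auto simp: exp_tent_def)
  next
    case False
    then show ?thesis using mono[of a b] assms by (auto simp: exp_tent_def)
  qed
qed

text \<open>A lower bound, uniform over scales \<open>y \<ge> 1\<close>, for the second-order gain
  of the exponential under a step \<open>2 * z\<close>. Only downward steps count: from below the
  barrier they stay in the exponential branch of \<open>exp_tent\<close>.\<close>

definition convexity_gain :: "real \<Rightarrow> real" where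
  "convexity_gain z = 2 * z\<^sup>2 * exp (- 2 * \<bar>z\<bar>) * of_bool (z < 0)"

lemma convexity_gain_measurable [measurable]: "convexity_gain \<in> borel_measurable borel"
  unfolding convexity_gain_def[abs_def] by measurable

text \<open>With \<open>s = - t\<close> the claim reads
  \<open>exp s * (1 - s) + s\<^sup>2 / 2 \<le> 1\<close>; the left side equals 1 at 0 and has
  derivative \<open>s * (1 - exp s)\<close>.\<close>

lemma exp_ge_quadratic_neg:
  assumes "(t::real) \<le> 0"
  shows "1 + t + t\<^sup>2 / 2 * exp t \<le> exp t"
proof -
  define s where "s = - t"
  have s: "0 \<le> s" using assms by (simp add: s_def)
  define f where "f u = exp u * (1 - u) + u\<^sup>2 / 2" for u :: real
  have "f s \<le> f 0"
  proof (rule DERIV_nonpos_imp_nonincreasing[OF s])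
    fix u :: real assume "0 \<le> u" "u \<le> s"
    have "(f has_real_derivative (u * (1 - exp u))) (at u)"
      unfolding f_def by (rule derivative_eq_intros refl | simp add: algebra_simps)+
    moreover have "u * (1 - exp u) \<le> 0"
      using \<open>0 \<le> u\<close> by (intro mult_nonneg_nonpos) auto
    ultimately show "\<exists>y. (f has_real_derivative y) (at u) \<and> y \<le> 0" by blast
  qed
  then have "exp s * (1 - s) + s\<^sup>2 / 2 \<le> 1" by (simp add: f_def)
  then have "exp (- s) * (exp s * (1 - s) + s\<^sup>2 / 2) \<le> exp (- s) * 1"
    by (intro mult_left_mono) auto
  then show ?thesis by (simp add: s_def distrib_left algebra_simps flip: mult.assoc exp_add)
qed

text \<open>The tangent at \<open>m\<close> improved by the gain. The exponential factor depends on
  the state alone and the bracket on the field alone, so under the product law the mean factorises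
  and the linear term \<open>2 * x\<close> disappears.\<close>

lemma exp_tent_ge:
  assumes y: "1 \<le> y" and m: "m \<le> c"
  shows "exp ((m - c) / y) * (y + 2 * x + convexity_gain x / y) \<le> exp_tent c y (m + 2 * x)"
proof (cases "m + 2 * x \<le> c")
  case True
  define t where "t = 2 * x / y"
  have yt: "y * t = 2 * x" using y by (simp add: t_def)
  have "y + 2 * x + convexity_gain x / y \<le> y * exp t"
  proof (cases "x < 0")
    case neg: True
    have "t \<le> 0" using neg y by (simp add: t_def divide_nonpos_pos)
    then have "y * (1 + t + t\<^sup>2 / 2 * exp t) \<le> y * exp t"
      using y by (intro mult_left_mono exp_ge_quadratic_neg) auto
    moreover have "convexity_gain x / y \<le> y * (t\<^sup>2 / 2 * exp t)"
    proof -
      have "2 * x * y \<le> 2 * x" using neg y by simp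
      then have "2 * x \<le> t" using y by (simp add: t_def pos_le_divide_eq)
      then have "convexity_gain x / y \<le> 2 * x\<^sup>2 * exp t / y"
        using neg y by (intro divide_right_mono) (auto simp: convexity_gain_def intro!: mult_left_mono)
      also have "\<dots> = y * (t\<^sup>2 / 2 * exp t)"
        using y by (simp add: t_def power2_eq_square field_simps)
      finally show ?thesis .
    qed
    moreover have "y * (1 + t + t\<^sup>2 / 2 * exp t) = y + 2 * x + y * (t\<^sup>2 / 2 * exp t)"
      by (simp only: distrib_left yt mult.right_neutral)
    ultimately show ?thesis by linarith
  next
    case False
    have "y * (1 + t) \<le> y * exp t" using y by (intro mult_left_mono exp_ge_add_one_self) auto
    then show ?thesis using False yt by (simp add: convexity_gain_def distrib_left)
  qed
  then have "exp ((m - c) / y) * (y + 2 * x + convexity_gain x / y) \<le> exp ((m - c) / y) * (y * exp t)"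
    by (intro mult_left_mono) auto
  also have "\<dots> = exp_tent c y (m + 2 * x)"
    using True by (simp add: exp_tent_def t_def algebra_simps add_divide_distrib diff_divide_distrib flip: exp_add)
  finally show ?thesis .
next
  case False
  define z where "z = (c - m) / y"
  have z: "0 \<le> z" and yz: "y * z = c - m" using m y by (auto simp: z_def)
  have x: "c - m < 2 * x" using False by simp
  then have gain: "convexity_gain x = 0" using m by (auto simp: convexity_gain_def)
  have "(1 + z) * exp (- z) \<le> 1"
    using exp_ge_add_one_self[of z] by (simp add: exp_minus field_simps)
  then have "y * ((1 + z) * exp (- z)) \<le> y * 1" using y by (intro mult_left_mono) auto
  then have 1: "(y + (c - m)) * exp (- z) \<le> y" by (simp add: yz[symmetric] algebra_simps)
  have "(2 * x - (c - m)) * exp (- z) \<le> (2 * x - (c - m)) * 1"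
    using x z by (intro mult_left_mono) auto
  with 1 have "exp (- z) * (y + 2 * x) \<le> y + (2 * x - (c - m))"
    by (simp add: algebra_simps)
  moreover have "(m - c) / y = - z" by (simp add: z_def minus_divide_left)
  ultimately show ?thesis using False by (simp add: gain exp_tent_def algebra_simps)
qed

section \<open>The stationary chain for strong interaction\<close>

context stationary_chain
begin

abbreviation jump :: "real \<times> real \<Rightarrow> real" where
  "jump p \<equiv> fst p + 2 * snd p"

lemma integral_product:
  fixes f g :: "real \<Rightarrow> real"
  assumes [measurable]: "f \<in> borel_measurable borel" and g: "integrable \<mu> g"
    and bound: "\<And>m. \<bar>m\<bar> \<le> c \<Longrightarrow> \<bar>f m\<bar> \<le> K"
  shows "integrable pairs (\<lambda>p. f (fst p) * g (snd p))"
    and "(\<integral>p. f (fst p) * g (snd p) \<partial>pairs) = (\<integral>m. f m \<partial>\<nu>) * (\<integral>x. g x \<partial>\<mu>)"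
proof -
  have [measurable]: "g \<in> borel_measurable borel" using borel_measurable_integrable[OF g] by simp
  show int: "integrable pairs (\<lambda>p. f (fst p) * g (snd p))"
  proof (rule Bochner_Integration.integrable_bound)
    show "integrable pairs (\<lambda>p. K * \<bar>g (snd p)\<bar>)"
      using integrable_pairs_snd[of "\<lambda>x. \<bar>g x\<bar>"] g by simp
    show "AE p in pairs. norm (f (fst p) * g (snd p)) \<le> norm (K * \<bar>g (snd p)\<bar>)"
      using AE_pairs_fst
    proof eventually_elim
      case (elim p)
      then have "\<bar>f (fst p)\<bar> * \<bar>g (snd p)\<bar> \<le> \<bar>K\<bar> * \<bar>g (snd p)\<bar>"
        using bound[of "fst p"] by (intro mult_right_mono) auto
      then show ?case by (simp add: abs_mult)
    qed
  qed simp
  have "(\<integral>p. f (fst p) * g (snd p) \<partial>pairs) = (\<integral>m. (\<integral>x. f m * g x \<partial>\<mu>) \<partial>\<nu>)"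
    using joint.integral_fst'[OF int] by simp
  then show "(\<integral>p. f (fst p) * g (snd p) \<partial>pairs) = (\<integral>m. f m \<partial>\<nu>) * (\<integral>x. g x \<partial>\<mu>)"
    using g by simp
qed

lemma integrable_jump: "integrable pairs jump"
  by (rule integrable_lipschitz[of _ 2 c]) auto

lemma integrable_softplus_jump:
  assumes "\<tau> \<in> {-1, 1}"
  shows "integrable pairs (\<lambda>p. softplus (\<tau> * jump p - c))"
proof (rule integrable_lipschitz[of _ 2 "c + 1"])
  fix m x assume m: "\<bar>m\<bar> \<le> c"
  have "softplus (\<tau> * (m + 2 * x) - c) \<le> max 0 (\<tau> * (m + 2 * x) - c) + 1" by (rule softplus_le)
  also have "\<dots> \<le> 2 * \<bar>x\<bar> + (c + 1)" using m assms c_pos by auto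
  finally show "\<bar>softplus (\<tau> * jump (m, x) - c)\<bar> \<le> 2 * \<bar>x\<bar> + (c + 1)" by simp
qed measurable

text \<open>The field is centred and the stationary mean does not move, so the pushes at the two
  barriers have equal means.\<close>

lemma integral_softplus_jump:
  assumes "\<tau> \<in> {-1, 1}"
  shows "(\<integral>p. softplus (\<tau> * jump p - c) \<partial>pairs) = lyapunov"
proof -
  have neg: "(\<integral>p. softplus (- jump p - c) \<partial>pairs) = lyapunov"
  proof -
    have "- jump p - c = - c - fst p - 2 * snd p" for p :: "real \<times> real" by simp
    then show ?thesis by (simp only: lyapunov_def)
  qed
  have "(\<integral>p. next_state p \<partial>pairs) = (\<integral>p. fst p \<partial>pairs)"
    using stationary_integral[of "\<lambda>x. x"] by simp
  moreover have "(\<integral>p. jump p \<partial>pairs) = (\<integral>p. fst p \<partial>pairs)"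
  proof -
    have "integrable pairs fst" by (rule integrable_lipschitz[of _ 0 c]) auto
    moreover have "integrable pairs snd" using integrable_pairs_snd[OF integrable_id] by simp
    moreover have "(\<integral>p. snd p \<partial>pairs) = 0" using integral_pairs_snd[of "\<lambda>x. x"] mean_zero by simp
    ultimately show ?thesis by simp
  qed
  moreover have "(\<integral>p. next_state p \<partial>pairs)
      = (\<integral>p. jump p \<partial>pairs) + (\<integral>p. softplus (- jump p - c) \<partial>pairs) - (\<integral>p. softplus (jump p - c) \<partial>pairs)"
    unfolding soft_clamp_def
    using integrable_jump integrable_softplus_jump[of 1] integrable_softplus_jump[of "-1"] by simp
  ultimately have "(\<integral>p. softplus (jump p - c) \<partial>pairs) = lyapunov"
    using neg by simp
  then show ?thesis using neg assms by auto
qed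

lemma lyapunov_nonneg: "0 \<le> lyapunov"
  unfolding lyapunov_def by simp

text \<open>The sign \<open>\<tau>\<close> selects a barrier: \<open>1\<close> the upper,
  \<open>-1\<close> the lower one. Both are then treated by the same estimates.\<close>

lemma soft_clamp_sign: "\<tau> \<in> {-1, 1} \<Longrightarrow> \<tau> * soft_clamp c z = soft_clamp c (\<tau> * z)"
  by (auto simp: soft_clamp_minus)

text \<open>Let \<open>E\<close> be the exponential moment and \<open>\<kappa>\<close> the mean
  gain. The jump raises the mean of the tent from its stationary value \<open>y * E\<close> by at
  least \<open>\<kappa> * E / y\<close>. The selected barrier takes back at most the mean push, and
  the opposite barrier can only raise the tent. As stationarity restores the value
  \<open>y * E\<close>, the gain is at most \<open>lyapunov\<close>.\<close>

lemma exp_moment_bound: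
  assumes \<tau>: "\<tau> \<in> {-1, 1}" and y: "1 \<le> y"
  shows "(\<integral>x. convexity_gain (\<tau> * x) \<partial>\<mu>) * (\<integral>m. exp ((\<tau> * m - c) / y) \<partial>\<nu>) \<le> y * lyapunov"
proof -
  define E where "E = (\<integral>m. exp ((\<tau> * m - c) / y) \<partial>\<nu>)"
  define \<kappa> where "\<kappa> = (\<integral>x. convexity_gain (\<tau> * x) \<partial>\<mu>)"
  have gain_int: "integrable \<mu> (\<lambda>x. convexity_gain (\<tau> * x))"
  proof (rule Bochner_Integration.integrable_bound)
    show "integrable \<mu> (\<lambda>x. 2 * x\<^sup>2)" using square_integrable by simp
    show "AE x in \<mu>. norm (convexity_gain (\<tau> * x)) \<le> norm (2 * x\<^sup>2)"
      using \<tau> by (intro AE_I2) (auto simp: convexity_gain_def intro!: mult_left_le)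
  qed simp
  have exp_le: "\<bar>exp ((\<tau> * m - c) / y)\<bar> \<le> 1" if "\<bar>m\<bar> \<le> c" for m
    using that \<tau> y by (auto intro!: divide_nonpos_pos)
  have tent_bound: "\<bar>exp_tent c y z\<bar> \<le> y + \<bar>z\<bar> + c" for z
  proof (cases "z \<le> c")
    case True
    then have "y * exp ((z - c) / y) \<le> y"
      using y by (intro mult_left_le) (auto simp: divide_nonpos_pos)
    moreover have "0 \<le> y * exp ((z - c) / y)" using y by simp
    moreover have "exp_tent c y z = y * exp ((z - c) / y)" using True by (simp add: exp_tent_def)
    ultimately show ?thesis using c_pos by linarith
  next
    case False
    then show ?thesis using y c_pos by (simp add: exp_tent_def)
  qed
  have int1: "integrable pairs (\<lambda>p. exp_tent c y (\<tau> * jump p))"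
  proof (rule integrable_lipschitz[of _ 2 "y + 2 * c"])
    fix m x assume "\<bar>m\<bar> \<le> c"
    then show "\<bar>exp_tent c y (\<tau> * jump (m, x))\<bar> \<le> 2 * \<bar>x\<bar> + (y + 2 * c)"
      using tent_bound[of "\<tau> * (m + 2 * x)"] \<tau> by auto
  qed measurable
  have int2: "integrable pairs (\<lambda>p. exp_tent c y (\<tau> * next_state p))"
  proof (rule integrable_lipschitz[of _ 0 "y + 2 * c"])
    fix m x assume "\<bar>m\<bar> \<le> c"
    have "\<bar>\<tau> * next_state (m, x)\<bar> \<le> c"
      using soft_clamp_abs_le[of c] c_pos \<tau> by (auto simp: abs_mult)
    then show "\<bar>exp_tent c y (\<tau> * next_state (m, x))\<bar> \<le> 0 * \<bar>x\<bar> + (y + 2 * c)"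
      using tent_bound[of "\<tau> * next_state (m, x)"] by simp
  qed measurable
  have lower: "(\<integral>p. exp ((\<tau> * fst p - c) / y) * (y + 2 * (\<tau> * snd p) + convexity_gain (\<tau> * snd p) / y) \<partial>pairs)
      = E * (y + \<kappa> / y)"
    and lower_int: "integrable pairs (\<lambda>p. exp ((\<tau> * fst p - c) / y) * (y + 2 * (\<tau> * snd p) + convexity_gain (\<tau> * snd p) / y))"
  proof -
    have g: "integrable \<mu> (\<lambda>x. y + 2 * (\<tau> * x) + convexity_gain (\<tau> * x) / y)"
      using integrable_id gain_int by simp
    have "(\<integral>x. y + 2 * (\<tau> * x) + convexity_gain (\<tau> * x) / y \<partial>\<mu>) = y + \<kappa> / y"
      using integrable_id gain_int mean_zero prob_space by (simp add: \<kappa>_def)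
    then show "(\<integral>p. exp ((\<tau> * fst p - c) / y) * (y + 2 * (\<tau> * snd p) + convexity_gain (\<tau> * snd p) / y) \<partial>pairs)
        = E * (y + \<kappa> / y)"
      "integrable pairs (\<lambda>p. exp ((\<tau> * fst p - c) / y) * (y + 2 * (\<tau> * snd p) + convexity_gain (\<tau> * snd p) / y))"
      using integral_product[of "\<lambda>m. exp ((\<tau> * m - c) / y)", OF _ g exp_le] by (simp_all add: E_def)
  qed
  have "E * (y + \<kappa> / y) \<le> (\<integral>p. exp_tent c y (\<tau> * jump p) \<partial>pairs)"
    unfolding lower[symmetric]
  proof (rule integral_mono_AE[OF lower_int int1])
    show "AE p in pairs. exp ((\<tau> * fst p - c) / y) * (y + 2 * (\<tau> * snd p) + convexity_gain (\<tau> * snd p) / y)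
        \<le> exp_tent c y (\<tau> * jump p)"
      using AE_pairs_fst
    proof eventually_elim
      case (elim p)
      have "\<tau> * fst p \<le> c" using elim \<tau> by auto
      from exp_tent_ge[OF y this, of "\<tau> * snd p"] show ?case
        by (simp add: distrib_left mult.left_commute)
    qed
  qed
  also have "\<dots> \<le> (\<integral>p. exp_tent c y (\<tau> * next_state p) + softplus (\<tau> * jump p - c) \<partial>pairs)"
  proof (rule integral_mono[OF int1])
    show "integrable pairs (\<lambda>p. exp_tent c y (\<tau> * next_state p) + softplus (\<tau> * jump p - c))"
      using int2 integrable_softplus_jump[OF \<tau>] by simp
    fix p
    let ?z = "\<tau> * jump p"
    have "exp_tent c y ?z - exp_tent c y (?z - softplus (?z - c)) \<le> softplus (?z - c)"
      using exp_tent_increment(2)[of y "?z - softplus (?z - c)" ?z c] y by simp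
    moreover have "exp_tent c y (?z - softplus (?z - c)) \<le> exp_tent c y (\<tau> * next_state p)"
      unfolding soft_clamp_sign[OF \<tau>] using y by (intro exp_tent_increment(1) soft_clamp_ge) auto
    ultimately show "exp_tent c y ?z \<le> exp_tent c y (\<tau> * next_state p) + softplus (?z - c)"
      by linarith
  qed
  also have "\<dots> = (\<integral>p. exp_tent c y (\<tau> * next_state p) \<partial>pairs) + lyapunov"
    using int2 integrable_softplus_jump[OF \<tau>] integral_softplus_jump[OF \<tau>] by simp
  also have "(\<integral>p. exp_tent c y (\<tau> * next_state p) \<partial>pairs) = (\<integral>p. exp_tent c y (\<tau> * fst p) \<partial>pairs)"
    by (rule stationary_integral[of "\<lambda>m. exp_tent c y (\<tau> * m)"]) measurable
  also have "\<dots> = (\<integral>m. exp_tent c y (\<tau> * m) \<partial>\<nu>)"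
    by (rule integral_pairs_fst) measurable
  also have "\<dots> = (\<integral>m. y * exp ((\<tau> * m - c) / y) \<partial>\<nu>)"
  proof (rule integral_cong_AE)
    show "AE m in \<nu>. exp_tent c y (\<tau> * m) = y * exp ((\<tau> * m - c) / y)"
      using support by eventually_elim (use \<tau> in \<open>auto simp: exp_tent_def\<close>)
  qed measurable
  also have "\<dots> = y * E" by (simp add: E_def)
  finally have "E * (y + \<kappa> / y) \<le> y * E + lyapunov" .
  then have "\<kappa> * E / y \<le> lyapunov" by (simp add: algebra_simps)
  then have "\<kappa> * E \<le> lyapunov * y" using y by (simp add: pos_divide_le_eq)
  then show ?thesis by (simp add: \<kappa>_def E_def mult.commute)
qed

section \<open>Balance of squares and the a priori bound\<close>

lemma integrable_jump_square: "integrable pairs (\<lambda>p. (jump p)\<^sup>2)"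
proof (rule integrable_quadratic[of _ 8 "2 * c\<^sup>2"])
  fix m x assume "\<bar>m\<bar> \<le> c"
  then have "m\<^sup>2 \<le> c\<^sup>2" by (metis abs_ge_zero power2_abs power_mono)
  moreover have "(m + 2 * x)\<^sup>2 \<le> 2 * m\<^sup>2 + 8 * x\<^sup>2"
    using zero_le_power2[of "m - 2 * x"] by (simp add: power2_eq_square algebra_simps)
  ultimately show "\<bar>(jump (m, x))\<^sup>2\<bar> \<le> 8 * x\<^sup>2 + 2 * c\<^sup>2" by simp
qed measurable

text \<open>The stationary second moment cancels, and independence with a centred field kills the
  mixed term; what remains is the second moment of the step \<open>2 * x\<close>.\<close>

lemma integral_jump_square_diff:
  "(\<integral>p. (jump p)\<^sup>2 - (next_state p)\<^sup>2 \<partial>pairs) = 4 * (\<integral>x. x\<^sup>2 \<partial>\<mu>)"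
proof -
  have sq_le: "m\<^sup>2 \<le> c\<^sup>2" if "\<bar>m\<bar> \<le> c" for m
    using that by (metis abs_ge_zero power2_abs power_mono)
  have n: "integrable pairs (\<lambda>p. (next_state p)\<^sup>2)"
    by (rule integrable_quadratic[of _ 0 "c\<^sup>2"]) (use c_pos in \<open>auto intro!: sq_le soft_clamp_abs_le\<close>)
  have f: "integrable pairs (\<lambda>p. (fst p)\<^sup>2)"
    by (rule integrable_quadratic[of _ 0 "c\<^sup>2"]) (auto intro!: sq_le)
  have s: "integrable pairs (\<lambda>p. (snd p)\<^sup>2)"
    using integrable_pairs_snd[OF square_integrable] by simp
  have cross: "integrable pairs (\<lambda>p. fst p * snd p)"
    by (rule integral_product(1)[OF _ integrable_id, of "\<lambda>m. m" c]) simp_all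
  have "(\<integral>p. fst p * snd p \<partial>pairs) = (\<integral>m. m \<partial>\<nu>) * (\<integral>x. x \<partial>\<mu>)"
    by (rule integral_product(2)[OF _ integrable_id, of "\<lambda>m. m" c]) simp_all
  then have cross0: "(\<integral>p. fst p * snd p \<partial>pairs) = 0"
    using mean_zero by simp
  have "(\<integral>p. (jump p)\<^sup>2 \<partial>pairs) = (\<integral>p. (fst p)\<^sup>2 + 4 * (fst p * snd p) + 4 * (snd p)\<^sup>2 \<partial>pairs)"
    by (simp add: power2_sum power_mult_distrib algebra_simps)
  also have "\<dots> = (\<integral>p. (fst p)\<^sup>2 \<partial>pairs) + 4 * (\<integral>p. (snd p)\<^sup>2 \<partial>pairs)"
    using f s cross cross0 by simp
  also have "(\<integral>p. (snd p)\<^sup>2 \<partial>pairs) = (\<integral>x. x\<^sup>2 \<partial>\<mu>)"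
    by (rule integral_pairs_snd) measurable
  also have "(\<integral>p. (fst p)\<^sup>2 \<partial>pairs) = (\<integral>p. (next_state p)\<^sup>2 \<partial>pairs)"
    by (rule stationary_integral[symmetric]) measurable
  finally show "(\<integral>p. (jump p)\<^sup>2 - (next_state p)\<^sup>2 \<partial>pairs) = 4 * (\<integral>x. x\<^sup>2 \<partial>\<mu>)"
    using n integrable_jump_square by simp
qed

lemma integrable_overshoot:
  assumes \<tau>: "\<tau> \<in> {-1, 1}"
  shows "integrable pairs (\<lambda>p. overshoot c (\<tau> * jump p))"
proof (rule integrable_quadratic[of _ 8 6])
  fix m x assume m: "\<bar>m\<bar> \<le> c"
  have "exp ((soft_clamp c (\<tau> * (m + 2 * x)) - c) / 2) \<le> 1"
    using soft_clamp_abs_le[of c "\<tau> * (m + 2 * x)"] c_pos by simp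
  moreover have "(max 0 (\<tau> * (m + 2 * x) - c))\<^sup>2 \<le> (2 * \<bar>x\<bar>)\<^sup>2"
    using m \<tau> by (intro power_mono) auto
  then have "(max 0 (\<tau> * (m + 2 * x) - c))\<^sup>2 \<le> 4 * x\<^sup>2" by (simp add: power_mult_distrib)
  moreover have "\<bar>overshoot c (\<tau> * (m + 2 * x))\<bar>
      \<le> 6 * exp ((soft_clamp c (\<tau> * (m + 2 * x)) - c) / 2) + 2 * (max 0 (\<tau> * (m + 2 * x) - c))\<^sup>2"
    using c_pos by (intro overshoot_bound) simp
  ultimately have "\<bar>overshoot c (\<tau> * (m + 2 * x))\<bar> \<le> 8 * x\<^sup>2 + 6" by linarith
  then show "\<bar>overshoot c (\<tau> * jump (m, x))\<bar> \<le> 8 * x\<^sup>2 + 6" by simp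
qed measurable

text \<open>\<open>I\<close> is the mean product of the two pushes. It is negligible because both
  barriers cannot push noticeably in the same step.\<close>

lemma balance:
  obtains I where "0 \<le> I" "I \<le> 2 * exp (- c) * lyapunov"
    "4 * (\<integral>x. x\<^sup>2 \<partial>\<mu>) = 4 * c * lyapunov + (\<integral>p. overshoot c (jump p) \<partial>pairs)
      + (\<integral>p. overshoot c (- jump p) \<partial>pairs) + 2 * I"
proof -
  let ?A = "\<lambda>p. softplus (jump p - c)" and ?B = "\<lambda>p. softplus (- jump p - c)"
  define I where "I = (\<integral>p. ?A p * ?B p \<partial>pairs)"
  have A: "integrable pairs ?A" "(\<integral>p. ?A p \<partial>pairs) = lyapunov"
    using integrable_softplus_jump[of 1] integral_softplus_jump[of 1] by auto
  have B: "integrable pairs ?B" "(\<integral>p. ?B p \<partial>pairs) = lyapunov"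
    using integrable_softplus_jump[of "-1"] integral_softplus_jump[of "-1"] by auto
  have le: "?A p * ?B p \<le> exp (- c) * (?A p + ?B p)" for p
    using softplus_product_le[of c "jump p"] c_pos by simp
  have int: "integrable pairs (\<lambda>p. exp (- c) * (?A p + ?B p))" using A B by simp
  have AB: "integrable pairs (\<lambda>p. ?A p * ?B p)"
  proof (rule Bochner_Integration.integrable_bound[OF int])
    show "AE p in pairs. norm (?A p * ?B p) \<le> norm (exp (- c) * (?A p + ?B p))"
    proof (rule AE_I2)
      fix p
      show "norm (?A p * ?B p) \<le> norm (exp (- c) * (?A p + ?B p))"
        using le[of p] abs_ge_self[of "exp (- c) * (?A p + ?B p)"]
        unfolding real_norm_def by (simp only: abs_of_nonneg mult_nonneg_nonneg softplus_nonneg)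
    qed
  qed measurable
  have "I \<le> (\<integral>p. exp (- c) * (?A p + ?B p) \<partial>pairs)"
    unfolding I_def by (rule integral_mono[OF AB int le])
  also have "\<dots> = 2 * exp (- c) * lyapunov" using A B by simp
  finally have "I \<le> 2 * exp (- c) * lyapunov" .
  moreover have "0 \<le> I" unfolding I_def by simp
  moreover have "4 * (\<integral>x. x\<^sup>2 \<partial>\<mu>) = 4 * c * lyapunov + (\<integral>p. overshoot c (jump p) \<partial>pairs)
      + (\<integral>p. overshoot c (- jump p) \<partial>pairs) + 2 * I"
  proof -
    have "integrable pairs (\<lambda>p. overshoot c (jump p))" "integrable pairs (\<lambda>p. overshoot c (- jump p))"
      using integrable_overshoot[of 1] integrable_overshoot[of "-1"] by auto
    moreover have "4 * (\<integral>x. x\<^sup>2 \<partial>\<mu>) = (\<integral>p. 2 * c * (?A p + ?B p) + overshoot c (jump p)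
        + overshoot c (- jump p) + 2 * (?A p * ?B p) \<partial>pairs)"
      unfolding integral_jump_square_diff[symmetric] square_minus_soft_clamp_square ..
    ultimately show ?thesis using A B AB by (simp add: I_def algebra_simps)
  qed
  ultimately show ?thesis using that by blast
qed

text \<open>The 6 is the uniform bound 3 on the negative part of the overshoot, once for each
  barrier.\<close>

lemma lyapunov_upper: "4 * c * lyapunov \<le> 4 * (\<integral>x. x\<^sup>2 \<partial>\<mu>) + 6"
proof -
  obtain I where I: "0 \<le> I" "4 * (\<integral>x. x\<^sup>2 \<partial>\<mu>) = 4 * c * lyapunov + (\<integral>p. overshoot c (jump p) \<partial>pairs)
      + (\<integral>p. overshoot c (- jump p) \<partial>pairs) + 2 * I"
    by (rule balance)
  have "- 3 \<le> (\<integral>p. overshoot c (jump p) \<partial>pairs)" "- 3 \<le> (\<integral>p. overshoot c (- jump p) \<partial>pairs)"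
    using integrable_overshoot[of 1] integrable_overshoot[of "-1"]
    by (auto intro!: joint.integral_ge_const AE_I2 overshoot_ge)
  then show ?thesis using I by linarith
qed

end

text \<open>Interpolates between the trivial bound on a probability and a linear one, so that only a
  power \<open>r\<close> of the jump size has to be integrated.\<close>

lemma min_one_le_powr:
  fixes z r :: real
  assumes "0 \<le> z" "0 < r" "r \<le> 1"
  shows "min 1 z \<le> z powr r"
proof (cases "1 \<le> z")
  case True
  then show ?thesis using ge_one_powr_ge_zero[of z r] assms by simp
next
  case False
  then show ?thesis using powr_mono'[of r 1 z] assms by simp
qed

section \<open>Jumps beyond a barrier\<close>

context stationary_chain
begin

text \<open>A jump crosses the barrier only if \<open>2 * \<bar>x\<bar>\<close> exceeds the distance
  of the state from it. With \<open>x\<close> fixed, \<open>exp_moment_bound\<close> at the scale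
  \<open>y = 1 + 2 * \<bar>x\<bar>\<close> bounds the probability of such states by a multiple of
  \<open>y * lyapunov\<close>. Interpolation lowers this to the power \<open>r\<close>, and
  integrating \<open>x\<^sup>2 * y powr r\<close> uses the moment hypothesis.\<close>

lemma integral_overshoot_tail:
  assumes \<tau>: "\<tau> \<in> {-1, 1}" and \<kappa>: "0 < (\<integral>x. convexity_gain (\<tau> * x) \<partial>\<mu>)"
    and r: "0 < r" "r \<le> 1" and M: "integrable \<mu> (\<lambda>x. x\<^sup>2 * (1 + 2 * \<bar>x\<bar>) powr r)"
  shows "(\<integral>p. (max 0 (\<tau> * jump p - c))\<^sup>2 \<partial>pairs)
    \<le> 4 * (exp 1 * lyapunov / (\<integral>x. convexity_gain (\<tau> * x) \<partial>\<mu>)) powr r * (\<integral>x. x\<^sup>2 * (1 + 2 * \<bar>x\<bar>) powr r \<partial>\<mu>)"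
    and "integrable pairs (\<lambda>p. (max 0 (\<tau> * jump p - c))\<^sup>2)"
proof -
  define \<kappa>' where "\<kappa>' = (\<integral>x. convexity_gain (\<tau> * x) \<partial>\<mu>)"
  have \<kappa>': "0 < \<kappa>'" using \<kappa> by (simp add: \<kappa>'_def)
  \<comment> \<open>Dominates the indicator of states within \<open>1 + 2 * \<bar>x\<bar>\<close> of
    the barrier: there the summand 1 makes the exponent nonnegative.\<close>
  define q where "q m x = min 1 (exp (1 + (\<tau> * m - c) / (1 + 2 * \<bar>x\<bar>)))" for m x :: real
  define h where "h m x = 4 * x\<^sup>2 * q m x" for m x :: real
  have q_bounds: "0 \<le> q m x" "q m x \<le> 1" for m x by (auto simp: q_def)
  have [measurable]: "(\<lambda>(m, x). q m x) \<in> borel_measurable (borel \<Otimes>\<^sub>M borel)"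
    unfolding q_def by measurable
  have hm [measurable]: "case_prod h \<in> borel_measurable (borel \<Otimes>\<^sub>M borel)"
    unfolding h_def by measurable
  have h: "integrable pairs (case_prod h)"
  proof (rule integrable_quadratic[of _ 4 0])
    fix m x :: real
    have "x\<^sup>2 * q m x \<le> x\<^sup>2" using q_bounds[of m x] by (intro mult_left_le) auto
    then show "\<bar>case_prod h (m, x)\<bar> \<le> 4 * x\<^sup>2 + 0" using q_bounds[of m x] by (simp add: h_def abs_mult)
  qed simp
  have tail: "(max 0 (\<tau> * (m + 2 * x) - c))\<^sup>2 \<le> h m x" if m: "\<bar>m\<bar> \<le> c" for m x
  proof (cases "\<tau> * (m + 2 * x) - c > 0")
    case True
    have \<tau>m: "\<tau> * m \<le> c" "\<tau> * (m + 2 * x) \<le> \<tau> * m + 2 * \<bar>x\<bar>" using m \<tau> by auto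
    have "- (1 + 2 * \<bar>x\<bar>) \<le> \<tau> * m - c" using True \<tau>m by linarith
    then have "- 1 \<le> (\<tau> * m - c) / (1 + 2 * \<bar>x\<bar>)" by (simp add: pos_le_divide_eq)
    then have "q m x = 1" by (simp add: q_def)
    moreover have "(max 0 (\<tau> * (m + 2 * x) - c))\<^sup>2 \<le> (2 * \<bar>x\<bar>)\<^sup>2"
      using \<tau>m by (intro power_mono) auto
    ultimately show ?thesis by (simp add: h_def power_mult_distrib)
  next
    case False
    then show ?thesis using q_bounds[of m x] by (simp add: h_def max_def)
  qed
  show int: "integrable pairs (\<lambda>p. (max 0 (\<tau> * jump p - c))\<^sup>2)"
  proof (rule Bochner_Integration.integrable_bound[OF h])
    show "AE p in pairs. norm ((max 0 (\<tau> * jump p - c))\<^sup>2) \<le> norm (case_prod h p)"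
      using AE_pairs_fst
    proof eventually_elim
      case (elim p)
      have "0 \<le> h (fst p) (snd p)" using q_bounds[of "fst p" "snd p"] by (simp add: h_def)
      then show ?case using tail[OF elim, of "snd p"] by (simp add: case_prod_beta)
    qed
  qed measurable
  define Z where "Z = exp 1 * lyapunov / \<kappa>'"
  have Z: "0 \<le> Z" using lyapunov_nonneg \<kappa>' by (simp add: Z_def)
  have inner: "(\<integral>m. h m x \<partial>\<nu>) \<le> 4 * Z powr r * (x\<^sup>2 * (1 + 2 * \<bar>x\<bar>) powr r)" for x
  proof -
    \<comment> \<open>The added 1 keeps the scale at least 1, as \<open>exp_moment_bound\<close>
      demands.\<close>
    define y where "y = 1 + 2 * \<bar>x\<bar>"
    have y: "1 \<le> y" by (simp add: y_def)
    have [measurable]: "(\<lambda>m. q m x) \<in> borel_measurable borel" unfolding q_def by measurable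
    have e_int: "integrable \<nu> (\<lambda>m. exp ((\<tau> * m - c) / y))"
    proof (rule st.integrable_const_bound[of _ 1])
      show "AE m in \<nu>. norm (exp ((\<tau> * m - c) / y)) \<le> 1"
        using support by eventually_elim (use \<tau> y in \<open>auto intro!: divide_nonpos_pos\<close>)
    qed measurable
    have q_int: "integrable \<nu> (\<lambda>m. q m x)"
      using q_bounds by (intro st.integrable_const_bound[of _ 1]) (auto intro!: AE_I2)
    have "(\<integral>m. q m x \<partial>\<nu>) \<le> (\<integral>m. exp 1 * exp ((\<tau> * m - c) / y) \<partial>\<nu>)"
    proof (rule integral_mono[OF q_int])
      show "q m x \<le> exp 1 * exp ((\<tau> * m - c) / y)" for m
        by (simp only: q_def y_def exp_add[symmetric] min.cobounded2)
    qed (use e_int in simp)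
    also have "\<dots> = exp 1 * (\<integral>m. exp ((\<tau> * m - c) / y) \<partial>\<nu>)" by simp
    also have "\<dots> \<le> exp 1 * (y * lyapunov / \<kappa>')"
      using exp_moment_bound[OF \<tau> y] \<kappa>' by (intro mult_left_mono) (auto simp: \<kappa>'_def pos_le_divide_eq mult.commute)
    also have "\<dots> = y * Z" by (simp add: Z_def)
    finally have "(\<integral>m. q m x \<partial>\<nu>) \<le> y * Z" .
    moreover have "(\<integral>m. q m x \<partial>\<nu>) \<le> 1"
      using q_bounds by (intro st.integral_le_const q_int AE_I2) auto
    ultimately have "(\<integral>m. q m x \<partial>\<nu>) \<le> min 1 (y * Z)" by simp
    also have "\<dots> \<le> (y * Z) powr r" using y Z r by (intro min_one_le_powr) auto
    also have "\<dots> = y powr r * Z powr r" using y Z by (simp add: powr_mult)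
    finally have "4 * x\<^sup>2 * (\<integral>m. q m x \<partial>\<nu>) \<le> 4 * x\<^sup>2 * (y powr r * Z powr r)"
      by (intro mult_left_mono) auto
    then show ?thesis by (simp add: h_def y_def mult_ac)
  qed
  have "(\<integral>p. (max 0 (\<tau> * jump p - c))\<^sup>2 \<partial>pairs) \<le> (\<integral>p. case_prod h p \<partial>pairs)"
  proof (rule integral_mono_AE[OF int h])
    show "AE p in pairs. (max 0 (\<tau> * jump p - c))\<^sup>2 \<le> case_prod h p"
      using AE_pairs_fst
    proof eventually_elim
      case (elim p)
      then show ?case using tail[OF elim, of "snd p"] by (simp add: case_prod_beta)
    qed
  qed
  also have "\<dots> = (\<integral>x. (\<integral>m. h m x \<partial>\<nu>) \<partial>\<mu>)"
    by (rule joint.integral_snd[symmetric, OF h])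
  also have "\<dots> \<le> (\<integral>x. 4 * Z powr r * (x\<^sup>2 * (1 + 2 * \<bar>x\<bar>) powr r) \<partial>\<mu>)"
  proof (rule integral_mono)
    show "integrable \<mu> (\<lambda>x. \<integral>m. h m x \<partial>\<nu>)" by (rule joint.integrable_snd[OF h])
    show "integrable \<mu> (\<lambda>x. 4 * Z powr r * (x\<^sup>2 * (1 + 2 * \<bar>x\<bar>) powr r))" using M by simp
  qed (rule inner)
  finally show "(\<integral>p. (max 0 (\<tau> * jump p - c))\<^sup>2 \<partial>pairs)
    \<le> 4 * (exp 1 * lyapunov / (\<integral>x. convexity_gain (\<tau> * x) \<partial>\<mu>)) powr r * (\<integral>x. x\<^sup>2 * (1 + 2 * \<bar>x\<bar>) powr r \<partial>\<mu>)"
    by (simp add: Z_def \<kappa>'_def)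
qed

text \<open>Both parts of \<open>overshoot_bound\<close> are averaged: the exponential, after
  stationarity, by \<open>exp_moment_bound\<close> at \<open>y = 2\<close>, the squared excess by
  the tail estimate.\<close>

lemma integral_overshoot_le:
  assumes \<tau>: "\<tau> \<in> {-1, 1}" and \<kappa>: "0 < (\<integral>x. convexity_gain (\<tau> * x) \<partial>\<mu>)"
    and r: "0 < r" "r \<le> 1" and M: "integrable \<mu> (\<lambda>x. x\<^sup>2 * (1 + 2 * \<bar>x\<bar>) powr r)"
  shows "\<bar>\<integral>p. overshoot c (\<tau> * jump p) \<partial>pairs\<bar>
    \<le> 12 * lyapunov / (\<integral>x. convexity_gain (\<tau> * x) \<partial>\<mu>)
      + 8 * (exp 1 * lyapunov / (\<integral>x. convexity_gain (\<tau> * x) \<partial>\<mu>)) powr r * (\<integral>x. x\<^sup>2 * (1 + 2 * \<bar>x\<bar>) powr r \<partial>\<mu>)"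
proof -
  note tail = integral_overshoot_tail[OF assms]
  let ?e = "\<lambda>p. exp ((\<tau> * next_state p - c) / 2)"
  have e_int: "integrable pairs ?e"
  proof (rule integrable_lipschitz[of _ 0 1])
    fix m x :: real
    have "\<bar>\<tau> * next_state (m, x)\<bar> \<le> c"
      using soft_clamp_abs_le[of c] c_pos \<tau> by (auto simp: abs_mult)
    then show "\<bar>?e (m, x)\<bar> \<le> 0 * \<bar>x\<bar> + 1" by simp
  qed measurable
  have "\<bar>\<integral>p. overshoot c (\<tau> * jump p) \<partial>pairs\<bar> \<le> (\<integral>p. \<bar>overshoot c (\<tau> * jump p)\<bar> \<partial>pairs)"
    by (rule integral_abs_bound)
  also have "\<dots> \<le> (\<integral>p. 6 * ?e p + 2 * (max 0 (\<tau> * jump p - c))\<^sup>2 \<partial>pairs)"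
  proof (rule integral_mono)
    show "integrable pairs (\<lambda>p. \<bar>overshoot c (\<tau> * jump p)\<bar>)" using integrable_overshoot[OF \<tau>] by simp
    show "integrable pairs (\<lambda>p. 6 * ?e p + 2 * (max 0 (\<tau> * jump p - c))\<^sup>2)" using e_int tail(2) by simp
    show "\<bar>overshoot c (\<tau> * jump p)\<bar> \<le> 6 * ?e p + 2 * (max 0 (\<tau> * jump p - c))\<^sup>2" for p
      unfolding soft_clamp_sign[OF \<tau>] using c_pos by (intro overshoot_bound) simp
  qed
  also have "\<dots> = 6 * (\<integral>p. ?e p \<partial>pairs) + 2 * (\<integral>p. (max 0 (\<tau> * jump p - c))\<^sup>2 \<partial>pairs)"
    using e_int tail(2) by simp
  also have "(\<integral>p. ?e p \<partial>pairs) = (\<integral>m. exp ((\<tau> * m - c) / 2) \<partial>\<nu>)"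
    using stationary_integral[of "\<lambda>m. exp ((\<tau> * m - c) / 2)"] integral_pairs_fst[of "\<lambda>m. exp ((\<tau> * m - c) / 2)"] by simp
  also have "\<dots> \<le> 2 * lyapunov / (\<integral>x. convexity_gain (\<tau> * x) \<partial>\<mu>)"
    using exp_moment_bound[OF \<tau>, of 2] \<kappa> by (simp add: pos_le_divide_eq mult.commute)
  finally show ?thesis using tail(1) by simp
qed

end

section \<open>Asymptotics of the free energy in the barrier parameter\<close>

context centered_law
begin

text \<open>If the gain vanished, the law would sit on one side of 0; being centred it would be
  concentrated at 0, against the positive variance.\<close>

lemma convexity_gain_pos:
  assumes \<tau>: "\<tau> \<in> {-1, 1}" and pos: "0 < (\<integral>x. x\<^sup>2 \<partial>\<mu>)"
  shows "0 < (\<integral>x. convexity_gain (\<tau> * x) \<partial>\<mu>)"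
proof (rule ccontr)
  have int: "integrable \<mu> (\<lambda>x. convexity_gain (\<tau> * x))"
  proof (rule Bochner_Integration.integrable_bound)
    show "integrable \<mu> (\<lambda>x. 2 * x\<^sup>2)" using square_integrable by simp
    show "AE x in \<mu>. norm (convexity_gain (\<tau> * x)) \<le> norm (2 * x\<^sup>2)"
      using \<tau> by (intro AE_I2) (auto simp: convexity_gain_def intro!: mult_left_le)
  qed simp
  have nonneg: "0 \<le> convexity_gain (\<tau> * x)" for x by (simp add: convexity_gain_def)
  assume "\<not> 0 < (\<integral>x. convexity_gain (\<tau> * x) \<partial>\<mu>)"
  moreover have "0 \<le> (\<integral>x. convexity_gain (\<tau> * x) \<partial>\<mu>)" using nonneg by simp
  ultimately have "(\<integral>x. convexity_gain (\<tau> * x) \<partial>\<mu>) = 0" by simp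
  then have "AE x in \<mu>. convexity_gain (\<tau> * x) = 0"
    using integral_nonneg_eq_0_iff_AE[OF int] nonneg by simp
  then have ge: "AE x in \<mu>. 0 \<le> \<tau> * x"
    by eventually_elim (auto simp: convexity_gain_def)
  have "(\<integral>x. \<tau> * x \<partial>\<mu>) = 0" using mean_zero by simp
  moreover have "integrable \<mu> (\<lambda>x. \<tau> * x)" using integrable_id by simp
  ultimately have "AE x in \<mu>. \<tau> * x = 0"
    using integral_nonneg_eq_0_iff_AE[OF _ ge] by simp
  then have "AE x in \<mu>. x\<^sup>2 = 0"
    by eventually_elim (use \<tau> in auto)
  then have "(\<integral>x. x\<^sup>2 \<partial>\<mu>) = (\<integral>x. 0 \<partial>\<mu>)" by (intro integral_cong_AE) auto
  then show False using pos by simp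
qed

lemma lyap_bounds:
  assumes "0 < c"
  shows "0 \<le> lyap c" "lyap c \<le> ((\<integral>x. x\<^sup>2 \<partial>\<mu>) + 2) / c"
proof -
  interpret stationary_chain \<mu> "distr paths borel (backward_limit c)" c
    by (rule stationary_exists[OF assms])
  show "0 \<le> lyap c" unfolding lyap_def by (rule lyapunov_nonneg)
  have "lyap c * c \<le> (\<integral>x. x\<^sup>2 \<partial>\<mu>) + 2"
    using lyapunov_upper unfolding lyap_def[symmetric] mult.assoc mult.commute[of c] by linarith
  then show "lyap c \<le> ((\<integral>x. x\<^sup>2 \<partial>\<mu>) + 2) / c" using assms by (simp add: pos_le_divide_eq)
qed

text \<open>A bootstrap: the a priori bound \<open>K1 / c\<close> is inserted into the overshoot
  terms of \<open>balance\<close>, which become \<open>O(c powr - r)\<close>; dividing by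
  \<open>c\<close> gives the expansion.\<close>

lemma lyap_asymptotics:
  assumes r: "0 < r" "r \<le> 1" and M: "integrable \<mu> (\<lambda>x. x\<^sup>2 * (1 + 2 * \<bar>x\<bar>) powr r)"
    and pos: "0 < (\<integral>x. x\<^sup>2 \<partial>\<mu>)"
  obtains K where "0 \<le> K" "\<And>c. 1 \<le> c \<Longrightarrow> \<bar>lyap c - (\<integral>x. x\<^sup>2 \<partial>\<mu>) / c\<bar> \<le> K * c powr (- 1 - r)"
proof -
  define v where "v = (\<integral>x. x\<^sup>2 \<partial>\<mu>)"
  define K1 where "K1 = v + 2"
  define \<kappa> where "\<kappa> \<tau> = (\<integral>x. convexity_gain (\<tau> * x) \<partial>\<mu>)" for \<tau> :: real
  define m where "m = (\<integral>x. x\<^sup>2 * (1 + 2 * \<bar>x\<bar>) powr r \<partial>\<mu>)"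
  define k where "k \<tau> = 12 * K1 / \<kappa> \<tau> + 8 * (exp 1 * K1 / \<kappa> \<tau>) powr r * m" for \<tau>
  define K where "K = k 1 + k (- 1) + 4 * K1"
  have K1: "0 < K1" using pos by (simp add: K1_def v_def)
  have \<kappa>: "0 < \<kappa> \<tau>" if "\<tau> \<in> {-1, 1}" for \<tau>
    unfolding \<kappa>_def by (rule convexity_gain_pos[OF that pos])
  have m: "0 \<le> m" unfolding m_def by simp
  have k: "0 \<le> k \<tau>" if "\<tau> \<in> {-1, 1}" for \<tau>
    using K1 \<kappa>[OF that] m by (simp add: k_def)
  have K: "0 \<le> K" using k[of 1] k[of "-1"] K1 by (simp add: K_def)
  have "\<bar>lyap c - v / c\<bar> \<le> K * c powr (- 1 - r)" if c: "1 \<le> c" for c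
  proof -
    interpret stationary_chain \<mu> "distr paths borel (backward_limit c)" c
      using c by (intro stationary_exists) simp
    define F where "F = lyap c"
    have F: "lyapunov = F" by (simp add: F_def lyap_def)
    have F0: "0 \<le> F" and FK: "F \<le> K1 / c" using lyap_bounds[of c] c by (auto simp: F_def K1_def v_def)
    \<comment> \<open>As \<open>r \<le> 1\<close>, terms linear in the free energy, of order
      \<open>1 / c\<close>, are absorbed into \<open>c powr - r\<close>.\<close>
    have cr: "1 / c \<le> c powr - r"
      using powr_mono[of "- 1" "- r" c] c r by (simp add: powr_minus_divide)
    have Fr: "F \<le> K1 * c powr - r"
      using FK mult_left_mono[OF cr, of K1] K1 by simp
    have over: "\<bar>\<integral>p. overshoot c (\<tau> * jump p) \<partial>pairs\<bar> \<le> k \<tau> * c powr - r" if \<tau>: "\<tau> \<in> {-1, 1}" for \<tau>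
    proof -
      have "(exp 1 * F / \<kappa> \<tau>) powr r \<le> ((exp 1 * K1 / \<kappa> \<tau>) * (1 / c)) powr r"
        using \<kappa>[OF \<tau>] F0 FK r c
        by (intro powr_mono2) (auto simp: divide_simps mult.commute)
      also have "\<dots> = (exp 1 * K1 / \<kappa> \<tau>) powr r * c powr - r"
        using \<kappa>[OF \<tau>] K1 c by (subst powr_mult) (auto simp: powr_minus_divide powr_divide)
      finally have 1: "8 * (exp 1 * F / \<kappa> \<tau>) powr r * m \<le> 8 * ((exp 1 * K1 / \<kappa> \<tau>) powr r * c powr - r) * m"
        using m by (intro mult_right_mono mult_left_mono) auto
      have 2: "12 * F / \<kappa> \<tau> \<le> 12 * (K1 * c powr - r) / \<kappa> \<tau>"
        using Fr \<kappa>[OF \<tau>] by (intro divide_right_mono) auto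
      have "\<bar>\<integral>p. overshoot c (\<tau> * jump p) \<partial>pairs\<bar> \<le> 12 * F / \<kappa> \<tau> + 8 * (exp 1 * F / \<kappa> \<tau>) powr r * m"
        using integral_overshoot_le[OF \<tau> convexity_gain_pos[OF \<tau> pos] r M] by (simp add: F \<kappa>_def m_def)
      also have "\<dots> \<le> 12 * (K1 * c powr - r) / \<kappa> \<tau> + 8 * ((exp 1 * K1 / \<kappa> \<tau>) powr r * c powr - r) * m"
        using 1 2 by linarith
      also have "\<dots> = k \<tau> * c powr - r" by (simp add: k_def algebra_simps)
      finally show ?thesis .
    qed
    obtain I where I: "0 \<le> I" "I \<le> 2 * exp (- c) * F"
      "4 * v = 4 * c * F + (\<integral>p. overshoot c (jump p) \<partial>pairs) + (\<integral>p. overshoot c (- jump p) \<partial>pairs) + 2 * I"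
      by (rule balance) (simp add: F v_def)
    have "exp (- c) * F \<le> 1 * F" using c F0 by (intro mult_right_mono) auto
    then have I2: "I \<le> 2 * (K1 * c powr - r)" using I(2) Fr by simp
    have "\<bar>4 * v - 4 * c * F\<bar> \<le> k 1 * c powr - r + k (- 1) * c powr - r + 2 * (2 * (K1 * c powr - r))"
      using over[of 1] over[of "- 1"] I I2 by simp
    also have "\<dots> = K * c powr - r" by (simp add: K_def algebra_simps)
    finally have "\<bar>v - c * F\<bar> \<le> K * c powr - r"
      using K powr_ge_zero[of c "- r"] mult_nonneg_nonneg[of K "c powr - r"] by (simp only: abs_le_iff) linarith
    then have "\<bar>v - c * F\<bar> / c \<le> K * c powr - r / c"
      using c by (intro divide_right_mono) auto
    moreover have "\<bar>F - v / c\<bar> = \<bar>v - c * F\<bar> / c"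
    proof -
      have "F - v / c = - ((v - c * F) / c)" using c by (simp add: field_simps)
      then show ?thesis using c by (simp add: abs_divide)
    qed
    moreover have "K * c powr - r / c = K * c powr (- 1 - r)"
    proof -
      have "c powr (- 1 - r) = c powr (- r + - 1)" by (simp add: algebra_simps)
      also have "\<dots> = c powr (- r) / c"
        unfolding powr_add using c by (simp add: powr_minus_divide)
      finally show ?thesis by simp
    qed
    ultimately show ?thesis by (simp add: F_def)
  qed
  with K show ?thesis using that by (simp add: v_def)
qed

end

section \<open>The derivative of the free energy\<close>

lemma bigo_powr_mono:
  fixes a b :: real
  assumes "a \<le> b"
  shows "(\<lambda>J::real. J powr a) \<in> O[at_top](\<lambda>J. J powr b)"
proof (rule bigoI[of _ 1])
  show "\<forall>\<^sub>F J::real in at_top. norm (J powr a) \<le> 1 * norm (J powr b)"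
    using eventually_ge_at_top[of 1] by eventually_elim (simp add: powr_mono assms)
qed

lemma bigo_powr_le_ln_powr:
  fixes a b d :: real
  assumes "0 \<le> d" "b \<le> - a"
  shows "(\<lambda>J::real. J powr b) \<in> O[at_top](\<lambda>J. ln J powr d / J powr a)"
proof (rule bigoI[of _ 1])
  show "\<forall>\<^sub>F J::real in at_top. norm (J powr b) \<le> 1 * norm (ln J powr d / J powr a)"
    using eventually_ge_at_top[of "exp 1"]
  proof eventually_elim
    case (elim J)
    have "1 \<le> exp (1::real)" by simp
    then have J: "1 \<le> J" using elim by linarith
    have "1 \<le> ln J" using elim J by (simp add: ln_ge_iff)
    then have "1 \<le> ln J powr d" using assms by (intro ge_one_powr_ge_zero) auto
    then have "1 * J powr - a \<le> ln J powr d * J powr - a" by (intro mult_right_mono) auto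
    moreover have "J powr b \<le> J powr - a" using J assms by (intro powr_mono) auto
    ultimately show ?case by (simp add: powr_minus_divide)
  qed
qed

lemma divide_le_divideI: "0 < b \<Longrightarrow> 0 < d \<Longrightarrow> a * d \<le> e * b \<Longrightarrow> a / b \<le> e / d" for a b d e :: real
  by (simp add: pos_divide_le_eq pos_le_divide_eq)

context centered_law
begin

abbreviation remainder :: "real \<Rightarrow> real" where
  "remainder J \<equiv> - (1 / 2) * deriv (free_energy \<mu>) J - (\<integral>x. x\<^sup>2 \<partial>\<mu>) / (4 * J\<^sup>2)"

text \<open>The free energy is nonnegative and \<open>O(1 / J)\<close>, so chords of length
  \<open>J / 2\<close> already have slope \<open>O(1 / J\<^sup>2)\<close>, the order of the main
  term itself.\<close>

lemma remainder_bigo_inverse_square: "remainder \<in> O[at_top](\<lambda>J. J powr - 2)"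
proof -
  define v where "v = (\<integral>x. x\<^sup>2 \<partial>\<mu>)"
  have v: "0 \<le> v" by (simp add: v_def)
  have fe: "0 \<le> free_energy \<mu> J" "free_energy \<mu> J \<le> (v + 2) / (2 * J)" if "0 < J" for J
    using lyap_bounds[of "2 * J"] that by (auto simp: free_energy_eq v_def)
  show ?thesis
  proof (rule bigoI[of _ "v + 2 + v / 4"])
    show "\<forall>\<^sub>F J in at_top. norm (remainder J) \<le> (v + 2 + v / 4) * norm (J powr - 2)"
      using eventually_gt_at_top[of 0]
    proof eventually_elim
      case (elim J)
      have J: "0 < J" by fact
      let ?D = "deriv (free_energy \<mu>) J"
      have J2: "J powr - 2 = 1 / J\<^sup>2"
        using J by (simp add: powr_minus_divide powr_numeral)
      have "?D \<le> (free_energy \<mu> (J + J / 2) - free_energy \<mu> J) / (J / 2)"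
        using J by (intro free_energy_deriv_bounds) auto
      also have "\<dots> \<le> (v + 2) / (2 * (J + J / 2)) / (J / 2)"
        using fe[of J] fe[of "J + J / 2"] J by (intro divide_right_mono) auto
      also have "\<dots> \<le> (v + 2) / (2 * (J / 2)) / (J / 2)"
        using J v by (intro divide_right_mono divide_left_mono) auto
      also have "\<dots> = 2 * (v + 2) / J\<^sup>2" using J by (simp add: power2_eq_square)
      finally have 1: "?D \<le> 2 * (v + 2) / J\<^sup>2" .
      have "- (2 * (v + 2) / J\<^sup>2) = (0 - (v + 2) / (2 * (J - J / 2))) / (J / 2)"
        using J by (simp add: power2_eq_square field_simps)
      also have "\<dots> \<le> (free_energy \<mu> J - free_energy \<mu> (J - J / 2)) / (J / 2)"
        using fe[of J] fe[of "J - J / 2"] J by (intro divide_right_mono) auto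
      also have "\<dots> \<le> ?D"
        using J by (intro free_energy_deriv_bounds) auto
      finally have 2: "- (2 * (v + 2) / J\<^sup>2) \<le> ?D" .
      have "\<bar>?D\<bar> \<le> 2 * (v + 2) / J\<^sup>2" using 1 2 by (simp add: abs_le_iff)
      moreover have "2 * (v + 2) / J\<^sup>2 = 2 * ((v + 2) / J\<^sup>2)" "0 \<le> v / (4 * J\<^sup>2)"
        using v by auto
      ultimately have "\<bar>- (1 / 2) * ?D - v / (4 * J\<^sup>2)\<bar> \<le> (v + 2) / J\<^sup>2 + v / (4 * J\<^sup>2)"
        by linarith
      also have "\<dots> = (v + 2 + v / 4) * (1 / J\<^sup>2)" by (simp add: add_divide_distrib)
      finally show ?case by (simp add: J2 v_def)
    qed
  qed
qed

text \<open>At \<open>c = 2 * J\<close> the free energy is \<open>a / J\<close> up to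
  \<open>\<delta>\<close>, with \<open>a\<close> half the variance. A chord slope of
  \<open>a / J\<close> misses the derivative \<open>- a / J\<^sup>2\<close> by
  \<open>O(t / J ^ 3)\<close>, and the error adds \<open>O(\<delta> / t)\<close>.\<close>

lemma remainder_bigo_moment:
  assumes r: "0 < r" "r \<le> 1" and int: "integrable \<mu> (\<lambda>x. \<bar>x\<bar> powr (2 + r))"
    and pos: "0 < (\<integral>x. x\<^sup>2 \<partial>\<mu>)"
  shows "remainder \<in> O[at_top](\<lambda>J. J powr (- 2 - r / 2))"
proof -
  define v where "v = (\<integral>x. x\<^sup>2 \<partial>\<mu>)"
  have v: "0 \<le> v" by (simp add: v_def)
  have M: "integrable \<mu> (\<lambda>x. x\<^sup>2 * (1 + 2 * \<bar>x\<bar>) powr r)"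
  proof (rule Bochner_Integration.integrable_bound)
    show "integrable \<mu> (\<lambda>x. 3 * (x\<^sup>2 + \<bar>x\<bar> powr (2 + r)))"
      using int square_integrable by simp
    show "AE x in \<mu>. norm (x\<^sup>2 * (1 + 2 * \<bar>x\<bar>) powr r) \<le> norm (3 * (x\<^sup>2 + \<bar>x\<bar> powr (2 + r)))"
    proof (rule AE_I2)
      fix x :: real
      have three: "3 powr r \<le> (3::real)" using powr_mono[of r 1 3] r by simp
      have "x\<^sup>2 * (1 + 2 * \<bar>x\<bar>) powr r \<le> 3 * (x\<^sup>2 + \<bar>x\<bar> powr (2 + r))"
      proof (cases "\<bar>x\<bar> \<le> 1")
        case True
        have "(1 + 2 * \<bar>x\<bar>) powr r \<le> 3 powr r" using True r by (intro powr_mono2) auto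
        then have "x\<^sup>2 * (1 + 2 * \<bar>x\<bar>) powr r \<le> x\<^sup>2 * 3" using three by (intro mult_left_mono) auto
        then show ?thesis by (simp add: mult.commute add_increasing2)
      next
        case False
        have "(1 + 2 * \<bar>x\<bar>) powr r \<le> (3 * \<bar>x\<bar>) powr r" using False r by (intro powr_mono2) auto
        also have "\<dots> = 3 powr r * \<bar>x\<bar> powr r" by (simp add: powr_mult)
        also have "\<dots> \<le> 3 * \<bar>x\<bar> powr r" using three by (intro mult_right_mono) auto
        finally have "x\<^sup>2 * (1 + 2 * \<bar>x\<bar>) powr r \<le> x\<^sup>2 * (3 * \<bar>x\<bar> powr r)" by (intro mult_left_mono) auto
        also have "\<dots> = 3 * \<bar>x\<bar> powr (2 + r)" using False by (simp add: powr_add powr_numeral)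
        finally show ?thesis using zero_le_power2[of x] by (simp only: distrib_left)
      qed
      then show "norm (x\<^sup>2 * (1 + 2 * \<bar>x\<bar>) powr r) \<le> norm (3 * (x\<^sup>2 + \<bar>x\<bar> powr (2 + r)))"
        by simp
    qed
  qed measurable
  obtain K where K: "0 \<le> K" and lyap_K: "\<And>c. 1 \<le> c \<Longrightarrow> \<bar>lyap c - v / c\<bar> \<le> K * c powr (- 1 - r)"
    using lyap_asymptotics[OF r M pos] unfolding v_def by blast
  define a where "a = v / 2"
  have a: "0 \<le> a" using v by (simp add: a_def)
  have fe: "\<bar>free_energy \<mu> J - a / J\<bar> \<le> K * J powr (- 1 - r)" if "1 \<le> J" for J
  proof -
    have "\<bar>free_energy \<mu> J - a / J\<bar> \<le> K * (2 * J) powr (- 1 - r)"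
      using lyap_K[of "2 * J"] that by (simp add: free_energy_eq a_def)
    also have "\<dots> \<le> K * J powr (- 1 - r)"
      using K that r by (intro mult_left_mono powr_mono2') auto
    finally show ?thesis .
  qed
  show ?thesis
  proof (rule bigoI[of _ "a + 10 * K"])
    show "\<forall>\<^sub>F J in at_top. norm (remainder J) \<le> (a + 10 * K) * norm (J powr (- 2 - r / 2))"
      using eventually_ge_at_top[of 2]
    proof eventually_elim
      case (elim J)
      have J: "0 < J" "2 \<le> J" using elim by auto
      let ?D = "deriv (free_energy \<mu>) J"
      \<comment> \<open>This choice makes both \<open>t / J ^ 3\<close> and
        \<open>\<delta> / t\<close> multiples of \<open>\<rho>\<close>; the factor 1/2 ensures
        \<open>J - t \<ge> J / 2\<close>.\<close>
      define t where "t = J powr (1 - r / 2) / 2"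
      define \<delta> where "\<delta> = K * J powr (- 1 - r)"
      define \<rho> where "\<rho> = J powr (- 2 - r / 2)"
      have \<delta>: "0 \<le> \<delta>" using K by (simp add: \<delta>_def)
      have "J powr (1 - r / 2) \<le> J powr 1" using J r by (intro powr_mono) auto
      then have t: "0 < t" "t \<le> J / 2" using J by (auto simp: t_def)
      have tJ: "t / J ^ 3 = \<rho> / 2"
      proof -
        have "J powr (1 - r / 2) = \<rho> * J powr 3" unfolding \<rho>_def by (simp flip: powr_add)
        then show ?thesis using J by (simp add: t_def powr_numeral)
      qed
      have \<delta>t: "\<delta> / t = 2 * K * \<rho>"
      proof -
        have "J powr (- 1 - r) = \<rho> * J powr (1 - r / 2)" unfolding \<rho>_def by (simp flip: powr_add)
        then show ?thesis using J by (simp add: \<delta>_def t_def)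
      qed
      have "?D \<le> (free_energy \<mu> (J + t) - free_energy \<mu> J) / t"
        using t J by (intro free_energy_deriv_bounds) auto
      also have "\<dots> \<le> (a / (J + t) - a / J + 2 * \<delta>) / t"
      proof (rule divide_right_mono)
        have "K * (J + t) powr (- 1 - r) \<le> \<delta>"
          unfolding \<delta>_def using K J t r by (intro mult_left_mono powr_mono2') auto
        then show "free_energy \<mu> (J + t) - free_energy \<mu> J \<le> a / (J + t) - a / J + 2 * \<delta>"
          using fe[of "J + t"] fe[of J] J t unfolding abs_le_iff \<delta>_def[symmetric] by simp
      qed (use t in simp)
      also have "\<dots> = - (a / (J * (J + t))) + 2 * (\<delta> / t)"
        using t J by (simp add: field_simps)
      also have "- (a / (J * (J + t))) \<le> - (a / J\<^sup>2) + a * (t / J ^ 3)"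
      proof -
        have "1 / J\<^sup>2 - t / J ^ 3 = (J - t) / J ^ 3"
          using J by (simp add: diff_divide_distrib power2_eq_square power3_eq_cube)
        also have "\<dots> \<le> 1 / (J * (J + t))"
        proof -
          have "(J - t) * (J * (J + t)) = J ^ 3 - J * t\<^sup>2"
            by (simp add: power2_eq_square power3_eq_cube algebra_simps)
          also have "\<dots> \<le> 1 * J ^ 3" using J by simp
          finally show ?thesis using J t by (intro divide_le_divideI) auto
        qed
        finally have "a * (1 / J\<^sup>2 - t / J ^ 3) \<le> a * (1 / (J * (J + t)))"
          using a by (rule mult_left_mono)
        then show ?thesis by (simp add: right_diff_distrib)
      qed
      finally have upper: "?D \<le> - (a / J\<^sup>2) + a * (\<rho> / 2) + 4 * K * \<rho>"
        unfolding tJ \<delta>t by simp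
      have "?D \<ge> (free_energy \<mu> J - free_energy \<mu> (J - t)) / t"
        using t J by (intro free_energy_deriv_bounds) auto
      \<comment> \<open>The 5 is 1 + 4: at \<open>J - t \<ge> J / 2\<close> the error is at most
        \<open>2 powr (1 + r) \<le> 4\<close> times \<open>\<delta>\<close>.\<close>
      moreover have "(free_energy \<mu> J - free_energy \<mu> (J - t)) / t \<ge> (a / J - a / (J - t) - 5 * \<delta>) / t"
      proof (rule divide_right_mono)
        have "(J - t) powr (- 1 - r) \<le> (J / 2) powr (- 1 - r)"
          using J t r by (intro powr_mono2') auto
        also have "\<dots> = 2 powr (1 + r) * J powr (- 1 - r)"
        proof -
          have "(J / 2) powr (- 1 - r) = J powr (- 1 - r) * (1 / 2) powr (- 1 - r)"
            using J by (simp flip: powr_mult)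
          also have "(1 / 2 :: real) powr (- 1 - r) = 2 powr (1 + r)"
            using powr_minus_divide[of 2 "- 1 - r"] by (simp add: powr_divide add.commute)
          finally show ?thesis by simp
        qed
        also have "\<dots> \<le> 4 * J powr (- 1 - r)"
        proof (rule mult_right_mono)
          have "(2::real) powr (1 + r) \<le> 2 powr 2" using r by (intro powr_mono) auto
          then show "(2::real) powr (1 + r) \<le> 4" by simp
        qed simp
        finally have "K * (J - t) powr (- 1 - r) \<le> K * (4 * J powr (- 1 - r))"
          using K by (rule mult_left_mono)
        then have "K * (J - t) powr (- 1 - r) \<le> 4 * \<delta>" by (simp add: \<delta>_def)
        then show "a / J - a / (J - t) - 5 * \<delta> \<le> free_energy \<mu> J - free_energy \<mu> (J - t)"
          using fe[of "J - t"] fe[of J] J t unfolding abs_le_iff \<delta>_def[symmetric] by simp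
      qed (use t in simp)
      moreover have "(a / J - a / (J - t) - 5 * \<delta>) / t = - (a / (J * (J - t))) - 5 * (\<delta> / t)"
        using t J by (simp add: field_simps)
      moreover have "a / (J * (J - t)) \<le> a / J\<^sup>2 + a * (2 * (t / J ^ 3))"
      proof -
        have "1 / (J * (J - t)) \<le> (J + 2 * t) / J ^ 3"
        proof -
          have "(J + 2 * t) * (J * (J - t)) = J ^ 3 + J * t * (J - 2 * t)"
            by (simp add: power2_eq_square power3_eq_cube algebra_simps)
          moreover have "0 \<le> J * t * (J - 2 * t)" using J t by simp
          ultimately have "1 * J ^ 3 \<le> (J + 2 * t) * (J * (J - t))" by linarith
          then show ?thesis using J t by (intro divide_le_divideI) auto
        qed
        also have "(J + 2 * t) / J ^ 3 = 1 / J\<^sup>2 + 2 * (t / J ^ 3)"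
          using J by (simp add: add_divide_distrib power2_eq_square power3_eq_cube)
        finally have "a * (1 / (J * (J - t))) \<le> a * (1 / J\<^sup>2 + 2 * (t / J ^ 3))"
          using a by (rule mult_left_mono)
        then show ?thesis by (simp add: distrib_left)
      qed
      ultimately have lower: "- (a / J\<^sup>2) - a * \<rho> - 10 * K * \<rho> \<le> ?D"
        unfolding tJ \<delta>t by simp
      have \<rho>: "0 \<le> \<rho>" "0 \<le> a * \<rho>" "0 \<le> K * \<rho>" using a K by (auto simp: \<rho>_def)
      have "\<bar>?D + a / J\<^sup>2\<bar> \<le> (a + 10 * K) * \<rho>"
        using upper lower \<rho> by (simp add: abs_le_iff algebra_simps)
      moreover have "remainder J = - (1 / 2) * (?D + a / J\<^sup>2)"
        by (simp add: a_def v_def algebra_simps)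
      ultimately have "\<bar>remainder J\<bar> \<le> (a + 10 * K) * \<rho>"
        using \<rho> a K by (simp add: abs_mult)
      then show ?case by (simp add: \<rho>_def)
    qed
  qed
qed

lemma remainder_bigo_third_moment:
  assumes "integrable \<mu> (\<lambda>x. \<bar>x\<bar> powr 3)" "0 < (\<integral>x. x\<^sup>2 \<partial>\<mu>)" "- 5 / 2 \<le> b"
  shows "remainder \<in> O[at_top](\<lambda>J. J powr b)"
proof -
  have "remainder \<in> O[at_top](\<lambda>J. J powr (- 2 - 1 / 2))"
    using assms by (intro remainder_bigo_moment) auto
  also have "(\<lambda>J. J powr (- 2 - 1 / 2)) \<in> O[at_top](\<lambda>J::real. J powr b)"
    using assms(3) by (intro bigo_powr_mono) simp
  finally show ?thesis .
qed

text \<open>From \<open>(1 + u / 3) ^ 3 \<le> exp u\<close> at \<open>u = s * \<bar>x\<bar>\<close>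
  comes the constant \<open>27 / s ^ 3\<close>; the two exponentials cover both signs of
  \<open>x\<close>.\<close>

lemma integrable_cube_if_exp:
  assumes "\<forall>\<^sub>F t in nhds 0. integrable \<mu> (\<lambda>x. exp (t * x))"
  shows "integrable \<mu> (\<lambda>x. \<bar>x\<bar> powr 3)"
proof -
  obtain d where d: "0 < d" "\<And>t. \<bar>t\<bar> < d \<Longrightarrow> integrable \<mu> (\<lambda>x. exp (t * x))"
    using assms by (auto simp: eventually_nhds_metric dist_real_def)
  define s where "s = d / 2"
  have s: "0 < s" "\<bar>s\<bar> < d" "\<bar>- s\<bar> < d" using d(1) by (auto simp: s_def)
  show ?thesis
  proof (rule Bochner_Integration.integrable_bound)
    show "integrable \<mu> (\<lambda>x. 27 / s ^ 3 * (exp (s * x) + exp (- s * x)))"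
      using d(2)[OF s(2)] d(2)[OF s(3)] by simp
    show "AE x in \<mu>. norm (\<bar>x\<bar> powr 3) \<le> norm (27 / s ^ 3 * (exp (s * x) + exp (- s * x)))"
    proof (rule AE_I2)
      fix x :: real
      have "(s * \<bar>x\<bar> / 3) ^ 3 \<le> (1 + s * \<bar>x\<bar> / real 3) ^ 3"
        using s by (intro power_mono) auto
      also have "\<dots> \<le> exp (s * \<bar>x\<bar>)"
        using s by (intro exp_ge_one_plus_x_over_n_power_n) (auto intro: order_trans[of _ 0])
      also have "\<dots> \<le> exp (s * x) + exp (- s * x)"
        by (cases "0 \<le> x") (auto simp: add_increasing add_increasing2)
      finally have "(s * \<bar>x\<bar> / 3) ^ 3 \<le> exp (s * x) + exp (- s * x)" .
      then have "\<bar>x\<bar> ^ 3 \<le> 27 / s ^ 3 * (exp (s * x) + exp (- s * x))"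
        using s by (simp add: power_mult_distrib power_divide field_simps)
      then show "norm (\<bar>x\<bar> powr 3) \<le> norm (27 / s ^ 3 * (exp (s * x) + exp (- s * x)))"
        using s by (simp add: powr_numeral)
    qed
  qed measurable
qed

lemma integrable_cube_if_powr:
  assumes "3 \<le> p" "integrable \<mu> (\<lambda>x. \<bar>x\<bar> powr p)"
  shows "integrable \<mu> (\<lambda>x. \<bar>x\<bar> powr 3)"
proof (rule Bochner_Integration.integrable_bound)
  show "integrable \<mu> (\<lambda>x. 1 + \<bar>x\<bar> powr p)" using assms by simp
  show "AE x in \<mu>. norm (\<bar>x\<bar> powr 3) \<le> norm (1 + \<bar>x\<bar> powr p)"
  proof (rule AE_I2)
    fix x :: real
    have "\<bar>x\<bar> powr 3 \<le> 1 + \<bar>x\<bar> powr p"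
    proof (cases "\<bar>x\<bar> \<le> 1")
      case True
      then have "\<bar>x\<bar> powr 3 \<le> 1" by (intro powr_le1) auto
      then show ?thesis by (simp add: add_increasing2)
    next
      case False
      then show ?thesis using powr_mono[of 3 p "\<bar>x\<bar>"] assms by simp
    qed
    then show "norm (\<bar>x\<bar> powr 3) \<le> norm (1 + \<bar>x\<bar> powr p)" by simp
  qed
qed measurable

text \<open>The fourth moment is even, so no absolute value intervenes, and it dominates the
  third.\<close>

lemma integrable_cube_if_normal:
  assumes "\<mu> = density lborel (\<lambda>x. ennreal (normal_density 0 \<sigma> x))" "0 < \<sigma>"
  shows "integrable \<mu> (\<lambda>x. \<bar>x\<bar> powr 3)"
proof (rule integrable_cube_if_powr[of 4])
  have "integrable lborel (\<lambda>x. normal_density 0 \<sigma> x * (x - 0) ^ 4)"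
    by (rule integrable_normal_moment[OF assms(2)])
  then have "integrable (density lborel (\<lambda>x. ennreal (normal_density 0 \<sigma> x))) (\<lambda>x. x ^ 4)"
    by (subst integrable_density) auto
  then show "integrable \<mu> (\<lambda>x. \<bar>x\<bar> powr 4)"
    unfolding assms(1) by (simp add: powr_numeral)
qed simp

end

text \<open>Compares exponents for \<open>r = p - 2\<close>: it yields
  \<open>(3 + eta p) / 2 \<le> 1 + p / 2 = 2 + r / 2\<close>.\<close>

lemma eta_le:
  assumes "2 \<le> p" "p \<le> 3"
  shows "eta p \<le> p - 1"
proof (cases "p = 3")
  case False
  have q: "0 < p\<^sup>2 + p - 1" and "2 * p \<le> p\<^sup>2 + p - 1"
    using assms mult_mono[of 2 p 1 "p - 1"] by (auto simp: power2_eq_square algebra_simps)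
  then have "2 * p * (p - 1) \<le> (p\<^sup>2 + p - 1) * (p - 1)"
    using assms by (intro mult_right_mono) auto
  then show ?thesis using False assms q by (simp add: eta_def pos_divide_le_eq mult.commute)
qed (simp add: eta_def)

text \<open>Below 3 the claim amounts to \<open>p\<^sup>2 - 3 * p + 1 \<le> 0\<close>, and the
  threshold is the larger root of that polynomial.\<close>

lemma eta_le_1:
  assumes "2 \<le> p" "p \<le> (3 + sqrt 5) / 2"
  shows "eta p \<le> 1"
proof -
  have "sqrt 5 < 3" by (rule real_less_lsqrt) auto
  then have p3: "p < 3" using assms by simp
  have "0 \<le> ((3 + sqrt 5) / 2 - p) * (p - (3 - sqrt 5) / 2)"
    using assms \<open>sqrt 5 < 3\<close> by (intro mult_nonneg_nonneg) (auto intro: order_trans[of _ 2])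
  also have "\<dots> = 3 * p - p\<^sup>2 - 1"
    by (simp add: field_simps power2_eq_square)
  finally have "2 * p * (p - 1) \<le> 1 * (p\<^sup>2 + p - 1)"
    by (simp add: power2_eq_square algebra_simps)
  moreover have "0 < p\<^sup>2 + p - 1" using assms zero_le_power2[of p] by linarith
  ultimately show ?thesis using p3 by (simp add: eta_def pos_divide_le_eq)
qed

theorem corollary4:
  fixes \<mu> :: "real measure" and \<theta> :: real
  assumes "real_distribution \<mu>"
    and "integrable \<mu> (\<lambda>x. x\<^sup>2)"
    and "(LINT x|\<mu>. x) = 0"
    and "\<mu> \<noteq> return borel 0"
    and "\<theta> > 0"
    and "\<theta>\<^sup>2 = prob_space.variance \<mu> (\<lambda>x. x)"
  defines "R \<equiv> (\<lambda>J. - (1 / 2) * deriv (free_energy \<mu>) J - \<theta>\<^sup>2 / (4 * J\<^sup>2))"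
  shows "(\<mu> = density lborel (\<lambda>x. ennreal (normal_density 0 \<theta> x)) \<longrightarrow>
            R \<in> O[at_top](\<lambda>J. ln J powr (1 / 4) / J powr (5 / 2))) \<and>
         ((\<forall>\<^sub>F t in nhds 0. integrable \<mu> (\<lambda>x. exp (t * x))) \<longrightarrow>
            R \<in> O[at_top](\<lambda>J. ln J powr (1 / 6) / J powr (13 / 6))) \<and>
         (\<forall>p\<ge>2. integrable \<mu> (\<lambda>x. \<bar>x\<bar> powr p) \<longrightarrow>
            (p > (3 + sqrt 5) / 2 \<longrightarrow> R \<in> O[at_top](\<lambda>J. 1 / J powr ((3 + eta p) / 2))) \<and>
            (p \<le> (3 + sqrt 5) / 2 \<longrightarrow> R \<in> O[at_top](\<lambda>J. 1 / J powr (eta p + 1))))"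
proof -
  interpret centered_law \<mu>
    using assms(1-3) by (intro centered_law.intro centered_law_axioms.intro)
  have var: "\<theta>\<^sup>2 = (\<integral>x. x\<^sup>2 \<partial>\<mu>)"
    using assms(6) mean_zero by simp
  then have pos: "0 < (\<integral>x. x\<^sup>2 \<partial>\<mu>)"
    using assms(5) by (metis zero_less_power)
  have R: "R = remainder"
    unfolding R_def var ..
  \<comment> \<open>A third moment permits \<open>r = 1\<close>, that is
    \<open>J powr (- 5 / 2)\<close>; this covers both rates with a logarithm.\<close>
  have cube: "R \<in> O[at_top](\<lambda>J. ln J powr d / J powr a)"
    if "integrable \<mu> (\<lambda>x. \<bar>x\<bar> powr 3)" "0 \<le> d" "a \<le> 5 / 2" for a d
  proof -
    have "R \<in> O[at_top](\<lambda>J. J powr (- 5 / 2))"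
      unfolding R using that pos by (intro remainder_bigo_third_moment) auto
    also have "(\<lambda>J. J powr (- 5 / 2)) \<in> O[at_top](\<lambda>J. ln J powr d / J powr a)"
      using that by (intro bigo_powr_le_ln_powr) auto
    finally show ?thesis .
  qed
  have inverse_powr: "(\<lambda>J::real. 1 / J powr a) = (\<lambda>J. J powr - a)" for a
    by (simp add: powr_minus_divide)
  \<comment> \<open>For \<open>p \<ge> 3\<close> the exponent 5/2 is enough, because
    \<open>eta p \<le> 2\<close>. For \<open>p < 3\<close> the choice \<open>r = p - 2\<close> is
    positive, as the threshold exceeds 2.\<close>
  have moment: "R \<in> O[at_top](\<lambda>J. 1 / J powr ((3 + eta p) / 2))"
    if p: "2 \<le> p" "p > (3 + sqrt 5) / 2" "integrable \<mu> (\<lambda>x. \<bar>x\<bar> powr p)" for p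
  proof (cases "3 \<le> p")
    case True
    have "eta p \<le> 2" using True by (simp add: eta_def pos_divide_le_eq)
    then show ?thesis
      unfolding R inverse_powr using pos integrable_cube_if_powr[OF True p(3)]
      by (intro remainder_bigo_third_moment) auto
  next
    case False
    have "2 < sqrt 5" by (rule real_less_rsqrt) simp
    then have p2: "2 < p" using p(2) by simp
    have "R \<in> O[at_top](\<lambda>J. J powr (- 2 - (p - 2) / 2))"
      unfolding R using p p2 False pos by (intro remainder_bigo_moment) auto
    also have "(\<lambda>J. J powr (- 2 - (p - 2) / 2)) \<in> O[at_top](\<lambda>J::real. J powr - ((3 + eta p) / 2))"
      using eta_le[of p] p False by (intro bigo_powr_mono) (simp add: field_simps)
    finally show ?thesis unfolding inverse_powr .
  qed
  \<comment> \<open>Here \<open>eta p + 1 \<le> 2\<close>, so the finite-variance bound is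
    enough.\<close>
  have small: "R \<in> O[at_top](\<lambda>J. 1 / J powr (eta p + 1))"
    if "2 \<le> p" "p \<le> (3 + sqrt 5) / 2" for p
  proof -
    have "R \<in> O[at_top](\<lambda>J. J powr - 2)"
      unfolding R by (rule remainder_bigo_inverse_square)
    also have "(\<lambda>J. J powr - 2) \<in> O[at_top](\<lambda>J::real. J powr - (eta p + 1))"
      using eta_le_1[OF that] by (intro bigo_powr_mono) simp
    finally show ?thesis unfolding inverse_powr .
  qed
  show ?thesis
    using cube[OF integrable_cube_if_normal[OF _ assms(5)], of "1 / 4" "5 / 2"]
      cube[OF integrable_cube_if_exp, of "1 / 6" "13 / 6"] moment small
    by auto
qed

end
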